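(* The inverse metric $(\cdot,\cdot):\Omega\otimes_{\mathcal{B}}\Omega\to\mathcal{B}$ on the quantum projective space and the generalized braiding $\sigma:\Omega\otimes_{\mathcal{B}}\Omega\to\Omega\otimes_{\mathcal{B}}\Omega$ satisfy $$(\cdot,\cdot)\circ\sigma(\partial p\otimes\bar\partial p)=q^{(\alpha_s,\alpha_s)}q^{2(\omega_s,2\rho)}\,(\cdot,\cdot)(\partial p\otimes\bar\partial p),$$ $$(\cdot,\cdot)\circ\sigma(\bar\partial p\otimes\partial p)=q^{-(\alpha_s,\alpha_s)}q^{-2(\omega_s,2\rho)}\,(\cdot,\cdot)(\bar\partial p\otimes\partial p).$$
   Context: **Quantum group data.** Fix an integer $r\ge 1$, a real number $0<q<1$ and $s\in\{1,r\}$. $U_q(\mathfrak{sl}_{r+1})$ is the quantized enveloping algebra with generators $K_i^{\pm1},E_i,F_i$, $1\le i\le r$ (Klimyk–Schmüdgen conventions: $\Delta(K_i)=K_i\otimes K_i$, $\Delta(E_i)=E_i\otimes K_i+1\otimes E_i$, $\Delta(F_i)=F_i\otimes 1+K_i^{-1}\otimes F_i$; $K_i$ acts on a vector of weight $\mu$ by $q^{(\alpha_i,\mu)}$). Here $\alpha_i$ are the simple roots, $\omega_i$ the fundamental weights, $\rho=\sum_i\omega_i$, $w_0$ the longest Weyl group element, $(\cdot,\cdot)$ on weights is the invariant form with $(\alpha_i,\alpha_i)=2$. Put $a=(\alpha_s,\alpha_s)=2$, $w=(\omega_s,\omega_s)$, $m=(\omega_s,2\rho)=r$. $V(\lambda)$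 is the simple type 1 module of highest weight $\lambda$, $V=V(\omega_s)$, and $V^*$ is its dual with $(Xf)(v)=f(S(X)v)$, $S$ the antipode. $\hat{R}_{X,Y}:X\otimes Y\to Y\otimes X$ is the braiding on finite-dimensional type 1 modules determined by being a module map with $\hat{R}_{V(\lambda),V(\mu)}(v\otimes u)=q^{(\lambda,w_0\mu)}u\otimes v$ for $v$ a highest weight vector of $V(\lambda)$ and $u$ a lowest weight vector of $V(\mu)$. Let $(v_i)$ be a weight basis of $V$ with weights $\lambda_i$ and dual basis $(f^i)$ of $V^*$. Define $\mathsf{E}(f^i\otimes v_j)=\delta_{ij}$, $\mathsf{E}'(v_i\otimes f^j)=q^{(\lambda_i,2\rho)}\delta_{ij}$, $\mathsf{C}=\sum_i v_i\otimes f^i$, $\mathsf{C}'=\sum_i q^{-(\lambda_i,2\rho)}f^i\otimes v_i$. Subscripts indicate the tensor legs on which a map acts ($\mathsf{C}_n,\mathsf{C}'_n$ insert the element at legs $n,n+1$); products of maps are compositions (rightmost first), legs being renumbered after each contraction or insertion. Put $$\mathsf{S}_{123}=(\hat{R}_{V,V^*})_{23}(\hat{R}_{V,V})_{12}(\hat{R}_{V,V^*}^{-1})_{23},\quad \tilde{\mathsf{S}}_{234}=(\hat{R}_{V,V^*})_{23}(\hat{R}_{V^*,V^*}^{-1})_{34}(\hat{R}_{V,V^*}^{-1})_{23},\quad \mathsf{T}_{1234}=\mathsf{S}_{123}\tilde{\mathsf{S}}_{234}=\tilde{\mathsf{S}}_{234}\mathsf{S}_{123}$$ (acting on $V\otimes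 V^*\otimes V$, $V^*\otimes V\otimes V^*$, $V\otimes V^*\otimes V\otimes V^*$ at the indicated legs). **Index-free notation.** A family $x=(x^{ij})_{1\le i,j\le r+1}$ is identified with $\sum_{i,j}v_i\otimes f^j\otimes x^{ij}$; products of families $xy$ (also $x\otimes y$, $(x,y)$) denote $\sum v_i\otimes f^j\otimes v_k\otimes f^l\otimes x^{ij}y^{kl}$ (resp. with $\otimes_{\mathcal{B}}$, the inverse metric), and similarly for more factors. The maps above act on the $V,V^*$ legs; other maps act on components. Elements such as $g_{+-}$ below carry no legs. **Algebra and first-order calculus.** $\mathcal{B}$ is the unital algebra generated by $p^{ij}$, $1\le i,j\le r+1$, with relations $\mathsf{S}_{123}pp=q^{w}pp$, $\tilde{\mathsf{S}}_{234}pp=q^{-w}pp$, $\mathsf{E}'_{12}p=q^{m}$. The Heckenberger–Kolb first-order differential calculus is $\Omega=\Omega_+\oplus\Omega_-$, with $\Omega_+,\Omega_-$ generated as left $\mathcal{B}$-modules by $\partial p^{ij}$, resp. $\bar\partial p^{ij}$, with relations $$\tilde{\mathsf{S}}_{234}p\,\partial p=q^{-w}p\,\partial p,\quad \mathsf{E}'_{12}\partial p=0,\qquad \mathsf{S}_{123}p\,\bar\partial p=q^{w}p\,\bar\partial p,\quad \mathsf{E}'_{12}\bar\partial p=0,$$ and right module structure $\partial p\,p=q^{a}\mathsf{T}_{1234}p\,\partial p$, $\bar\partial p\,p=q^{-a}\mathsf{T}_{1234}p\,\bar\partial p$. **Metric and inverse metric.** $g=g_{+-}+g_{-+}$ with $g_{+-}=\mathsf{E}'_{12}\mathsf{E}_{23}\,\partial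 p\otimes\bar\partial p$ and $g_{-+}=\mathsf{E}'_{12}\mathsf{E}_{23}\,\bar\partial p\otimes\partial p$ in $\Omega\otimes_{\mathcal{B}}\Omega$ (central elements). The inverse metric is the (well-defined) $\mathcal{B}$-bimodule map $(\cdot,\cdot):\Omega\otimes_{\mathcal{B}}\Omega\to\mathcal{B}$ with $(\partial p,\partial p)=(\bar\partial p,\bar\partial p)=0$, $(\partial p,\bar\partial p)=q^{a}q^{-w-m}\mathsf{S}_{123}\mathsf{C}_3p-q^{a}q^{-m}pp$, $(\bar\partial p,\partial p)=\mathsf{C}'_2p-q^{-m}pp$. **Generalized braiding.** $\sigma$ is the (well-defined) $\mathcal{B}$-bimodule map $\Omega\otimes_{\mathcal{B}}\Omega\to\Omega\otimes_{\mathcal{B}}\Omega$ given by $$\sigma(\partial p\otimes\partial p)=q^{a}\mathsf{S}_{123}\tilde{\mathsf{S}}_{234}\,\partial p\otimes\partial p,\qquad \sigma(\bar\partial p\otimes\bar\partial p)=q^{-a}\mathsf{S}_{123}\tilde{\mathsf{S}}_{234}\,\bar\partial p\otimes\bar\partial p,$$ $$\sigma(\partial p\otimes\bar\partial p)=q^{2a-2w}\mathsf{S}_{123}\tilde{\mathsf{S}}_{234}^{-1}\,\bar\partial p\otimes\partial p+(1-q^{a})q^{a}q^{-m}\,p\,g_{-+}\,p,$$ $$\sigma(\bar\partial p\otimes\partial p)=q^{2w-2a}\mathsf{S}_{123}^{-1}\tilde{\mathsf{S}}_{234}\,\partial p\otimes\bar\partial p+(1-q^{-a})q^{-m}\,p\,g_{+-}\,p.$$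 *)

theory Defs
  imports
    "HOL-Analysis.Analysis"
    "HOL-Library.Function_Algebras"
    "HOL-Library.Poly_Mapping"
begin

section \<open>Complex vector spaces and unital complex algebras\<close>

class cvector = ab_group_add +
  fixes scaleC :: "complex \<Rightarrow> 'a \<Rightarrow> 'a"  (infixr "*\<^sub>C" 75)
  assumes scaleC_add_right: "c *\<^sub>C (x + y) = c *\<^sub>C x + c *\<^sub>C y"
    and scaleC_add_left: "(c + d) *\<^sub>C x = c *\<^sub>C x + d *\<^sub>C x"
    and scaleC_scaleC: "c *\<^sub>C (d *\<^sub>C x) = (c * d) *\<^sub>C x"
    and scaleC_one: "1 *\<^sub>C x = x"
begin

lemma scaleC_zero_right [simp]: "c *\<^sub>C 0 = 0"
  using scaleC_add_right[of c 0 0] by simp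

end

class calgebra_1 = cvector + ring_1 +
  assumes mult_scaleC_left: "(c *\<^sub>C x) * y = c *\<^sub>C (x * y)"
    and mult_scaleC_right: "x * (c *\<^sub>C y) = c *\<^sub>C (x * y)"

instantiation complex :: calgebra_1
begin
definition "scaleC (c::complex) (x::complex) = c * x"
instance by standard (simp_all add: scaleC_complex_def algebra_simps)
end

instantiation "fun" :: (type, cvector) cvector
begin
definition "scaleC c (f :: 'a \<Rightarrow> 'b) = (\<lambda>x. c *\<^sub>C f x)"
instance
  by standard
    (simp_all add: scaleC_fun_def fun_eq_iff scaleC_add_right scaleC_add_left
      scaleC_scaleC scaleC_one)
end

instantiation poly_mapping :: (type, cvector) cvector
begin
definition "scaleC c (f :: 'a \<Rightarrow>\<^sub>0 'b) = Poly_Mapping.map (scaleC c) f"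

lemma lookup_scaleC: "Poly_Mapping.lookup (c *\<^sub>C f) k = c *\<^sub>C Poly_Mapping.lookup f k"
  for f :: "'a \<Rightarrow>\<^sub>0 'b"
  by (simp add: scaleC_poly_mapping_def map.rep_eq when_def)

instance
  by standard
    (simp_all add: poly_mapping_eq_iff fun_eq_iff lookup_scaleC lookup_add
      scaleC_add_right scaleC_add_left scaleC_scaleC scaleC_one)
end

section \<open>Presentations by generators and relations\<close>

text \<open>Linear extension to formal complex combinations, and the additive subgroup
  generated by a set.\<close>

definition lin_ext :: "('k \<Rightarrow> 'm::cvector) \<Rightarrow> ('k \<Rightarrow>\<^sub>0 complex) \<Rightarrow> 'm" where
  "lin_ext \<phi> f = (\<Sum>k\<in>Poly_Mapping.keys f. Poly_Mapping.lookup f k *\<^sub>C \<phi> k)"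

inductive_set add_span :: "'m::ab_group_add set \<Rightarrow> 'm set" for G where
  zero: "0 \<in> add_span G"
| base: "g \<in> G \<Longrightarrow> g \<in> add_span G"
| diff: "x \<in> add_span G \<Longrightarrow> y \<in> add_span G \<Longrightarrow> x - y \<in> add_span G"

text \<open>Words form a monoid under concatenation, written additively so that the
  convolution product on finitely supported complex functions of words is that of the free
  complex algebra on \<^typ>\<open>'x\<close>.\<close>

datatype 'x word = Word (letters: "'x list")

instantiation word :: (type) monoid_add
begin
definition "0 = Word []"
definition "u + v = Word (letters u @ letters v)"
instance
proof
  fix a b c :: "'a word"
  show "a + b + c = a + (b + c)" by (simp add: plus_word_def)
  show "0 + a = a" by (simp add: plus_word_def zero_word_def)
  show "a + 0 = a" by (simp add: plus_word_def zero_word_def)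
qed
end

definition ideal_of :: "'c::ring_1 set \<Rightarrow> 'c set" where
  "ideal_of R = add_span {x * f * y | x f y. f \<in> R}"

definition free_gen :: "'x \<Rightarrow> 'x word \<Rightarrow>\<^sub>0 complex" where
  "free_gen x = Poly_Mapping.single (Word [x]) 1"

definition presented_algebra :: "('x \<Rightarrow> 'b::calgebra_1) \<Rightarrow> ('x word \<Rightarrow>\<^sub>0 complex) set \<Rightarrow> bool" where
  "presented_algebra g R \<longleftrightarrow>
     (let ev = lin_ext (\<lambda>w. prod_list (map g (letters w)))
      in surj ev \<and> (\<forall>f. ev f = 0 \<longleftrightarrow> f \<in> ideal_of R))"

text \<open>The free left module on a finite type \<^typ>\<open>'x\<close> consists of the functions
  \<^typ>\<open>'x \<Rightarrow> 'b\<close>.\<close>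

definition free_lact :: "'b::ring_1 \<Rightarrow> ('x \<Rightarrow> 'b) \<Rightarrow> 'x \<Rightarrow> 'b" where
  "free_lact c \<beta> = (\<lambda>x. c * \<beta> x)"

definition free_basis :: "'x \<Rightarrow> 'x \<Rightarrow> 'b::ring_1" where
  "free_basis x = (\<lambda>y. if y = x then 1 else 0)"

definition lcomb :: "('b \<Rightarrow> 'm \<Rightarrow> 'm::ab_group_add) \<Rightarrow> ('x::finite \<Rightarrow> 'm) \<Rightarrow> ('x \<Rightarrow> 'b) \<Rightarrow> 'm" where
  "lcomb lact g \<beta> = (\<Sum>x\<in>UNIV. lact (\<beta> x) (g x))"

text \<open>The left submodule generated by \<open>g\<close>, namely \<open>range (lcomb lact g)\<close>, is
  presented by the generators \<open>g\<close> and the relations \<open>R\<close>.\<close>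

definition presented_left_module ::
  "('b::ring_1 \<Rightarrow> 'm \<Rightarrow> 'm::ab_group_add) \<Rightarrow> ('x::finite \<Rightarrow> 'm) \<Rightarrow> ('x \<Rightarrow> 'b) set \<Rightarrow> bool" where
  "presented_left_module lact g R \<longleftrightarrow>
     (\<forall>\<beta>. lcomb lact g \<beta> = 0 \<longleftrightarrow> \<beta> \<in> add_span {free_lact c \<rho> | c \<rho>. \<rho> \<in> R})"

section \<open>Bimodules and their tensor product\<close>

locale cbimodule =
  fixes lact :: "'b::calgebra_1 \<Rightarrow> 'm::cvector \<Rightarrow> 'm"
    and ract :: "'m \<Rightarrow> 'b \<Rightarrow> 'm"
  assumes lact_add_left: "lact (b + c) x = lact b x + lact c x"
    and lact_add_right: "lact b (x + y) = lact b x + lact b y"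
    and lact_mult: "lact (b * c) x = lact b (lact c x)"
    and lact_scaleC_one: "lact (\<kappa> *\<^sub>C 1) x = \<kappa> *\<^sub>C x"
    and ract_add_left: "ract (x + y) b = ract x b + ract y b"
    and ract_add_right: "ract x (b + c) = ract x b + ract x c"
    and ract_mult: "ract x (b * c) = ract (ract x b) c"
    and ract_scaleC_one: "ract x (\<kappa> *\<^sub>C 1) = \<kappa> *\<^sub>C x"
    and lact_ract: "lact b (ract x c) = ract (lact b x) c"

definition bimodule_map ::
  "('b \<Rightarrow> 'm::cvector \<Rightarrow> 'm) \<Rightarrow> ('m \<Rightarrow> 'b \<Rightarrow> 'm) \<Rightarrow>
   ('b \<Rightarrow> 'l::cvector \<Rightarrow> 'l) \<Rightarrow> ('l \<Rightarrow> 'b \<Rightarrow> 'l) \<Rightarrow> ('m \<Rightarrow> 'l) \<Rightarrow> bool" where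
  "bimodule_map lm rm ll rl h \<longleftrightarrow>
     (\<forall>x y. h (x + y) = h x + h y) \<and>
     (\<forall>b x. h (lm b x) = ll b (h x)) \<and>
     (\<forall>b x. h (rm x b) = rl (h x) b)"

definition balanced_relations ::
  "('b \<Rightarrow> 'o::cvector \<Rightarrow> 'o) \<Rightarrow> ('o \<Rightarrow> 'b \<Rightarrow> 'o) \<Rightarrow> ('o \<times> 'o \<Rightarrow>\<^sub>0 complex) set" where
  "balanced_relations lact ract =
     (let e = (\<lambda>x y. Poly_Mapping.single (x, y) 1)
      in {e (x + x') y - e x y - e x' y | x x' y. True}
       \<union> {e x (y + y') - e x y - e x y' | x y y'. True}
       \<union> {e (\<kappa> *\<^sub>C x) y - \<kappa> *\<^sub>C e x y | \<kappa> x y. True}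
       \<union> {e x (\<kappa> *\<^sub>C y) - \<kappa> *\<^sub>C e x y | \<kappa> x y. True}
       \<union> {e (ract x b) y - e x (lact b y) | x b y. True})"

text \<open>The bimodule \<^typ>\<open>'t\<close> with actions \<open>lt\<close>, \<open>rt\<close> is, via \<open>tens\<close>, the tensor square
  over \<^typ>\<open>'b\<close> of the bimodule \<^typ>\<open>'o\<close> with actions \<open>lact\<close>, \<open>ract\<close>.\<close>

definition is_tensor_square ::
  "('b::calgebra_1 \<Rightarrow> 'o::cvector \<Rightarrow> 'o) \<Rightarrow> ('o \<Rightarrow> 'b \<Rightarrow> 'o) \<Rightarrow>
   ('b \<Rightarrow> 't::cvector \<Rightarrow> 't) \<Rightarrow> ('t \<Rightarrow> 'b \<Rightarrow> 't) \<Rightarrow> ('o \<Rightarrow> 'o \<Rightarrow> 't) \<Rightarrow> bool" where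
  "is_tensor_square lact ract lt rt tens \<longleftrightarrow>
     cbimodule lt rt \<and>
     (\<forall>b x y. lt b (tens x y) = tens (lact b x) y) \<and>
     (\<forall>b x y. rt (tens x y) b = tens x (ract y b)) \<and>
     surj (lin_ext (\<lambda>(x, y). tens x y)) \<and>
     (\<forall>f. lin_ext (\<lambda>(x, y). tens x y) f = 0 \<longleftrightarrow>
          f \<in> add_span {\<kappa> *\<^sub>C h | \<kappa> h. h \<in> balanced_relations lact ract})"

section \<open>Weights of \<open>sl\<^bsub>r+1\<^esub>\<close>\<close>

text \<open>Weights of \<open>sl\<^bsub>r+1\<^esub>\<close> are written in the standard orthonormal coordinates
  \<open>\<epsilon>\<^sub>1, \<dots>, \<epsilon>\<^bsub>r+1\<^esub>\<close> (vectors with coordinate sum 0, extended by 0 outside \<open>1, \<dots>, r+1\<close>);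
  the invariant form normalised by \<open>(\<alpha>\<^sub>i, \<alpha>\<^sub>i) = 2\<close> is then the dot product.\<close>

type_synonym weight = "nat \<Rightarrow> real"

definition wform :: "nat \<Rightarrow> weight \<Rightarrow> weight \<Rightarrow> real" where
  "wform r \<mu> \<nu> = (\<Sum>j=1..r+1. \<mu> j * \<nu> j)"

definition sroot :: "nat \<Rightarrow> weight" where
  "sroot i = (\<lambda>j. of_bool (j = i) - of_bool (j = Suc i))"

definition fweight :: "nat \<Rightarrow> nat \<Rightarrow> weight" where
  "fweight r i = (\<lambda>j. of_bool (1 \<le> j \<and> j \<le> i) - of_bool (1 \<le> j \<and> j \<le> r + 1) * (real i / real (r + 1)))"

definition two_rho :: "nat \<Rightarrow> weight" where
  "two_rho r = (\<lambda>j. 2 * (\<Sum>i=1..r. fweight r i j))"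

definition weight_lattice :: "nat \<Rightarrow> weight set" where
  "weight_lattice r = {\<lambda>j. \<Sum>i=1..r. real_of_int (c i) * fweight r i j | c. True}"

text \<open>The Weyl group is the symmetric group permuting the coordinates; its longest
  element is their reversal.\<close>

definition w0 :: "nat \<Rightarrow> weight \<Rightarrow> weight" where
  "w0 r \<mu> = (\<lambda>j. if 1 \<le> j \<and> j \<le> r + 1 then \<mu> (r + 2 - j) else 0)"

section \<open>Modules over \<open>U\<^sub>q(sl\<^bsub>r+1\<^esub>)\<close> and their braiding\<close>

definition qpow :: "real \<Rightarrow> real \<Rightarrow> complex" where
  "qpow q x = complex_of_real (q powr x)"

text \<open>The action of the generators \<open>K\<^sub>i, K\<^sub>i\<^sup>-\<^sup>1, E\<^sub>i, F\<^sub>i\<close> (\<open>1 \<le> i \<le> r\<close>) as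
  matrices with respect to a basis indexed by \<^typ>\<open>'d\<close>.\<close>

record ('d::finite) uq_rep =
  Kmat :: "nat \<Rightarrow> complex^'d^'d"
  Kinv :: "nat \<Rightarrow> complex^'d^'d"
  Emat :: "nat \<Rightarrow> complex^'d^'d"
  Fmat :: "nat \<Rightarrow> complex^'d^'d"

definition q_serre :: "real \<Rightarrow> (nat \<Rightarrow> complex^'d^'d) \<Rightarrow> nat \<Rightarrow> nat \<Rightarrow> bool" where
  "q_serre q X i j \<longleftrightarrow>
     (if i = Suc j \<or> j = Suc i
      then X i ** X i ** X j - mat (qpow q 1 + qpow q (-1)) ** X i ** X j ** X i
             + X j ** X i ** X i = 0
      else X i ** X j = X j ** X i)"

definition uq_module :: "nat \<Rightarrow> real \<Rightarrow> 'd::finite uq_rep \<Rightarrow> bool" where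
  "uq_module r q X \<longleftrightarrow>
     (\<forall>i\<in>{1..r}. Kmat X i ** Kinv X i = mat 1 \<and> Kinv X i ** Kmat X i = mat 1) \<and>
     (\<forall>i\<in>{1..r}. \<forall>j\<in>{1..r}.
        Kmat X i ** Kmat X j = Kmat X j ** Kmat X i \<and>
        Kmat X i ** Emat X j ** Kinv X i = mat (qpow q (wform r (sroot i) (sroot j))) ** Emat X j \<and>
        Kmat X i ** Fmat X j ** Kinv X i = mat (qpow q (- wform r (sroot i) (sroot j))) ** Fmat X j \<and>
        Emat X i ** Fmat X j - Fmat X j ** Emat X i =
          (if i = j then mat (1 / (qpow q 1 - qpow q (-1))) ** (Kmat X i - Kinv X i) else 0) \<and>
        q_serre q (Emat X) i j \<and> q_serre q (Fmat X) i j)"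

definition weight_vector :: "nat \<Rightarrow> real \<Rightarrow> 'd::finite uq_rep \<Rightarrow> weight \<Rightarrow> complex^'d \<Rightarrow> bool" where
  "weight_vector r q X \<mu> x \<longleftrightarrow> \<mu> \<in> weight_lattice r \<and> x \<noteq> 0 \<and>
     (\<forall>i\<in>{1..r}. Kmat X i *v x = qpow q (wform r (sroot i) \<mu>) *s x)"

definition highest_weight_vector :: "nat \<Rightarrow> real \<Rightarrow> 'd::finite uq_rep \<Rightarrow> weight \<Rightarrow> complex^'d \<Rightarrow> bool" where
  "highest_weight_vector r q X \<mu> x \<longleftrightarrow>
     weight_vector r q X \<mu> x \<and> (\<forall>i\<in>{1..r}. Emat X i *v x = 0)"

definition lowest_weight_vector :: "nat \<Rightarrow> real \<Rightarrow> 'd::finite uq_rep \<Rightarrow> weight \<Rightarrow> complex^'d \<Rightarrow> bool" where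
  "lowest_weight_vector r q X \<mu> x \<longleftrightarrow>
     weight_vector r q X \<mu> x \<and> (\<forall>i\<in>{1..r}. Fmat X i *v x = 0)"

definition simple_module :: "nat \<Rightarrow> real \<Rightarrow> 'd::finite uq_rep \<Rightarrow> bool" where
  "simple_module r q X \<longleftrightarrow> uq_module r q X \<and>
     (\<forall>W. vec.subspace W \<and>
        (\<forall>i\<in>{1..r}. \<forall>x\<in>W. Kmat X i *v x \<in> W \<and> Kinv X i *v x \<in> W \<and>
                             Emat X i *v x \<in> W \<and> Fmat X i *v x \<in> W)
        \<longrightarrow> W = {0} \<or> W = UNIV)"

text \<open>\<open>X\<close> is the simple type 1 module \<open>V(\<mu>)\<close>.\<close>

definition is_V :: "nat \<Rightarrow> real \<Rightarrow> weight \<Rightarrow> 'd::finite uq_rep \<Rightarrow> bool" where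
  "is_V r q \<mu> X \<longleftrightarrow> simple_module r q X \<and> (\<exists>x. highest_weight_vector r q X \<mu> x)"

text \<open>The dual, in the dual basis: \<open>X\<close> acts by the transpose of \<open>S(X)\<close>, where
  \<open>S(K\<^sub>i) = K\<^sub>i\<^sup>-\<^sup>1\<close>, \<open>S(E\<^sub>i) = - E\<^sub>i K\<^sub>i\<^sup>-\<^sup>1\<close>, \<open>S(F\<^sub>i) = - K\<^sub>i F\<^sub>i\<close>.\<close>

definition dual_rep :: "'d::finite uq_rep \<Rightarrow> 'd uq_rep" where
  "dual_rep X = \<lparr> Kmat = (\<lambda>i. transpose (Kinv X i)),
                  Kinv = (\<lambda>i. transpose (Kmat X i)),
                  Emat = (\<lambda>i. transpose (- (Emat X i ** Kinv X i))),
                  Fmat = (\<lambda>i. transpose (- (Kmat X i ** Fmat X i))) \<rparr>"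

definition kron :: "complex^'a^'a \<Rightarrow> complex^'b^'b \<Rightarrow> complex^('a::finite \<times> 'b::finite)^('a \<times> 'b)" where
  "kron A B = (\<chi> x y. A $ fst x $ fst y * B $ snd x $ snd y)"

definition tensor_vec :: "complex^'a \<Rightarrow> complex^'b \<Rightarrow> complex^('a::finite \<times> 'b::finite)" where
  "tensor_vec x y = (\<chi> z. x $ fst z * y $ snd z)"

definition tensor_rep :: "'a::finite uq_rep \<Rightarrow> 'b::finite uq_rep \<Rightarrow> ('a \<times> 'b) uq_rep" where
  "tensor_rep X Y = \<lparr> Kmat = (\<lambda>i. kron (Kmat X i) (Kmat Y i)),
                      Kinv = (\<lambda>i. kron (Kinv X i) (Kinv Y i)),
                      Emat = (\<lambda>i. kron (Emat X i) (Kmat Y i) + kron (mat 1) (Emat Y i)),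
                      Fmat = (\<lambda>i. kron (Fmat X i) (mat 1) + kron (Kinv X i) (Fmat Y i)) \<rparr>"

text \<open>The braiding of simple modules \<open>X\<close>, \<open>Y\<close>; the row index of \<open>R\<close> refers to \<open>Y \<otimes> X\<close>
  and the column index to \<open>X \<otimes> Y\<close>.\<close>

definition is_braiding :: "nat \<Rightarrow> real \<Rightarrow> 'a::finite uq_rep \<Rightarrow> 'b::finite uq_rep \<Rightarrow>
    complex^('a \<times> 'b)^('b \<times> 'a) \<Rightarrow> bool" where
  "is_braiding r q X Y R \<longleftrightarrow>
     (\<forall>i\<in>{1..r}.
        R ** Kmat (tensor_rep X Y) i = Kmat (tensor_rep Y X) i ** R \<and>
        R ** Kinv (tensor_rep X Y) i = Kinv (tensor_rep Y X) i ** R \<and>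
        R ** Emat (tensor_rep X Y) i = Emat (tensor_rep Y X) i ** R \<and>
        R ** Fmat (tensor_rep X Y) i = Fmat (tensor_rep Y X) i ** R) \<and>
     (\<forall>l m x y. is_V r q l X \<and> is_V r q m Y \<and>
        highest_weight_vector r q X l x \<and> lowest_weight_vector r q Y (w0 r m) y \<longrightarrow>
        R *v tensor_vec x y = qpow q (wform r l (w0 r m)) *s tensor_vec y x)"

section \<open>Data of the quantum projective space\<close>

text \<open>The rank is \<open>r\<close>, the node \<open>s\<close>. \<open>V = V(\<omega>\<^sub>s)\<close> is given by its matrices in a weight basis \<open>(v\<^sub>i)\<close> indexed by \<^typ>\<open>'n\<close>, a type
  with \<open>r + 1\<close> elements; \<open>v\<^sub>i\<close> has weight \<open>wts i\<close>. The dual basis of the dual module has the same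
  index type, so every leg, \<open>V\<close> or dual, is indexed by \<^typ>\<open>'n\<close>.\<close>

record ('n::finite) qps =
  rk :: nat
  node :: nat
  qpar :: real
  Vrep :: "'n uq_rep"
  wts :: "'n \<Rightarrow> weight"
  R_V_V :: "complex^('n \<times> 'n)^('n \<times> 'n)"
  R_V_Vd :: "complex^('n \<times> 'n)^('n \<times> 'n)"
  R_Vd_Vd :: "complex^('n \<times> 'n)^('n \<times> 'n)"

definition qps_data :: "'n::finite qps \<Rightarrow> bool" where
  "qps_data D \<longleftrightarrow>
     1 \<le> rk D \<and> CARD('n) = rk D + 1 \<and> node D \<in> {1, rk D} \<and> 0 < qpar D \<and> qpar D < 1 \<and>
     is_V (rk D) (qpar D) (fweight (rk D) (node D)) (Vrep D) \<and>
     (\<forall>i. weight_vector (rk D) (qpar D) (Vrep D) (wts D i) (axis i 1)) \<and>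
     is_braiding (rk D) (qpar D) (Vrep D) (Vrep D) (R_V_V D) \<and>
     is_braiding (rk D) (qpar D) (Vrep D) (dual_rep (Vrep D)) (R_V_Vd D) \<and>
     is_braiding (rk D) (qpar D) (dual_rep (Vrep D)) (dual_rep (Vrep D)) (R_Vd_Vd D)"

definition const_a :: "'n::finite qps \<Rightarrow> real" where
  "const_a D = wform (rk D) (sroot (node D)) (sroot (node D))"

definition const_w :: "'n::finite qps \<Rightarrow> real" where
  "const_w D = wform (rk D) (fweight (rk D) (node D)) (fweight (rk D) (node D))"

definition const_m :: "'n::finite qps \<Rightarrow> real" where
  "const_m D = wform (rk D) (fweight (rk D) (node D)) (two_rho (rk D))"

abbreviation qp :: "'n::finite qps \<Rightarrow> real \<Rightarrow> complex" where
  "qp D x \<equiv> qpow (qpar D) x"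

definition leg12 :: "complex^('n \<times> 'n)^('n \<times> 'n) \<Rightarrow> complex^('n \<times> 'n \<times> 'n)^('n::finite \<times> 'n \<times> 'n)" where
  "leg12 A = (\<chi> x y. case (x, y) of ((i, j, k), (i', j', k')) \<Rightarrow> A $ (i, j) $ (i', j') * of_bool (k = k'))"

definition leg23 :: "complex^('n \<times> 'n)^('n \<times> 'n) \<Rightarrow> complex^('n \<times> 'n \<times> 'n)^('n::finite \<times> 'n \<times> 'n)" where
  "leg23 A = (\<chi> x y. case (x, y) of ((i, j, k), (i', j', k')) \<Rightarrow> of_bool (i = i') * A $ (j, k) $ (j', k'))"

definition S_op :: "'n qps \<Rightarrow> complex^('n \<times> 'n \<times> 'n)^('n::finite \<times> 'n \<times> 'n)" where
  "S_op D = leg23 (R_V_Vd D) ** leg12 (R_V_V D) ** leg23 (matrix_inv (R_V_Vd D))"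

text \<open>The three legs of \<open>S\<^sup>~\<close> carry the labels 2, 3, 4 within the fourfold tensor product.\<close>

definition St_op :: "'n qps \<Rightarrow> complex^('n \<times> 'n \<times> 'n)^('n::finite \<times> 'n \<times> 'n)" where
  "St_op D = leg12 (R_V_Vd D) ** leg23 (matrix_inv (R_Vd_Vd D)) ** leg12 (matrix_inv (R_V_Vd D))"

section \<open>Families\<close>

text \<open>A family \<open>x i j k l\<close> stands for \<open>\<Sum> v\<^sub>i \<otimes> f\<^sup>j \<otimes> v\<^sub>k \<otimes> f\<^sup>l \<otimes> x i j k l\<close>.\<close>

type_synonym ('n, 'm) fam2 = "'n \<Rightarrow> 'n \<Rightarrow> 'm"
type_synonym ('n, 'm) fam4 = "'n \<Rightarrow> 'n \<Rightarrow> 'n \<Rightarrow> 'n \<Rightarrow> 'm"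

definition fprod :: "('x \<Rightarrow> 'y \<Rightarrow> 'z) \<Rightarrow> ('n, 'x) fam2 \<Rightarrow> ('n, 'y) fam2 \<Rightarrow> ('n, 'z) fam4" where
  "fprod \<mu> x y = (\<lambda>i j k l. \<mu> (x i j) (y k l))"

definition at123 :: "complex^('n \<times> 'n \<times> 'n)^('n::finite \<times> 'n \<times> 'n) \<Rightarrow> ('n, 'm::cvector) fam4 \<Rightarrow> ('n, 'm) fam4" where
  "at123 A x = (\<lambda>i j k l. \<Sum>(i', j', k')\<in>UNIV. A $ (i, j, k) $ (i', j', k') *\<^sub>C x i' j' k' l)"

definition at234 :: "complex^('n \<times> 'n \<times> 'n)^('n::finite \<times> 'n \<times> 'n) \<Rightarrow> ('n, 'm::cvector) fam4 \<Rightarrow> ('n, 'm) fam4" where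
  "at234 A x = (\<lambda>i j k l. \<Sum>(j', k', l')\<in>UNIV. A $ (j, k, l) $ (j', k', l') *\<^sub>C x i j' k' l')"

definition T_op :: "'n::finite qps \<Rightarrow> ('n, 'm::cvector) fam4 \<Rightarrow> ('n, 'm) fam4" where
  "T_op D x = at123 (S_op D) (at234 (St_op D) x)"

definition E'12 :: "'n::finite qps \<Rightarrow> ('n, 'm::cvector) fam2 \<Rightarrow> 'm" where
  "E'12 D x = (\<Sum>i\<in>UNIV. qp D (wform (rk D) (wts D i) (two_rho (rk D))) *\<^sub>C x i i)"

definition E23 :: "('n::finite, 'm::cvector) fam4 \<Rightarrow> ('n, 'm) fam2" where
  "E23 x = (\<lambda>i l. \<Sum>j\<in>UNIV. x i j j l)"

definition C3 :: "('n, 'm::cvector) fam2 \<Rightarrow> ('n, 'm) fam4" where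
  "C3 x = (\<lambda>i j k l. if k = l then x i j else 0)"

definition C'2 :: "'n::finite qps \<Rightarrow> ('n, 'm::cvector) fam2 \<Rightarrow> ('n, 'm) fam4" where
  "C'2 D x = (\<lambda>i j k l. if j = k then qp D (- wform (rk D) (wts D j) (two_rho (rk D))) *\<^sub>C x i l else 0)"

definition entries :: "('n, 'm) fam4 \<Rightarrow> 'm set" where
  "entries x = {x i j k l | i j k l. True}"

section \<open>The algebra, the calculus, the metric and the generalized braiding\<close>

definition B_relations :: "'n::finite qps \<Rightarrow> ('n, 'c::{cvector, ring_1}) fam2 \<Rightarrow> 'c set" where
  "B_relations D p =
     entries (at123 (S_op D) (fprod (*) p p) - qp D (const_w D) *\<^sub>C fprod (*) p p) \<union>
     entries (at234 (St_op D) (fprod (*) p p) - qp D (- const_w D) *\<^sub>C fprod (*) p p) \<union>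
     {E'12 D p - qp D (const_m D) *\<^sub>C 1}"

definition is_qps_algebra :: "'n::finite qps \<Rightarrow> ('n, 'b::calgebra_1) fam2 \<Rightarrow> bool" where
  "is_qps_algebra D p \<longleftrightarrow>
     presented_algebra (\<lambda>(i, j). p i j) (B_relations D (\<lambda>i j. free_gen (i, j)))"

definition holomorphic_relations ::
  "'n::finite qps \<Rightarrow> ('n, 'b) fam2 \<Rightarrow> ('b \<Rightarrow> 'm::cvector \<Rightarrow> 'm) \<Rightarrow> ('n, 'm) fam2 \<Rightarrow> 'm set" where
  "holomorphic_relations D p lact dp =
     entries (at234 (St_op D) (fprod lact p dp) - qp D (- const_w D) *\<^sub>C fprod lact p dp) \<union>
     {E'12 D dp}"

definition antiholomorphic_relations ::
  "'n::finite qps \<Rightarrow> ('n, 'b) fam2 \<Rightarrow> ('b \<Rightarrow> 'm::cvector \<Rightarrow> 'm) \<Rightarrow> ('n, 'm) fam2 \<Rightarrow> 'm set" where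
  "antiholomorphic_relations D p lact dbp =
     entries (at123 (S_op D) (fprod lact p dbp) - qp D (const_w D) *\<^sub>C fprod lact p dbp) \<union>
     {E'12 D dbp}"

text \<open>\<open>dp\<close> and \<open>dbp\<close> are the families of the \<open>\<partial>p\<^sup>i\<^sup>j\<close> and their antiholomorphic
  counterparts. The relations are evaluated in the free left module on the index pairs.\<close>

definition is_hk_calculus ::
  "'n::finite qps \<Rightarrow> ('n, 'b::calgebra_1) fam2 \<Rightarrow>
   ('b \<Rightarrow> 'o::cvector \<Rightarrow> 'o) \<Rightarrow> ('o \<Rightarrow> 'b \<Rightarrow> 'o) \<Rightarrow> ('n, 'o) fam2 \<Rightarrow> ('n, 'o) fam2 \<Rightarrow> bool" where
  "is_hk_calculus D p lact ract dp dbp \<longleftrightarrow>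
     cbimodule lact ract \<and>
     presented_left_module lact (\<lambda>(i, j). dp i j)
       (holomorphic_relations D p free_lact (\<lambda>i j. free_basis (i, j))) \<and>
     presented_left_module lact (\<lambda>(i, j). dbp i j)
       (antiholomorphic_relations D p free_lact (\<lambda>i j. free_basis (i, j))) \<and>
     (\<forall>z. \<exists>!xy. xy \<in> range (lcomb lact (\<lambda>(i, j). dp i j)) \<times> range (lcomb lact (\<lambda>(i, j). dbp i j)) \<and>
                z = fst xy + snd xy) \<and>
     fprod ract dp p = qp D (const_a D) *\<^sub>C T_op D (fprod lact p dp) \<and>
     fprod ract dbp p = qp D (- const_a D) *\<^sub>C T_op D (fprod lact p dbp)"

definition g_pm :: "'n::finite qps \<Rightarrow> ('o \<Rightarrow> 'o \<Rightarrow> 't::cvector) \<Rightarrow> ('n, 'o) fam2 \<Rightarrow> ('n, 'o) fam2 \<Rightarrow> 't" where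
  "g_pm D tens dp dbp = E'12 D (E23 (fprod tens dp dbp))"

definition g_mp :: "'n::finite qps \<Rightarrow> ('o \<Rightarrow> 'o \<Rightarrow> 't::cvector) \<Rightarrow> ('n, 'o) fam2 \<Rightarrow> ('n, 'o) fam2 \<Rightarrow> 't" where
  "g_mp D tens dp dbp = E'12 D (E23 (fprod tens dbp dp))"

definition is_inverse_metric ::
  "'n::finite qps \<Rightarrow> ('n, 'b::calgebra_1) fam2 \<Rightarrow>
   ('b \<Rightarrow> 't::cvector \<Rightarrow> 't) \<Rightarrow> ('t \<Rightarrow> 'b \<Rightarrow> 't) \<Rightarrow> ('o \<Rightarrow> 'o \<Rightarrow> 't) \<Rightarrow>
   ('n, 'o) fam2 \<Rightarrow> ('n, 'o) fam2 \<Rightarrow> ('t \<Rightarrow> 'b) \<Rightarrow> bool" where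
  "is_inverse_metric D p lt rt tens dp dbp met \<longleftrightarrow>
     (let a = const_a D; w = const_w D; m = const_m D;
          pair = (\<lambda>x y. met (tens x y))
      in bimodule_map lt rt (*) (*) met \<and>
         fprod pair dp dp = 0 \<and>
         fprod pair dbp dbp = 0 \<and>
         fprod pair dp dbp =
           (qp D a * qp D (- w - m)) *\<^sub>C at123 (S_op D) (C3 p) - (qp D a * qp D (- m)) *\<^sub>C fprod (*) p p \<and>
         fprod pair dbp dp = C'2 D p - qp D (- m) *\<^sub>C fprod (*) p p)"

definition is_generalized_braiding ::
  "'n::finite qps \<Rightarrow> ('n, 'b::calgebra_1) fam2 \<Rightarrow>
   ('b \<Rightarrow> 't::cvector \<Rightarrow> 't) \<Rightarrow> ('t \<Rightarrow> 'b \<Rightarrow> 't) \<Rightarrow> ('o \<Rightarrow> 'o \<Rightarrow> 't) \<Rightarrow>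
   ('n, 'o) fam2 \<Rightarrow> ('n, 'o) fam2 \<Rightarrow> ('t \<Rightarrow> 't) \<Rightarrow> bool" where
  "is_generalized_braiding D p lt rt tens dp dbp \<sigma> \<longleftrightarrow>
     (let a = const_a D; w = const_w D; m = const_m D;
          S = S_op D; St = St_op D;
          \<sigma>t = (\<lambda>x y. \<sigma> (tens x y));
          p_g_p = (\<lambda>g. fprod (\<lambda>b c. lt b (rt g c)) p p)
      in bimodule_map lt rt lt rt \<sigma> \<and>
         fprod \<sigma>t dp dp = qp D a *\<^sub>C at123 S (at234 St (fprod tens dp dp)) \<and>
         fprod \<sigma>t dbp dbp = qp D (- a) *\<^sub>C at123 S (at234 St (fprod tens dbp dbp)) \<and>
         fprod \<sigma>t dp dbp =
           qp D (2 * a - 2 * w) *\<^sub>C at123 S (at234 (matrix_inv St) (fprod tens dbp dp)) +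
           ((1 - qp D a) * qp D a * qp D (- m)) *\<^sub>C p_g_p (g_mp D tens dp dbp) \<and>
         fprod \<sigma>t dbp dp =
           qp D (2 * w - 2 * a) *\<^sub>C at123 (matrix_inv S) (at234 St (fprod tens dp dbp)) +
           ((1 - qp D (- a)) * qp D (- m)) *\<^sub>C p_g_p (g_pm D tens dp dbp))"

end

theory Submission
  imports Defs
begin

text \<open>
  Apply the inverse metric to the formulas for the braiding. It is a bimodule map, so it passes through the
  operators on the legs, and the claim becomes an identity between families in the algebra. On
  \<open>\<partial>p\<close> tensored with its antiholomorphic counterpart the left-hand side consists of \<open>S S\<^sup>~\<^sup>-\<^sup>1\<close> applied to
  \<open>C' p - q\<^bsup>-m\<^esup> pp\<close> and of a multiple of \<open>pp\<close> that contains the scalar value of the metric on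
  \<open>g\<^bsub>-+\<^esub>\<close>. On \<open>pp\<close> both operators act by powers of \<open>q\<close>,
  by the relations of the algebra. Three more facts are required.

  First, \<open>S\<^sup>~\<close> sends an insertion of \<open>C\<close> on the right of a dual leg to \<open>q\<^bsup>-w-m\<^esup>\<close> times an insertion of
  \<open>C'\<close> on its left (\<open>St_C3\<close>). This is naturality of the braiding with respect to \<open>C\<close>, followed by the
  fact that the braiding of \<open>V\<close> with its dual turns \<open>C\<close> into a multiple of \<open>C'\<close>. Hence the two insertion terms
  of the metric are exchanged. For the second identity one also needs that \<open>S\<close> and \<open>S\<^sup>~\<close> commute
  (\<open>S_St_commute\<close>).

  Second, the value of the metric on \<open>g\<close> requires the contraction \<open>E\<close> of \<open>S\<close> on the legs 2 and 3
  (\<open>E23_S\<close>). Naturality for \<open>E'\<close> computes it for the inverse braiding of \<open>V \<otimes> V\<close>, and the Hecke relation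
  passes from the inverse to the braiding. The same formula, applied to \<open>S pp = q\<^sup>w pp\<close>, shows that \<open>p\<close> is a
  projection (\<open>E23_pp\<close>).

  Third, the values on \<open>g\<^bsub>-+\<^esub>\<close> and \<open>g\<^bsub>+-\<^esub>\<close> are \<open>q\<^bsup>\<plusminus>m\<^esup> [r + 1]\<^sub>q - 1\<close>, where the quantum integer is the sum of
  the \<open>q\<^bsup>(\<lambda>\<^sub>i, 2\<rho>)\<^esup>\<close>. Multiplied by \<open>1 - q\<^bsup>\<plusminus>2\<^esup>\<close> they telescope (\<open>metric_trace_mp\<close>,
  \<open>metric_trace_pm\<close>), and the coefficients of \<open>pp\<close> agree (\<open>metric_intertwines_braiding\<close>).

  The naturality and Hecke relations are verified on matrix entries of the braidings. To get these, \<open>V\<close> is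
  shown to be the vector representation in a standard form, with the given weight basis up to order and scalar
  factors (\<open>vector_rep_exists\<close>): vectors that should vanish are singular and lie below the highest weight, so
  they generate a proper submodule. A highest weight vector tensored with a lowest weight vector generates the
  tensor product, and so the normalisation on it determines all entries (\<open>braiding_self\<close>,
  \<open>braiding_dual_entry\<close>). The dual module has the same standard form in the reversed order (\<open>dual\<close>), which
  covers the third braiding.
\<close>

section \<open>Powers of q and weights\<close>

lemma qpow_add: "0 < q \<Longrightarrow> qpow q (x + y) = qpow q x * qpow q y"
  by (simp add: qpow_def powr_add)
lemma qpow_zero [simp]: "0 < q \<Longrightarrow> qpow q 0 = 1"
  by (simp add: qpow_def)
lemma qpow_nonzero [simp]: "0 < q \<Longrightarrow> qpow q x \<noteq> 0"
  by (simp add: qpow_def)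
lemma qpow_minus: "0 < q \<Longrightarrow> qpow q (- x) = inverse (qpow q x)"
  by (simp add: qpow_def powr_minus)
lemma qpow_of_nat: "0 < q \<Longrightarrow> qpow q (real k) = qpow q 1 ^ k"
  by (simp add: qpow_def powr_realpow)
lemma qpow_inject: "0 < q \<Longrightarrow> q < 1 \<Longrightarrow> qpow q x = qpow q y \<longleftrightarrow> x = y"
  by (simp add: qpow_def powr_inj)
lemma qpow_one_diff: "0 < q \<Longrightarrow> q < 1 \<Longrightarrow> qpow q 1 - qpow q (-1) \<noteq> 0"
  using qpow_inject[of q 1 "-1"] by simp

lemma wform_sroot: "i \<in> {1..r} \<Longrightarrow> wform r (sroot i) \<mu> = \<mu> i - \<mu> (Suc i)"
proof -
  assume i: "i \<in> {1..r}"
  have "wform r (sroot i) \<mu> = (\<Sum>j=1..r+1. (if j = i then \<mu> j else 0) - (if j = Suc i then \<mu> j else 0))"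
    unfolding wform_def sroot_def by (intro sum.cong) auto
  also have "\<dots> = \<mu> i - \<mu> (Suc i)"
    using i by (simp add: sum_subtractf)
  finally show ?thesis .
qed

lemma wform_sroot_sroot:
  "i \<in> {1..r} \<Longrightarrow> wform r (sroot i) (sroot j) =
     of_bool (i = j) - of_bool (i = Suc j) - of_bool (Suc i = j) + of_bool (i = j)"
  by (simp only: wform_sroot) (simp add: sroot_def)

lemma wform_diff_right: "wform r \<mu> (\<lambda>j. \<nu> j - \<kappa> j) = wform r \<mu> \<nu> - wform r \<mu> \<kappa>"
  by (simp add: wform_def sum_subtractf algebra_simps)

lemma wform_minus_right: "wform r \<mu> (\<lambda>j. - \<nu> j) = - wform r \<mu> \<nu>"
  by (simp add: wform_def sum_negf)

lemma wform_commute: "wform r \<mu> \<nu> = wform r \<nu> \<mu>"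
  by (simp add: wform_def mult.commute)

lemma two_rho_eq:
  assumes "j \<in> {1..r+1}"
  shows "two_rho r j = real r + 2 - 2 * real j"
proof -
  have s1: "(\<Sum>i=1..r. real i) = real r * (real r + 1) / 2"
    by (induction r) (auto simp: field_simps)
  have "{1..r} \<inter> {i. j \<le> i} = {j..r}" using assms by auto
  then have s2: "(\<Sum>i=1..r. of_bool (j \<le> i)) = real (r + 1 - j)"
    by (simp add: of_bool_def sum.If_cases)
  have "(\<Sum>i=1..r. fweight r i j) = (\<Sum>i=1..r. of_bool (j \<le> i) - real i / real (r+1))"
    using assms by (intro sum.cong) (auto simp: fweight_def)
  also have "\<dots> = real (r + 1 - j) - (\<Sum>i=1..r. real i) / real (r+1)"
    by (simp only: sum_subtractf s2 sum_divide_distrib)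
  also have "\<dots> = real (r + 1) - real j - real r / 2"
    unfolding s1 using assms by (simp add: of_nat_diff field_simps)
  finally show ?thesis by (simp add: two_rho_def)
qed

lemma telescope_two_rho:
  "(\<Sum>j=1..n+1. \<mu> j * (c - 2 * real j)) =
    (\<Sum>i=1..n. real i * (c - 1 - real i) * (\<mu> i - \<mu> (Suc i))) + real (n + 1) * (c - 2 - real n) * (\<mu> (n+1) :: real)"
  by (induction n) (auto simp: algebra_simps)

text \<open>Since \<open>2\<rho> = \<Sum> i (r + 1 - i) \<alpha>\<^sub>i\<close>, the number \<open>(\<mu>, 2\<rho>)\<close> is determined by the pairings
  \<open>(\<alpha>\<^sub>i, \<mu>)\<close>, that is, by the eigenvalues of the \<open>K\<^sub>i\<close> on a vector of weight \<open>\<mu>\<close>. It also serves as a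
  height function: it drops by 2 each time some \<open>F\<^sub>i\<close> is applied.\<close>

lemma wform_two_rho_expand:
  "wform r \<mu> (two_rho r) = (\<Sum>i=1..r. real i * (real r + 1 - real i) * wform r (sroot i) \<mu>)"
proof -
  have "wform r \<mu> (two_rho r) = (\<Sum>j=1..r+1. \<mu> j * ((real r + 2) - 2 * real j))"
    unfolding wform_def by (intro sum.cong) (auto simp: two_rho_eq)
  also have "\<dots> = (\<Sum>i=1..r. real i * (real r + 2 - 1 - real i) * (\<mu> i - \<mu> (Suc i)))"
    unfolding telescope_two_rho by simp
  also have "\<dots> = (\<Sum>i=1..r. real i * (real r + 1 - real i) * wform r (sroot i) \<mu>)"
    by (intro sum.cong) (auto simp: wform_sroot)
  finally show ?thesis .
qed

lemma wform_two_rho_cong: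
  "(\<And>i. i \<in> {1..r} \<Longrightarrow> wform r (sroot i) \<mu> = wform r (sroot i) \<nu>) \<Longrightarrow>
   wform r \<mu> (two_rho r) = wform r \<nu> (two_rho r)"
  unfolding wform_two_rho_expand by (intro sum.cong) auto

lemma wform_sroot_two_rho: "i \<in> {1..r} \<Longrightarrow> wform r (sroot i) (two_rho r) = 2"
  by (simp add: wform_sroot two_rho_eq)

lemma wform_sroot_fweight:
  "i \<in> {1..r} \<Longrightarrow> s \<in> {1..r} \<Longrightarrow> wform r (sroot i) (fweight r s) = of_bool (i = s)"
  by (auto simp: wform_sroot fweight_def)

lemma sum_initial_segment:
  fixes f :: "nat \<Rightarrow> real"
  shows "s \<le> n \<Longrightarrow> (\<Sum>j=1..n. if j \<le> s then f j else 0) = (\<Sum>j=1..s. f j)"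
  by (rule sum.mono_neutral_cong_right) auto

lemma sum_of_bool_initial_segment: "(\<Sum>j=1..n. of_bool (j \<le> s)) = real (min n s)"
proof -
  have "{1..n} \<inter> {j. j \<le> s} = {1..min n s}" by auto
  then show ?thesis by (simp only: of_bool_def sum.If_cases finite_atLeastAtMost) simp
qed

lemma wform_fweight:
  assumes "s \<in> {1..r}"
  shows "wform r (fweight r s) \<mu> = (\<Sum>j=1..s. \<mu> j) - real s / real (r+1) * (\<Sum>j=1..r+1. \<mu> j)"
proof -
  have 1: "(\<Sum>j=1..r+1. if j \<le> s then \<mu> j else 0) = (\<Sum>j=1..s. \<mu> j)"
    using assms by (intro sum_initial_segment) simp
  have "wform r (fweight r s) \<mu> = (\<Sum>j=1..r+1. (if j \<le> s then \<mu> j else 0) - real s / real (r+1) * \<mu> j)"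
    unfolding wform_def fweight_def by (intro sum.cong) (auto simp: algebra_simps)
  also have "\<dots> = (\<Sum>j=1..s. \<mu> j) - real s / real (r+1) * (\<Sum>j=1..r+1. \<mu> j)"
    by (simp only: sum_subtractf 1 sum_distrib_left)
  finally show ?thesis .
qed

lemma fweight_total: "s \<in> {1..r} \<Longrightarrow> (\<Sum>j=1..r+1. fweight r s j) = 0"
proof -
  assume s: "s \<in> {1..r}"
  have "(\<Sum>j=1..r+1. of_bool (j \<le> s)) = real s"
    unfolding sum_of_bool_initial_segment using s by simp
  moreover have "(\<Sum>j=1..r+1. fweight r s j) = (\<Sum>j=1..r+1. of_bool (j \<le> s) - real s / real (r+1))"
    by (intro sum.cong) (auto simp: fweight_def)
  ultimately show ?thesis by (simp only: sum_subtractf) (simp del: sum.cl_ivl_Suc)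
qed

lemma wform_fweight_fweight:
  assumes "s \<in> {1..r}" "t \<in> {1..r}"
  shows "wform r (fweight r s) (fweight r t) = real (min s t) - real s * real t / real (r+1)"
proof -
  note 1 = sum_of_bool_initial_segment[of t s]
  have "(\<Sum>j=1..s. fweight r t j) = (\<Sum>j=1..s. of_bool (j \<le> t) - real t / real (r+1))"
    using assms by (intro sum.cong) (auto simp: fweight_def)
  also have "\<dots> = real (min s t) - real s * real t / real (r+1)"
    by (simp only: sum_subtractf 1) simp
  finally show ?thesis
    unfolding wform_fweight[OF assms(1)] fweight_total[OF assms(2)] by simp
qed

lemma w0_fweight:
  assumes "s \<in> {1..r}"
  shows "w0 r (fweight r s) = (\<lambda>j. - fweight r (r + 1 - s) j)"
proof
  fix j
  have sub: "real (r + 1 - s) = real (r + 1) - real s" using assms by (simp add: of_nat_diff)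
  show "w0 r (fweight r s) j = - fweight r (r + 1 - s) j"
  proof (cases "1 \<le> j \<and> j \<le> r + 1")
    case True
    then have "(r + 2 - j \<le> s) = (\<not> j \<le> r + 1 - s)" "1 \<le> r + 2 - j" "r + 2 - j \<le> r + 1"
      using assms by auto
    then show ?thesis using True
      unfolding w0_def fweight_def sub by (cases "j \<le> r + 1 - s") (auto simp: diff_divide_distrib)
  qed (auto simp: w0_def fweight_def)
qed

lemma weight_latticeI:
  "\<mu> = (\<lambda>j. \<Sum>i=1..r. real_of_int (c i) * fweight r i j) \<Longrightarrow> \<mu> \<in> weight_lattice r"
  unfolding weight_lattice_def mem_Collect_eq by (rule exI[of _ c]) simp

lemma fweight_in_lattice:
  assumes "s \<in> {1..r}"
  shows "fweight r s \<in> weight_lattice r"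
proof -
  have "fweight r s j = (\<Sum>i=1..r. real_of_int (of_bool (i = s)) * fweight r i j)" for j
  proof -
    have "(\<Sum>i=1..r. real_of_int (of_bool (i = s)) * fweight r i j) = (\<Sum>i=1..r. if i = s then fweight r i j else 0)"
      by (intro sum.cong) auto
    then show ?thesis using assms by simp
  qed
  then show ?thesis by (intro weight_latticeI[where c = "\<lambda>i. of_bool (i = s)"] ext)
qed

lemma uminus_in_lattice: "\<mu> \<in> weight_lattice r \<Longrightarrow> (\<lambda>j. - \<mu> j) \<in> weight_lattice r"
proof -
  assume "\<mu> \<in> weight_lattice r"
  then obtain c where "\<mu> = (\<lambda>j. \<Sum>i=1..r. real_of_int (c i) * fweight r i j)"
    by (auto simp: weight_lattice_def)
  then have "(\<lambda>j. - \<mu> j) = (\<lambda>j. \<Sum>i=1..r. real_of_int (- c i) * fweight r i j)"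
    by (simp only: of_int_minus mult_minus_left sum_negf)
  then show ?thesis by (rule weight_latticeI)
qed

section \<open>The vector representation\<close>

lemma mat_scalar_vec: "mat c *v x = c *s (x :: complex^'n::finite)"
  by (simp add: vec_eq_iff matrix_vector_mult_def mat_def if_distrib[of "\<lambda>a. a * _"] cong: if_cong)

text \<open>Weight vectors of \<open>V\<close> are multiples of the given basis vectors, in an order and with factors that
  have to be discovered from the module structure. So a standard basis is recorded by the
  enumeration \<open>\<iota>\<close> of the indices and by the factors \<open>c\<close>.\<close>

definition scaled_axis :: "(nat \<Rightarrow> 'n::finite) \<Rightarrow> (nat \<Rightarrow> complex) \<Rightarrow> nat \<Rightarrow> complex^'n" where
  "scaled_axis \<iota> c k = c k *s axis (\<iota> k) 1"

text \<open>The diagram automorphism \<open>j \<mapsto> r + 1 - j\<close> exchanges \<open>V(\<omega>\<^sub>1)\<close> and \<open>V(\<omega>\<^sub>r)\<close>. Numbering the simple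
  roots by \<open>\<tau> 1, \<dots>, \<tau> r\<close>, where \<open>\<tau>\<close> is the identity or this automorphism, treats both nodes at once:
  the node of the highest weight is always \<open>\<tau> 1\<close>.\<close>

locale relabelling =
  fixes r :: nat and \<tau> :: "nat \<Rightarrow> nat"
  assumes r_pos: "1 \<le> r"
    and tau: "(\<forall>j\<in>{1..r}. \<tau> j = j) \<or> (\<forall>j\<in>{1..r}. \<tau> j = r + 1 - j)"
begin

lemma tau_in: "j \<in> {1..r} \<Longrightarrow> \<tau> j \<in> {1..r}"
  using tau by auto

lemma tau_surj: assumes "i \<in> {1..r}" obtains j where "j \<in> {1..r}" "i = \<tau> j"
proof -
  have "\<exists>j\<in>{1..r}. i = \<tau> j"
    using tau
  proof
    assume "\<forall>j\<in>{1..r}. \<tau> j = j" then show ?thesis using assms by force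
  next
    assume flip: "\<forall>j\<in>{1..r}. \<tau> j = r + 1 - j"
    have "r + 1 - i \<in> {1..r}" using assms by auto
    from flip[rule_format, OF this] have "\<tau> (r + 1 - i) = i" using assms by simp
    then show ?thesis using assms by (intro bexI[of _ "r + 1 - i"]) auto
  qed
  then show ?thesis using that by blast
qed

lemma tau_inj: "i \<in> {1..r} \<Longrightarrow> j \<in> {1..r} \<Longrightarrow> \<tau> i = \<tau> j \<longleftrightarrow> i = j"
  using tau by auto

lemma tau_adjacent: "i \<in> {1..r} \<Longrightarrow> j \<in> {1..r} \<Longrightarrow>
   (\<tau> i = Suc (\<tau> j) \<or> \<tau> j = Suc (\<tau> i)) \<longleftrightarrow> (i = Suc j \<or> j = Suc i)"
  using tau by auto

lemma tau_cartan: "i \<in> {1..r} \<Longrightarrow> j \<in> {1..r} \<Longrightarrow>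
   wform r (sroot (\<tau> i)) (sroot (\<tau> j)) =
     of_bool (i = j) - of_bool (i = Suc j) - of_bool (Suc i = j) + of_bool (i = j)"
proof -
  assume ij: "i \<in> {1..r}" "j \<in> {1..r}"
  obtain i' j' where ij': "r + 1 = i + i'" "r + 1 = j + j'"
    using ij by (metis atLeastAtMost_iff le_add1 le_trans less_eqE)
  then have "\<tau> i = i \<and> \<tau> j = j \<or> \<tau> i = i' \<and> \<tau> j = j'"
    using tau ij by (metis add_diff_cancel_left')
  moreover have "(i' = j') = (i = j)" "(i' = Suc j') = (Suc i = j)" "(Suc i' = j') = (i = Suc j)"
    using ij' by linarith+
  ultimately have eq: "(\<tau> i = \<tau> j) = (i = j)"
    and "(\<tau> i = Suc (\<tau> j)) = (i = Suc j) \<and> (Suc (\<tau> i) = \<tau> j) = (Suc i = j) \<or>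
         (\<tau> i = Suc (\<tau> j)) = (Suc i = j) \<and> (Suc (\<tau> i) = \<tau> j) = (i = Suc j)"
    by (elim disjE; simp)+
  from this(2) show ?thesis
    unfolding wform_sroot_sroot[OF tau_in[OF ij(1)]] eq by (elim disjE conjE) simp_all
qed

end

text \<open>The standard model of the vector representation. The basis \<open>b\<^sub>1, \<dots>, b\<^bsub>r+1\<^esub>\<close> runs from the highest to the
  lowest weight vector, and \<open>F\<^bsub>\<tau> j\<^esub>\<close> and \<open>E\<^bsub>\<tau> j\<^esub>\<close> only move between \<open>b\<^sub>j\<close> and \<open>b\<^bsub>j+1\<^esub>\<close>. The dual module has the
  same shape for the reversed order, so every fact about this model applies to it as well.\<close>

locale vector_rep = relabelling r \<tau>
  for r :: nat and q :: real and \<tau> :: "nat \<Rightarrow> nat"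
    and \<iota> :: "nat \<Rightarrow> 'n::finite" and c :: "nat \<Rightarrow> complex" and X :: "'n uq_rep" +
  assumes q_pos [simp]: "0 < q" and q_less [simp]: "q < 1"
    and iota: "bij_betw \<iota> {1..r+1} UNIV"
    and c_nonzero: "k \<in> {1..r+1} \<Longrightarrow> c k \<noteq> 0"
    and Kmat_b: "j \<in> {1..r} \<Longrightarrow> k \<in> {1..r+1} \<Longrightarrow>
       Kmat X (\<tau> j) *v scaled_axis \<iota> c k = qpow q (of_bool (j = k) - of_bool (Suc j = k)) *s scaled_axis \<iota> c k"
    and Kinv_b: "j \<in> {1..r} \<Longrightarrow> k \<in> {1..r+1} \<Longrightarrow>
       Kinv X (\<tau> j) *v scaled_axis \<iota> c k = qpow q (of_bool (Suc j = k) - of_bool (j = k)) *s scaled_axis \<iota> c k"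
    and Emat_b: "j \<in> {1..r} \<Longrightarrow> k \<in> {1..r+1} \<Longrightarrow>
       Emat X (\<tau> j) *v scaled_axis \<iota> c k = (if k = Suc j then scaled_axis \<iota> c j else 0)"
    and Fmat_b: "j \<in> {1..r} \<Longrightarrow> k \<in> {1..r+1} \<Longrightarrow>
       Fmat X (\<tau> j) *v scaled_axis \<iota> c k = (if k = j then scaled_axis \<iota> c (Suc j) else 0)"
begin

abbreviation b :: "nat \<Rightarrow> complex^'n" where "b \<equiv> scaled_axis \<iota> c"

lemma b_nonzero: "k \<in> {1..r+1} \<Longrightarrow> b k \<noteq> 0"
  using c_nonzero[of k] by (auto simp: scaled_axis_def axis_def vec_eq_iff)

lemma axis_eq_b: "k \<in> {1..r+1} \<Longrightarrow> axis (\<iota> k) 1 = inverse (c k) *s b k"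
  using c_nonzero[of k] by (simp add: scaled_axis_def)

lemma iota_surj: obtains k where "k \<in> {1..r+1}" "a = \<iota> k"
  using iota unfolding bij_betw_def by (metis UNIV_I imageE)

lemma vec_induct:
  assumes sub: "vec.subspace W" and b: "\<And>k. k \<in> {1..r+1} \<Longrightarrow> b k \<in> W"
  shows "x \<in> W"
proof -
  have ax: "axis a 1 \<in> W" for a
    using iota_surj[of a] b axis_eq_b by (metis sub vec.subspace_scale)
  have "x = (\<Sum>a\<in>UNIV. x $ a *s axis a 1)"
    by (simp add: vec_eq_iff sum_component axis_def if_distrib[of "\<lambda>z. _ * z"] cong: if_cong)
  then show ?thesis
    using ax sub by (metis (no_types, lifting) vec.subspace_scale vec.subspace_sum)
qed

lemma mat_eqI:
  assumes "\<And>k. k \<in> {1..r+1} \<Longrightarrow> A *v b k = B *v b k"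
  shows "A = (B :: complex^'n^'m)"
proof -
  have "A *v x = B *v x" for x
  proof -
    have "x \<in> {x. A *v x = B *v x}"
      by (rule vec_induct)
         (auto simp: assms vec.subspace_def matrix_vector_right_distrib vector_scalar_commute)
    then show ?thesis by simp
  qed
  then show ?thesis by (simp add: matrix_eq)
qed

text \<open>All defining relations can be tested on the basis vectors. The Serre relations hold because
  \<open>E\<^sub>i\<^sup>2 = E\<^sub>i E\<^sub>j E\<^sub>i = 0\<close> for adjacent \<open>i\<close>, \<open>j\<close>, and likewise for the \<open>F\<^sub>i\<close>.\<close>

lemma is_uq_module: "uq_module r q X"
proof -
  note act = matrix_vector_mul_assoc[symmetric] mat_scalar_vec vector_scalar_commute
     matrix_vector_mult_diff_rdistrib matrix_vector_mult_add_rdistrib Kmat_b Kinv_b Emat_b Fmat_b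
  have inv: "Kmat X (\<tau> i) ** Kinv X (\<tau> i) = mat 1" "Kinv X (\<tau> i) ** Kmat X (\<tau> i) = mat 1"
    if "i \<in> {1..r}" for i
    by (rule mat_eqI, use that in \<open>simp add: act qpow_add[symmetric]\<close>)+
  have KK: "Kmat X (\<tau> i) ** Kmat X (\<tau> j) = Kmat X (\<tau> j) ** Kmat X (\<tau> i)"
    if "i \<in> {1..r}" "j \<in> {1..r}" for i j
    by (rule mat_eqI, use that in \<open>simp add: act mult.commute\<close>)
  have KE: "Kmat X (\<tau> i) ** Emat X (\<tau> j) ** Kinv X (\<tau> i) =
      mat (qpow q (wform r (sroot (\<tau> i)) (sroot (\<tau> j)))) ** Emat X (\<tau> j)"
    if "i \<in> {1..r}" "j \<in> {1..r}" for i j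
    by (rule mat_eqI, use that in \<open>auto simp add: act qpow_add[symmetric] tau_cartan\<close>)
  have KF: "Kmat X (\<tau> i) ** Fmat X (\<tau> j) ** Kinv X (\<tau> i) =
      mat (qpow q (- wform r (sroot (\<tau> i)) (sroot (\<tau> j)))) ** Fmat X (\<tau> j)"
    if "i \<in> {1..r}" "j \<in> {1..r}" for i j
    by (rule mat_eqI, use that in \<open>auto simp add: act qpow_add[symmetric] tau_cartan\<close>)
  have EF: "Emat X (\<tau> i) ** Fmat X (\<tau> j) - Fmat X (\<tau> j) ** Emat X (\<tau> i) =
      (if \<tau> i = \<tau> j then mat (1 / (qpow q 1 - qpow q (-1))) ** (Kmat X (\<tau> i) - Kinv X (\<tau> i)) else 0)"
    if "i \<in> {1..r}" "j \<in> {1..r}" for i j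
  proof (rule mat_eqI)
    fix k assume k: "k \<in> {1..r+1}"
    have nz: "qpow q 1 - qpow q (-1) \<noteq> 0" by (rule qpow_one_diff) auto
    show "(Emat X (\<tau> i) ** Fmat X (\<tau> j) - Fmat X (\<tau> j) ** Emat X (\<tau> i)) *v b k =
      (if \<tau> i = \<tau> j then mat (1 / (qpow q 1 - qpow q (-1))) ** (Kmat X (\<tau> i) - Kinv X (\<tau> i)) else 0) *v b k"
    proof (cases "i = j")
      case False
      then have "\<tau> i \<noteq> \<tau> j" using that tau_inj by blast
      then show ?thesis using False that k by (simp add: act)
    next
      case True
      define \<delta> where "\<delta> = qpow q 1 - qpow q (-1)"
      define u where "u = (of_bool (j = k) - of_bool (Suc j = k) :: real)"
      have u': "of_bool (Suc j = k) - of_bool (j = k) = - u" by (simp add: u_def)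
      have "mat (1 / \<delta>) ** (Kmat X (\<tau> j) - Kinv X (\<tau> j)) *v b k = ((qpow q u - qpow q (- u)) / \<delta>) *s b k"
        using that k unfolding act(1-3,4) Kmat_b[OF that(2) k] Kinv_b[OF that(2) k] u' u_def[symmetric]
        by (simp add: vec_eq_iff diff_divide_distrib algebra_simps)
      moreover have "(qpow q u - qpow q (- u)) / \<delta> = of_bool (j = k) - of_bool (Suc j = k)"
        using nz by (auto simp: u_def \<delta>_def divide_simps)
      moreover have "(Emat X (\<tau> j) ** Fmat X (\<tau> j) - Fmat X (\<tau> j) ** Emat X (\<tau> j)) *v b k
          = (of_bool (j = k) - of_bool (Suc j = k)) *s b k"
        using that k by (auto simp: act)
      ultimately show ?thesis unfolding True \<delta>_def by simp
    qed
  qed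
  have SE: "q_serre q (Emat X) (\<tau> i) (\<tau> j)" if ij: "i \<in> {1..r}" "j \<in> {1..r}" for i j
  proof (cases "i = Suc j \<or> j = Suc i")
    case True
    have "Emat X (\<tau> i) ** Emat X (\<tau> i) ** Emat X (\<tau> j)
        - mat (qpow q 1 + qpow q (-1)) ** Emat X (\<tau> i) ** Emat X (\<tau> j) ** Emat X (\<tau> i)
        + Emat X (\<tau> j) ** Emat X (\<tau> i) ** Emat X (\<tau> i) = 0"
      by (rule mat_eqI, use True ij in \<open>elim disjE\<close>) (simp_all add: act)
    then show ?thesis using True tau_adjacent[OF ij] by (simp only: q_serre_def if_True)
  next
    case False
    have "Emat X (\<tau> i) ** Emat X (\<tau> j) = Emat X (\<tau> j) ** Emat X (\<tau> i)"
      by (rule mat_eqI, use False ij in \<open>cases "i = j"\<close>) (simp_all add: act)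
    then show ?thesis using False tau_adjacent[OF ij] by (simp only: q_serre_def if_False)
  qed
  have SF: "q_serre q (Fmat X) (\<tau> i) (\<tau> j)" if ij: "i \<in> {1..r}" "j \<in> {1..r}" for i j
  proof (cases "i = Suc j \<or> j = Suc i")
    case True
    have "Fmat X (\<tau> i) ** Fmat X (\<tau> i) ** Fmat X (\<tau> j)
        - mat (qpow q 1 + qpow q (-1)) ** Fmat X (\<tau> i) ** Fmat X (\<tau> j) ** Fmat X (\<tau> i)
        + Fmat X (\<tau> j) ** Fmat X (\<tau> i) ** Fmat X (\<tau> i) = 0"
      by (rule mat_eqI, use True ij in \<open>elim disjE\<close>) (simp_all add: act)
    then show ?thesis using True tau_adjacent[OF ij] by (simp only: q_serre_def if_True)
  next
    case False
    have "Fmat X (\<tau> i) ** Fmat X (\<tau> j) = Fmat X (\<tau> j) ** Fmat X (\<tau> i)"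
      by (rule mat_eqI, use False ij in \<open>cases "i = j"\<close>) (simp_all add: act)
    then show ?thesis using False tau_adjacent[OF ij] by (simp only: q_serre_def if_False)
  qed
  have two: "P i j" if "i \<in> {1..r}" "j \<in> {1..r}"
      "\<And>i j. i \<in> {1..r} \<Longrightarrow> j \<in> {1..r} \<Longrightarrow> P (\<tau> i) (\<tau> j)" for P :: "nat \<Rightarrow> nat \<Rightarrow> bool" and i j
    using tau_surj[OF that(1)] tau_surj[OF that(2)] that(3) by metis
  show ?thesis
    unfolding uq_module_def
  proof (rule conjI; intro ballI)
    fix i assume "i \<in> {1..r}"
    then show "Kmat X i ** Kinv X i = mat 1 \<and> Kinv X i ** Kmat X i = mat 1"
      using inv tau_surj by metis
  next
    fix i j assume "i \<in> {1..r}" "j \<in> {1..r}"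
    then show "Kmat X i ** Kmat X j = Kmat X j ** Kmat X i \<and>
        Kmat X i ** Emat X j ** Kinv X i = mat (qpow q (wform r (sroot i) (sroot j))) ** Emat X j \<and>
        Kmat X i ** Fmat X j ** Kinv X i = mat (qpow q (- wform r (sroot i) (sroot j))) ** Fmat X j \<and>
        Emat X i ** Fmat X j - Fmat X j ** Emat X i =
          (if i = j then mat (1 / (qpow q 1 - qpow q (-1))) ** (Kmat X i - Kinv X i) else 0) \<and>
        q_serre q (Emat X) i j \<and> q_serre q (Fmat X) i j"
    proof (rule two)
      fix i j assume ij: "i \<in> {1..r}" "j \<in> {1..r}"
      show "Kmat X (\<tau> i) ** Kmat X (\<tau> j) = Kmat X (\<tau> j) ** Kmat X (\<tau> i) \<and>
        Kmat X (\<tau> i) ** Emat X (\<tau> j) ** Kinv X (\<tau> i) = mat (qpow q (wform r (sroot (\<tau> i)) (sroot (\<tau> j)))) ** Emat X (\<tau> j) \<and>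
        Kmat X (\<tau> i) ** Fmat X (\<tau> j) ** Kinv X (\<tau> i) = mat (qpow q (- wform r (sroot (\<tau> i)) (sroot (\<tau> j)))) ** Fmat X (\<tau> j) \<and>
        Emat X (\<tau> i) ** Fmat X (\<tau> j) - Fmat X (\<tau> j) ** Emat X (\<tau> i) =
          (if \<tau> i = \<tau> j then mat (1 / (qpow q 1 - qpow q (-1))) ** (Kmat X (\<tau> i) - Kinv X (\<tau> i)) else 0) \<and>
        q_serre q (Emat X) (\<tau> i) (\<tau> j) \<and> q_serre q (Fmat X) (\<tau> i) (\<tau> j)"
        by (intro conjI KK[OF ij] KE[OF ij] KF[OF ij] EF[OF ij] SE[OF ij] SF[OF ij])
    qed
  qed
qed

text \<open>Each \<open>E\<^bsub>\<tau> j\<^esub>\<close> and each \<open>F\<^bsub>\<tau> j\<^esub>\<close> extracts a single coordinate and sends it to a multiple of one basis vector,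
  so a nonzero submodule contains some \<open>b\<^sub>k\<close>. Raising and lowering then produces the whole basis.
  For the dual module this supplies the simplicity that the normalisation of its braidings requires.\<close>

lemma is_simple: "simple_module r q X"
  unfolding simple_module_def
proof (intro conjI allI impI is_uq_module)
  fix W :: "(complex^'n) set"
  assume "vec.subspace W \<and> (\<forall>i\<in>{1..r}. \<forall>x\<in>W. Kmat X i *v x \<in> W \<and> Kinv X i *v x \<in> W \<and>
                             Emat X i *v x \<in> W \<and> Fmat X i *v x \<in> W)"
  then have sub: "vec.subspace W"
    and E: "\<And>j x. j \<in> {1..r} \<Longrightarrow> x \<in> W \<Longrightarrow> Emat X (\<tau> j) *v x \<in> W"
    and F: "\<And>j x. j \<in> {1..r} \<Longrightarrow> x \<in> W \<Longrightarrow> Fmat X (\<tau> j) *v x \<in> W"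
    using tau_in by blast+
  show "W = {0} \<or> W = UNIV"
  proof (cases "W = {0}")
    case False
    then obtain z where z: "z \<in> W" "z \<noteq> 0"
      using sub vec.subspace_0 by blast
    define co where "co x k = x $ \<iota> k / c k" for x :: "complex^'n" and k
    have inj: "\<iota> k = \<iota> l \<longleftrightarrow> k = l" if "k \<in> {1..r+1}" "l \<in> {1..r+1}" for k l
      using iota that unfolding bij_betw_def inj_on_def by blast
    have Eco: "Emat X (\<tau> j) *v x = co x (Suc j) *s b j" if j: "j \<in> {1..r}" for x j
    proof -
      have "x \<in> {x. Emat X (\<tau> j) *v x = co x (Suc j) *s b j}"
      proof (rule vec_induct)
        fix k assume k: "k \<in> {1..r+1}"
        have "co (b k) (Suc j) = of_bool (k = Suc j)"
          using k j c_nonzero[of k] by (auto simp: co_def scaled_axis_def axis_def inj)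
        then show "b k \<in> {x. Emat X (\<tau> j) *v x = co x (Suc j) *s b j}"
          using k j by (simp add: Emat_b)
      qed (auto simp: vec.subspace_def co_def matrix_vector_right_distrib vector_scalar_commute
             vec.scale_left_distrib add_divide_distrib)
      then show ?thesis by simp
    qed
    have Fco: "Fmat X (\<tau> j) *v x = co x j *s b (Suc j)" if j: "j \<in> {1..r}" for x j
    proof -
      have "x \<in> {x. Fmat X (\<tau> j) *v x = co x j *s b (Suc j)}"
      proof (rule vec_induct)
        fix k assume k: "k \<in> {1..r+1}"
        have "co (b k) j = of_bool (k = j)"
          using k j c_nonzero[of k] by (auto simp: co_def scaled_axis_def axis_def inj)
        then show "b k \<in> {x. Fmat X (\<tau> j) *v x = co x j *s b (Suc j)}"
          using k j by (simp add: Fmat_b)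
      qed (auto simp: vec.subspace_def co_def matrix_vector_right_distrib vector_scalar_commute
             vec.scale_left_distrib add_divide_distrib)
      then show ?thesis by simp
    qed
    \<comment> \<open>A nonzero coordinate at \<open>b\<^sub>k\<close> is extracted by \<open>E\<^bsub>\<tau> (k-1)\<^esub>\<close>, or by \<open>F\<^bsub>\<tau> 1\<^esub>\<close> if \<open>k = 1\<close>.\<close>
    obtain a where "z $ a \<noteq> 0" using z by (auto simp: vec_eq_iff)
    then obtain k where k: "k \<in> {1..r+1}" "co z k \<noteq> 0"
      using iota_surj[of a] c_nonzero unfolding co_def by (metis divide_eq_0_iff)
    have scale: "x \<in> W" if "t *s x \<in> W" "t \<noteq> 0" for t x
      using vec.subspace_scale[OF sub that(1), of "inverse t"] that(2) by simp
    have "\<exists>k\<in>{1..r+1}. b k \<in> W"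
    proof (cases "k = 1")
      case True
      then have "co z 1 *s b (Suc 1) \<in> W" using F[of 1 z] Fco[of 1 z] z r_pos by simp
      then show ?thesis using scale k True r_pos by (intro bexI[of _ "Suc 1"]) auto
    next
      case False
      define j where "j = k - 1"
      have j: "j \<in> {1..r}" "k = Suc j" using k False by (auto simp: j_def)
      then have "co z k *s b j \<in> W" using E[of j z] Eco[of j z] z by simp
      then show ?thesis using scale k j by (intro bexI[of _ j]) auto
    qed
    then obtain k where k: "k \<in> {1..r+1}" "b k \<in> W" by blast
    have up: "b l \<in> W" if "k \<le> l" "l \<le> r+1" for l
      using that
    proof (induction l rule: dec_induct)
      case (step l)
      then show ?case using F[of l "b l"] Fmat_b[of l l] k by simp
    qed (use k in simp)
    have down: "b l \<in> W" if "l \<le> k" "1 \<le> l" for l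
      using that
    proof (induction rule: inc_induct)
      case (step l)
      then show ?case using E[of l "b (Suc l)"] Emat_b[of l "Suc l"] k by simp
    qed (use k in simp)
    have "b l \<in> W" if "l \<in> {1..r+1}" for l
      using up[of l] down[of l] that by (cases "k \<le> l") auto
    then have "x \<in> W" for x using vec_induct[OF sub] by blast
    then show ?thesis by blast
  qed simp
qed

end

section \<open>The braiding of the vector representation with itself\<close>

lemma tensor_vec_simps:
  "tensor_vec (x + x') y = tensor_vec x y + tensor_vec x' y"
  "tensor_vec x (y + y') = tensor_vec x y + tensor_vec x y'"
  "tensor_vec (s *s x) y = s *s tensor_vec x y"
  "tensor_vec x (s *s y) = s *s tensor_vec x y"
  "tensor_vec 0 y = 0" "tensor_vec x 0 = 0"
  by (simp_all add: tensor_vec_def vec_eq_iff algebra_simps)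

lemma kron_tensor_vec: "kron A B *v tensor_vec x y = tensor_vec (A *v x) (B *v y)"
  by (simp add: kron_def tensor_vec_def matrix_vector_mult_def vec_eq_iff sum_product
        sum.cartesian_product UNIV_Times_UNIV[symmetric] algebra_simps split_def
      del: UNIV_Times_UNIV)

lemma Fmat_tensor_vec:
  "Fmat (tensor_rep X Y) i *v tensor_vec x y =
     tensor_vec (Fmat X i *v x) y + tensor_vec (Kinv X i *v x) (Fmat Y i *v y)"
  by (simp add: tensor_rep_def matrix_vector_mult_add_rdistrib kron_tensor_vec)

lemma Emat_tensor_vec:
  "Emat (tensor_rep X Y) i *v tensor_vec x y =
     tensor_vec (Emat X i *v x) (Kmat Y i *v y) + tensor_vec x (Emat Y i *v y)"
  by (simp add: tensor_rep_def matrix_vector_mult_add_rdistrib kron_tensor_vec)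

lemma braiding_Fmat:
  "is_braiding r q X Y R \<Longrightarrow> i \<in> {1..r} \<Longrightarrow>
   R *v (Fmat (tensor_rep X Y) i *v u) = Fmat (tensor_rep Y X) i *v (R *v u)"
  by (simp add: is_braiding_def matrix_vector_mul_assoc)

lemma braiding_Emat:
  "is_braiding r q X Y R \<Longrightarrow> i \<in> {1..r} \<Longrightarrow>
   R *v (Emat (tensor_rep X Y) i *v u) = Emat (tensor_rep Y X) i *v (R *v u)"
  by (simp add: is_braiding_def matrix_vector_mul_assoc)

lemma braiding_extreme:
  "is_braiding r q X Y R \<Longrightarrow> is_V r q l X \<Longrightarrow> is_V r q m Y \<Longrightarrow>
   highest_weight_vector r q X l x \<Longrightarrow> lowest_weight_vector r q Y (w0 r m) y \<Longrightarrow>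
   R *v tensor_vec x y = qpow q (wform r l (w0 r m)) *s tensor_vec y x"
  unfolding is_braiding_def by blast

lemma scale_cancel: "s *s x = s *s y \<Longrightarrow> s \<noteq> 0 \<Longrightarrow> x = (y :: complex^'n)"
  by (simp add: vec_eq_iff)

context relabelling begin

lemma tau_flip: "j \<in> {1..r} \<Longrightarrow> r + 1 - \<tau> j = \<tau> (r + 1 - j)"
proof -
  assume j: "j \<in> {1..r}"
  have j': "r + 1 - j \<in> {1..r}" using j by auto
  show ?thesis using tau
  proof
    assume "\<forall>j\<in>{1..r}. \<tau> j = j" then show ?thesis using j j' by metis
  next
    assume "\<forall>j\<in>{1..r}. \<tau> j = r + 1 - j" then show ?thesis using j j' by metis
  qed
qed

lemma fweight_pairing:
  "i \<in> {1..r} \<Longrightarrow> j \<in> {1..r} \<Longrightarrow> wform r (sroot (\<tau> i)) (fweight r (\<tau> j)) = of_bool (i = j)"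
  using wform_sroot_fweight[OF tau_in tau_in] tau_inj by simp

lemma one_in: "1 \<in> {1..r}" and r_in: "r \<in> {1..r}"
  using r_pos by auto

lemma w0_highest: "w0 r (fweight r (\<tau> 1)) = (\<lambda>j. - fweight r (\<tau> r) j)"
  using w0_fweight[OF tau_in[OF one_in]] tau_flip[OF one_in] by simp

end

context vector_rep begin

lemma highest: "highest_weight_vector r q X (fweight r (\<tau> 1)) (b 1)"
  unfolding highest_weight_vector_def weight_vector_def
proof (intro conjI ballI)
  show "fweight r (\<tau> 1) \<in> weight_lattice r" by (intro fweight_in_lattice tau_in one_in)
  show "b 1 \<noteq> 0" by (rule b_nonzero) simp
  fix i assume "i \<in> {1..r}"
  then obtain j where j: "j \<in> {1..r}" "i = \<tau> j" by (rule tau_surj)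
  show "Kmat X i *v b 1 = qpow q (wform r (sroot i) (fweight r (\<tau> 1))) *s b 1"
    using Kmat_b[of j 1] j fweight_pairing[OF j(1) one_in] by simp
  show "Emat X i *v b 1 = 0" using Emat_b[of j 1] j by simp
qed

lemma lowest: "lowest_weight_vector r q X (w0 r (fweight r (\<tau> 1))) (b (r+1))"
  unfolding lowest_weight_vector_def weight_vector_def w0_highest
proof (intro conjI ballI)
  show "(\<lambda>j. - fweight r (\<tau> r) j) \<in> weight_lattice r"
    by (intro uminus_in_lattice fweight_in_lattice tau_in r_in)
  show "b (r + 1) \<noteq> 0" by (rule b_nonzero) simp
  fix i assume "i \<in> {1..r}"
  then obtain j where j: "j \<in> {1..r}" "i = \<tau> j" by (rule tau_surj)
  show "Kmat X i *v b (r+1) = qpow q (wform r (sroot i) (\<lambda>j. - fweight r (\<tau> r) j)) *s b (r+1)"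
    using Kmat_b[of j "r+1"] j fweight_pairing[OF j(1) r_in] by (auto simp: wform_minus_right)
  show "Fmat X i *v b (r+1) = 0" using Fmat_b[of j "r+1"] j by simp
qed

lemma is_V_X: "is_V r q (fweight r (\<tau> 1)) X"
  unfolding is_V_def using is_simple highest by blast

lemma tau_ends: "\<tau> 1 = 1 \<and> \<tau> r = r \<or> \<tau> 1 = r \<and> \<tau> r = 1"
  using tau one_in r_in by (metis add_diff_cancel_right' diff_add_inverse)

lemma wform_ends:
  "wform r (fweight r (\<tau> 1)) (fweight r (\<tau> 1)) = real r / real (r+1)"
  "wform r (fweight r (\<tau> 1)) (fweight r (\<tau> r)) = 1 / real (r+1)"
  "wform r (fweight r (\<tau> r)) (fweight r (\<tau> 1)) = 1 / real (r+1)"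
proof -
  have e: "real r - real r * real r / real (r+1) = real r / real (r+1)"
    "1 - real r / real (r+1) = 1 / real (r+1)" "1 - 1 / real (r+1) = real r / real (r+1)"
    by (simp_all add: divide_simps) (simp_all add: algebra_simps)?
  have m: "min 1 r = 1" "min r 1 = 1" using r_pos by auto
  show "wform r (fweight r (\<tau> 1)) (fweight r (\<tau> 1)) = real r / real (r+1)"
    "wform r (fweight r (\<tau> 1)) (fweight r (\<tau> r)) = 1 / real (r+1)"
    "wform r (fweight r (\<tau> r)) (fweight r (\<tau> 1)) = 1 / real (r+1)"
    unfolding wform_fweight_fweight[OF tau_in[OF one_in] tau_in[OF one_in]]
      wform_fweight_fweight[OF tau_in[OF one_in] tau_in[OF r_in]]
      wform_fweight_fweight[OF tau_in[OF r_in] tau_in[OF one_in]]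
    using tau_ends by (elim disjE; simp only: m min.idem e of_nat_1 mult_1 mult_1_right)+
qed

text \<open>With \<open>z = q\<close> and \<open>\<kappa> = q\<^sup>w\<close>, where \<open>w = (\<omega>\<^sub>s, \<omega>\<^sub>s) = r / (r + 1)\<close>, all other constants of the braidings
  are monomials: the normalisation on \<open>b\<^sub>1 \<otimes> b\<^bsub>r+1\<^esub>\<close> is \<open>q\<^bsup>w - 1\<^esup> = \<kappa> / z\<close>.\<close>

definition \<kappa> where "\<kappa> = qpow q (real r / real (r+1))"
definition z where "z = qpow q 1"

lemma \<kappa>_nonzero [simp]: "\<kappa> \<noteq> 0" and z_nonzero [simp]: "z \<noteq> 0"
  by (simp_all add: \<kappa>_def z_def)

lemma qpow_m1: "qpow q (-1) = inverse z"
  by (simp add: z_def qpow_minus)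

lemma qpow_w0: "qpow q (- (1 / real (r+1))) = \<kappa> / z"
proof -
  have "- (1 / real (r+1)) = real r / real (r+1) + (-1)" by (simp add: field_simps)
  then show ?thesis by (simp only: qpow_add q_pos qpow_m1 \<kappa>_def) (simp add: divide_inverse)
qed

lemma K_simps: "j \<in> {1..r} \<Longrightarrow> Kmat X (\<tau> j) *v b j = z *s b j"
  "j \<in> {1..r} \<Longrightarrow> Kmat X (\<tau> j) *v b (Suc j) = inverse z *s b (Suc j)"
  "j \<in> {1..r} \<Longrightarrow> Kinv X (\<tau> j) *v b j = inverse z *s b j"
  "j \<in> {1..r} \<Longrightarrow> Kinv X (\<tau> j) *v b (Suc j) = z *s b (Suc j)"
  "j \<in> {1..r} \<Longrightarrow> k \<in> {1..r+1} \<Longrightarrow> k \<noteq> j \<Longrightarrow> k \<noteq> Suc j \<Longrightarrow> Kmat X (\<tau> j) *v b k = b k"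
  "j \<in> {1..r} \<Longrightarrow> k \<in> {1..r+1} \<Longrightarrow> k \<noteq> j \<Longrightarrow> k \<noteq> Suc j \<Longrightarrow> Kinv X (\<tau> j) *v b k = b k"
  by (auto simp: Kmat_b Kinv_b z_def[symmetric] qpow_m1)

text \<open>The vector \<open>b\<^sub>1 \<otimes> b\<^bsub>r+1\<^esub>\<close>, highest times lowest, generates the tensor square, so its prescribed image
  determines the braiding. Pushing it around with the \<open>E\<^bsub>\<tau> j\<^esub>\<close> and \<open>F\<^bsub>\<tau> j\<^esub>\<close> reaches first the pairs \<open>i < j\<close>,
  then the diagonal, then the pairs \<open>j < i\<close>, where the correction term of the Hecke type braiding appears.\<close>

lemma braiding_self:
  assumes R: "is_braiding r q X X R" and ij: "i \<in> {1..r+1}" "j \<in> {1..r+1}"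
  shows "R *v tensor_vec (b i) (b j) =
    (if i = j then \<kappa> *s tensor_vec (b i) (b j)
     else (\<kappa> / z) *s tensor_vec (b j) (b i) + (if j < i then (\<kappa> - \<kappa> / z / z) *s tensor_vec (b i) (b j) else 0))"
proof -
  let ?T = "\<lambda>i j. tensor_vec (b i) (b j)"
  note act = Fmat_tensor_vec Emat_tensor_vec Emat_b Fmat_b K_simps tensor_vec_simps
    vector_scalar_commute matrix_vector_right_distrib matrix_vector_mult_diff_distrib
  note F = braiding_Fmat[OF R tau_in] note E = braiding_Emat[OF R tau_in]
  have 0: "R *v ?T 1 (r+1) = (\<kappa> / z) *s ?T (r+1) 1"
    using braiding_extreme[OF R is_V_X is_V_X highest lowest]
    unfolding w0_highest wform_minus_right wform_ends qpow_w0 .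
  \<comment> \<open>\<open>E\<^bsub>\<tau> j\<^esub>\<close> decreases the second index from \<open>j + 1\<close> to \<open>j\<close>; then \<open>F\<^bsub>\<tau> i\<^esub>\<close> increases the first index.\<close>
  have 1: "R *v ?T 1 j = (\<kappa> / z) *s ?T j 1" if "2 \<le> j" "j \<le> r+1" for j
    using that(2,1)
  proof (induction j rule: inc_induct)
    case (step j)
    then show ?case using E[of j "?T 1 (Suc j)"] by (simp add: act)
  qed (use 0 in simp)
  have 2: "R *v ?T i j = (\<kappa> / z) *s ?T j i" if "1 \<le> i" "i < j" "j \<le> r+1" for i j
    using that
  proof (induction i rule: dec_induct)
    case (step i)
    then show ?case using F[of i "?T i j"] by (simp add: act)
  qed (use 1 in simp)
  have 3: "R *v ?T i i = \<kappa> *s ?T i i" "R *v ?T (Suc i) (Suc i) = \<kappa> *s ?T (Suc i) (Suc i)"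
    if "1 \<le> i" "i \<le> r" for i
    using that E[of i "?T i (Suc i)"] F[of i "?T i (Suc i)"] 2[of i "Suc i"] by (simp_all add: act)
  \<comment> \<open>Here \<open>E\<^bsub>\<tau> i\<^esub>\<close> acts on both factors of \<open>b\<^bsub>i+1\<^esub> \<otimes> b\<^bsub>i+1\<^esub>\<close>; the extra term is already known.\<close>
  have 4: "R *v ?T (Suc i) i = (\<kappa> / z) *s ?T i (Suc i) + (\<kappa> - \<kappa> / z / z) *s ?T (Suc i) i"
    if "1 \<le> i" "i \<le> r" for i
  proof -
    have "inverse z *s (R *v ?T i (Suc i)) + R *v ?T (Suc i) i = \<kappa> *s (inverse z *s ?T i (Suc i) + ?T (Suc i) i)"
      using that E[of i "?T (Suc i) (Suc i)"] 3(2)[of i] by (simp add: act)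
    then have "R *v ?T (Suc i) i = \<kappa> *s (inverse z *s ?T i (Suc i) + ?T (Suc i) i) - inverse z *s ((\<kappa> / z) *s ?T (Suc i) i)"
      using that 2[of i "Suc i"] by (simp add: algebra_simps)
    then show ?thesis by (simp add: vec_eq_iff algebra_simps divide_inverse)
  qed
  have 5: "R *v ?T i j = (\<kappa> / z) *s ?T j i + (\<kappa> - \<kappa> / z / z) *s ?T i j" if "Suc j \<le> i" "1 \<le> j" "i \<le> r+1" for i j
    using that
  proof (induction i rule: dec_induct)
    case (step i)
    then show ?case using F[of i "?T i j"] by (simp add: act)
  qed (use 4 in simp)
  consider "i = j" "i = 1" | "i = j" "i \<ge> 2" | "i < j" | "j < i" using ij by fastforce
  then show ?thesis
  proof cases
    case 1 then show ?thesis using 3(1)[of 1] r_pos by simp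
  next
    case 2 then show ?thesis using 3(2)[of "i - 1"] ij by simp
  next
    case 3 then show ?thesis using 2 ij by simp
  next
    case 4 then show ?thesis using 5 ij by simp
  qed
qed

end

section \<open>The dual module and its braiding with the vector representation\<close>

text \<open>The coefficient of \<open>\<phi>\<^sub>k \<otimes> b\<^sub>k\<close> in the image of \<open>b\<^sub>i \<otimes> \<phi>\<^sub>i\<close> under the braiding with the dual, up to the
  common factor \<open>q\<^bsup>-w\<^esup>\<close>, for \<open>t = q\<^bsup>-2\<^esup>\<close>.\<close>

definition mixed_coeff :: "complex \<Rightarrow> nat \<Rightarrow> nat \<Rightarrow> complex" where
  "mixed_coeff t i k = (if k = i then 1 else if k < i then (t - 1) * t ^ (i - k - 1) else 0)"

text \<open>This is the recursion that applying \<open>F\<^bsub>\<tau> i\<^esub>\<close> to \<open>b\<^sub>i \<otimes> \<phi>\<^bsub>i+1\<^esub>\<close> produces. Both row and column sums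
  telescope by it to single powers of \<open>t\<close>. Up to a fixed power of \<open>q\<close>, these are the pivotal weights
  \<open>q\<^bsup>(\<lambda>\<^sub>i, 2\<rho>)\<^esup>\<close> and their inverses.\<close>

lemma mixed_coeff_Suc: "mixed_coeff t (Suc i) k = t * mixed_coeff t i k + of_bool (k = Suc i) - of_bool (k = i)"
proof -
  consider "k = i" | "k = Suc i" | "k > Suc i" | d where "i = Suc (k + d)"
    using less_imp_Suc_add[of k i] by fastforce
  then show ?thesis by cases (auto simp: mixed_coeff_def)
qed

lemma sum_mixed_coeff_right: "(\<Sum>k=1..Suc i. mixed_coeff t (Suc i) k) = t ^ i"
proof -
  have *: "i < n \<Longrightarrow> (\<Sum>k=1..n. mixed_coeff t (Suc i) k) = t ^ i" for n
  proof (induction i)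
    case 0
    have "(\<Sum>k=1..n. mixed_coeff t (Suc 0) k) = (\<Sum>k=1..n. if k = 1 then 1 else 0)"
      by (intro sum.cong) (auto simp: mixed_coeff_def)
    then show ?case using 0 by simp
  next
    case (Suc i)
    have "(\<Sum>k=1..n. mixed_coeff t (Suc (Suc i)) k) = t * (\<Sum>k=1..n. mixed_coeff t (Suc i) k)
        + (\<Sum>k=1..n. of_bool (k = Suc (Suc i))) - (\<Sum>k=1..n. of_bool (k = Suc i))"
      unfolding mixed_coeff_Suc[of t "Suc i"] by (simp only: sum.distrib sum_subtractf sum_distrib_left)
    then show ?case using Suc by (simp add: of_bool_def)
  qed
  show ?thesis by (rule *) simp
qed

lemma sum_mixed_coeff_left:
  "1 \<le> k \<Longrightarrow> (\<Sum>i=1..n. mixed_coeff t i k) = (if k \<le> n then t ^ (n - k) else 0)"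
proof (induction n)
  case (Suc n)
  then show ?case
    by (cases "k = Suc n") (auto simp: mixed_coeff_def Suc_diff_le algebra_simps simp flip: power_Suc)
qed simp

lemma matrix_vector_axis: "A *v axis k 1 = column k A" for A :: "complex^'m::finite^'k"
  by (simp add: vec_eq_iff matrix_vector_mult_def column_def axis_def if_distrib[of "(*) _"] cong: if_cong)

context vector_rep begin

text \<open>The basis dual to \<open>b\<^sub>1, \<dots>, b\<^bsub>r+1\<^esub>\<close>, hence the inverse factors.\<close>

definition \<phi> :: "nat \<Rightarrow> complex^'n" where "\<phi> k = inverse (c k) *s axis (\<iota> k) 1"

lemma iota_eq: "k \<in> {1..r+1} \<Longrightarrow> l \<in> {1..r+1} \<Longrightarrow> \<iota> k = \<iota> l \<longleftrightarrow> k = l"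
  using iota unfolding bij_betw_def inj_on_def by blast

lemma transpose_phi:
  assumes "k \<in> {1..r+1}" "\<And>l. l \<in> {1..r+1} \<Longrightarrow> (M *v b l) $ \<iota> k / (c k * c l) = v $ \<iota> l"
  shows "transpose M *v \<phi> k = v"
proof -
  have "(transpose M *v \<phi> k) $ a = v $ a" for a
  proof -
    obtain l where l: "l \<in> {1..r+1}" "a = \<iota> l" by (rule iota_surj)
    have "(M *v b l) $ \<iota> k = M $ \<iota> k $ \<iota> l * c l"
      by (simp add: scaled_axis_def vector_scalar_commute mult.commute matrix_vector_axis column_def)
    moreover have "(transpose M *v \<phi> k) $ \<iota> l = M $ \<iota> k $ \<iota> l / c k"
      by (simp add: \<phi>_def vector_scalar_commute matrix_vector_axis column_def transpose_def divide_inverse mult.commute)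
    ultimately show ?thesis using assms(2)[OF l(1)] l c_nonzero[OF l(1)] by (simp add: field_simps)
  qed
  then show ?thesis by (simp add: vec_eq_iff)
qed

lemma b_nth: "k \<in> {1..r+1} \<Longrightarrow> l \<in> {1..r+1} \<Longrightarrow> b k $ \<iota> l = (if k = l then c k else 0)"
  and phi_nth: "k \<in> {1..r+1} \<Longrightarrow> l \<in> {1..r+1} \<Longrightarrow> \<phi> k $ \<iota> l = (if k = l then inverse (c k) else 0)"
  by (auto simp: scaled_axis_def \<phi>_def axis_def iota_eq)

lemma Kmat_phi: "j \<in> {1..r} \<Longrightarrow> k \<in> {1..r+1} \<Longrightarrow>
    Kmat (dual_rep X) (\<tau> j) *v \<phi> k = qpow q (of_bool (Suc j = k) - of_bool (j = k)) *s \<phi> k"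
  unfolding dual_rep_def uq_rep.simps
  by (rule transpose_phi) (auto simp: Kinv_b b_nth phi_nth c_nonzero field_simps)

lemma Kinv_phi: "j \<in> {1..r} \<Longrightarrow> k \<in> {1..r+1} \<Longrightarrow>
    Kinv (dual_rep X) (\<tau> j) *v \<phi> k = qpow q (of_bool (j = k) - of_bool (Suc j = k)) *s \<phi> k"
  unfolding dual_rep_def uq_rep.simps
  by (rule transpose_phi) (auto simp: Kmat_b b_nth phi_nth c_nonzero field_simps)

lemma neg_mult_vec: "(- A) *v x = - (A *v x)" for A :: "complex^'m^'k"
  by (simp add: matrix_vector_mult_def vec_eq_iff sum_negf)

lemma Emat_phi: "j \<in> {1..r} \<Longrightarrow> k \<in> {1..r+1} \<Longrightarrow>
    Emat (dual_rep X) (\<tau> j) *v \<phi> k = (if k = j then (- z) *s \<phi> (Suc j) else 0)"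
  unfolding dual_rep_def uq_rep.simps
  by (rule transpose_phi)
     (auto simp: neg_mult_vec matrix_vector_mul_assoc[symmetric] Kinv_b Emat_b vector_scalar_commute
        b_nth phi_nth c_nonzero field_simps z_def)

lemma Fmat_phi: "j \<in> {1..r} \<Longrightarrow> k \<in> {1..r+1} \<Longrightarrow>
    Fmat (dual_rep X) (\<tau> j) *v \<phi> k = (if k = Suc j then (- inverse z) *s \<phi> j else 0)"
  unfolding dual_rep_def uq_rep.simps
  by (rule transpose_phi)
     (auto simp: neg_mult_vec matrix_vector_mul_assoc[symmetric] Kmat_b Fmat_b vector_scalar_commute
        b_nth phi_nth c_nonzero field_simps qpow_m1)

lemma mult_neg_vec: "A *v (- x) = - (A *v x)" for A :: "complex^'m^'k"
  by (simp add: matrix_vector_mult_def vec_eq_iff sum_negf)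

lemma tensor_vec_neg: "tensor_vec (- x) y = - tensor_vec x y" "tensor_vec x (- y) = - tensor_vec x y"
  by (simp_all add: tensor_vec_def vec_eq_iff)

text \<open>On the dual basis \<open>F\<^bsub>\<tau> j\<^esub>\<close> sends \<open>\<phi>\<^bsub>j+1\<^esub>\<close> to \<open>- q\<^sup>-\<^sup>1 \<phi>\<^sub>j\<close>. Reversing the order and absorbing these factors
  gives the dual module the standard form.\<close>

definition dual_scale :: "nat \<Rightarrow> complex" where
  "dual_scale k = (- inverse z) ^ k / c (r + 2 - k)"

lemma dual_basis: "scaled_axis (\<lambda>k. \<iota> (r + 2 - k)) dual_scale k = (- inverse z) ^ k *s \<phi> (r + 2 - k)"
  by (simp add: scaled_axis_def dual_scale_def \<phi>_def divide_inverse)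

lemma dual: "vector_rep r q (\<lambda>j. \<tau> (r + 1 - j)) (\<lambda>k. \<iota> (r + 2 - k)) dual_scale (dual_rep X)"
proof
  show "(\<forall>j\<in>{1..r}. \<tau> (r + 1 - j) = j) \<or> (\<forall>j\<in>{1..r}. \<tau> (r + 1 - j) = r + 1 - j)"
  proof -
    have "r + 1 - j \<in> {1..r} \<and> r + 1 - (r + 1 - j) = j" if "j \<in> {1..r}" for j using that by auto
    then show ?thesis using tau by metis
  qed
  have "bij_betw (\<lambda>k. r + 2 - k) {1..r+1} {1..r+1}"
    by (rule bij_betwI[of _ _ _ "\<lambda>k. r + 2 - k"]) auto
  from bij_betw_trans[OF this iota] show "bij_betw (\<lambda>k. \<iota> (r + 2 - k)) {1..r+1} UNIV"
    by (simp add: o_def)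
  show "dual_scale k \<noteq> 0" if "k \<in> {1..r+1}" for k
  proof -
    have "r + 2 - k \<in> {1..r+1}" using that by auto
    from c_nonzero[OF this] show ?thesis by (simp add: dual_scale_def)
  qed
  fix j k assume j: "j \<in> {1..r}" and k: "k \<in> {1..r+1}"
  have j': "r + 1 - j \<in> {1..r}" and k': "r + 2 - k \<in> {1..r+1}" using j k by auto
  have e: "(Suc (r + 1 - j) = r + 2 - k) = (j = k)" "(r + 1 - j = r + 2 - k) = (Suc j = k)"
    "(r + 2 - k = r + 1 - j) = (k = Suc j)" "(r + 2 - k = Suc (r + 1 - j)) = (k = j)"
    using j k by auto
  have f: "Suc (r + 1 - j) = r + 2 - j" "r + 1 - j = r + 2 - Suc j" using j by auto
  show "Kmat (dual_rep X) (\<tau> (r + 1 - j)) *v scaled_axis (\<lambda>k. \<iota> (r + 2 - k)) dual_scale k =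
      qpow q (of_bool (j = k) - of_bool (Suc j = k)) *s scaled_axis (\<lambda>k. \<iota> (r + 2 - k)) dual_scale k"
    unfolding dual_basis vector_scalar_commute Kmat_phi[OF j' k'] e by (simp add: mult.commute)
  show "Kinv (dual_rep X) (\<tau> (r + 1 - j)) *v scaled_axis (\<lambda>k. \<iota> (r + 2 - k)) dual_scale k =
      qpow q (of_bool (Suc j = k) - of_bool (j = k)) *s scaled_axis (\<lambda>k. \<iota> (r + 2 - k)) dual_scale k"
    unfolding dual_basis vector_scalar_commute Kinv_phi[OF j' k'] e by (simp add: mult.commute)
  show "Emat (dual_rep X) (\<tau> (r + 1 - j)) *v scaled_axis (\<lambda>k. \<iota> (r + 2 - k)) dual_scale k =
      (if k = Suc j then scaled_axis (\<lambda>k. \<iota> (r + 2 - k)) dual_scale j else 0)"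
    unfolding dual_basis vector_scalar_commute Emat_phi[OF j' k'] e f(1) by simp
  show "Fmat (dual_rep X) (\<tau> (r + 1 - j)) *v scaled_axis (\<lambda>k. \<iota> (r + 2 - k)) dual_scale k =
      (if k = j then scaled_axis (\<lambda>k. \<iota> (r + 2 - k)) dual_scale (Suc j) else 0)"
    unfolding dual_basis vector_scalar_commute Fmat_phi[OF j' k'] e by simp
qed (use r_pos in auto)

lemma is_V_dual: "is_V r q (fweight r (\<tau> r)) (dual_rep X)"
  using vector_rep.is_V_X[OF dual] by simp

lemma dual_lowest: "lowest_weight_vector r q (dual_rep X) (w0 r (fweight r (\<tau> r))) (\<phi> 1)"
proof -
  have "lowest_weight_vector r q (dual_rep X) (w0 r (fweight r (\<tau> r)))
     ((- inverse z) ^ (r+1) *s \<phi> 1)"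
    using vector_rep.lowest[OF dual] unfolding dual_basis by simp
  moreover have "A *v (s *s x) = t *s (s *s x) \<longleftrightarrow> A *v x = t *s x" if "s \<noteq> 0" for A :: "complex^'n^'n" and s t x
  proof -
    have "t *s (s *s x) = s *s (t *s x)" by (simp add: mult.commute)
    then show ?thesis unfolding vector_scalar_commute using scale_cancel[OF _ that] by metis
  qed
  moreover have "(- inverse z) ^ (r+1) \<noteq> 0" by simp
  ultimately show ?thesis
    unfolding lowest_weight_vector_def weight_vector_def
    by (simp only: vector_scalar_commute vec.scale_eq_0_iff simp_thms) blast
qed

lemma w0_dual: "w0 r (fweight r (\<tau> r)) = (\<lambda>j. - fweight r (\<tau> 1) j)"
  using w0_fweight[OF tau_in[OF r_in]] tau_flip[OF r_in] by simp

lemma qpow_dual: "qpow q (- (real r / real (r+1))) = inverse \<kappa>"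
  unfolding \<kappa>_def by (rule qpow_minus) simp

lemma K_phi_simps: "j \<in> {1..r} \<Longrightarrow> Kinv (dual_rep X) (\<tau> j) *v \<phi> j = z *s \<phi> j"
  "j \<in> {1..r} \<Longrightarrow> Kinv (dual_rep X) (\<tau> j) *v \<phi> (Suc j) = inverse z *s \<phi> (Suc j)"
  "j \<in> {1..r} \<Longrightarrow> k \<in> {1..r+1} \<Longrightarrow> k \<noteq> j \<Longrightarrow> k \<noteq> Suc j \<Longrightarrow> Kinv (dual_rep X) (\<tau> j) *v \<phi> k = \<phi> k"
  by (auto simp: Kinv_phi z_def[symmetric] qpow_m1)

text \<open>Here \<open>b\<^sub>1 \<otimes> \<phi>\<^sub>1\<close> is the product of a highest and a lowest weight vector. Applying generators to it reaches
  all \<open>b\<^sub>i \<otimes> \<phi>\<^sub>j\<close> with \<open>i \<noteq> j\<close>, where the braiding is a multiple of the flip, and passing through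
  \<open>b\<^sub>i \<otimes> \<phi>\<^bsub>i+1\<^esub>\<close> relates consecutive diagonal vectors.\<close>

lemma
  assumes R: "is_braiding r q X (dual_rep X) R"
  shows braiding_dual_off: "i \<in> {1..r+1} \<Longrightarrow> j \<in> {1..r+1} \<Longrightarrow> i \<noteq> j \<Longrightarrow>
        R *v tensor_vec (b i) (\<phi> j) = (z / \<kappa>) *s tensor_vec (\<phi> j) (b i)"
    and braiding_dual_first: "R *v tensor_vec (b 1) (\<phi> 1) = inverse \<kappa> *s tensor_vec (\<phi> 1) (b 1)"
    and braiding_dual_Suc: "i \<in> {1..r} \<Longrightarrow> R *v tensor_vec (b (Suc i)) (\<phi> (Suc i)) =
        inverse (z * z) *s (R *v tensor_vec (b i) (\<phi> i))
        + inverse \<kappa> *s (tensor_vec (\<phi> (Suc i)) (b (Suc i)) - tensor_vec (\<phi> i) (b i))"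
proof -
  let ?U = "\<lambda>i j. tensor_vec (b i) (\<phi> j)" and ?U' = "\<lambda>j i. tensor_vec (\<phi> j) (b i)"
  note act = Fmat_tensor_vec Emat_tensor_vec Emat_b Fmat_b Emat_phi Fmat_phi K_simps K_phi_simps tensor_vec_simps
    vector_scalar_commute matrix_vector_right_distrib matrix_vector_mult_diff_distrib
    mult_neg_vec tensor_vec_neg
  note F = braiding_Fmat[OF R tau_in] note E = braiding_Emat[OF R tau_in]
  show 0: "R *v ?U 1 1 = inverse \<kappa> *s ?U' 1 1"
    using braiding_extreme[OF R is_V_X is_V_dual highest dual_lowest]
    unfolding w0_dual wform_minus_right wform_ends qpow_dual .
  have 1: "R *v ?U i 1 = (z / \<kappa>) *s ?U' 1 i" if "Suc 1 \<le> i" "i \<le> r+1" for i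
    using that
  proof (induction i rule: dec_induct)
    case base
    then show ?case using F[of 1 "?U 1 1"] 0 r_pos by (simp add: act divide_inverse mult.commute)
  next
    case (step i)
    then show ?case using F[of i "?U i 1"] by (simp add: act)
  qed
  have E': "R *v ?U i (Suc j) = (z / \<kappa>) *s ?U' (Suc j) i"
    if "j \<in> {1..r}" "(- z) *s (R *v ?U i (Suc j)) = (- z) *s ((z / \<kappa>) *s ?U' (Suc j) i)" for i j
    using scale_cancel[OF that(2)] by simp
  have 2: "R *v ?U i j = (z / \<kappa>) *s ?U' j i" if "1 \<le> j" "j < i" "i \<le> r+1" for i j
    using that
  proof (induction j rule: dec_induct)
    case base then show ?case using 1 by simp
  next
    case (step j)
    then show ?case using E[of j "?U i j"] by (intro E') (simp_all add: act mult.commute mult.left_commute)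
  qed
  have 3: "R *v ?U 1 j = (z / \<kappa>) *s ?U' j 1" if "Suc 1 \<le> j" "j \<le> r+1" for j
    using that
  proof (induction j rule: dec_induct)
    case base
    have "R *v ?U 1 (Suc 1) = (z / \<kappa>) *s ?U' (Suc 1) 1"
      using E[of 1 "?U 1 1"] 0 r_pos by (intro E') (simp_all add: act divide_inverse mult.commute mult.left_commute)
    then show ?case by simp
  next
    case (step j)
    then show ?case using E[of j "?U 1 j"] by (intro E') (simp_all add: act mult.commute mult.left_commute)
  qed
  have 4: "R *v ?U i j = (z / \<kappa>) *s ?U' j i" if "1 \<le> i" "i < j" "j \<le> r+1" for i j
    using that
  proof (induction i rule: dec_induct)
    case base then show ?case using 3 by simp
  next
    case (step i)
    then show ?case using F[of i "?U i j"] by (simp add: act)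
  qed
  show "R *v ?U i j = (z / \<kappa>) *s ?U' j i" if "i \<in> {1..r+1}" "j \<in> {1..r+1}" "i \<noteq> j"
    using 2[of j i] 4[of i j] that by (cases "i < j") auto
  show "R *v ?U (Suc i) (Suc i) = inverse (z * z) *s (R *v ?U i i)
        + inverse \<kappa> *s (?U' (Suc i) (Suc i) - ?U' i i)" if i: "i \<in> {1..r}"
  proof -
    have zz: "z * (inverse z * x) = x" for x by simp
    have "R *v (?U (Suc i) (Suc i) - inverse (z * z) *s ?U i i) =
        inverse \<kappa> *s (?U' (Suc i) (Suc i) - ?U' i i)"
      using F[of i "?U i (Suc i)"] 4[of i "Suc i"] i
      by (simp add: act divide_inverse algebra_simps zz)
    then show ?thesis
      by (simp only: matrix_vector_mult_diff_distrib vector_scalar_commute diff_eq_eq add.commute)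
  qed
qed

end

section \<open>Matrix entries of the braidings\<close>

text \<open>The rank of a basis index in the order of decreasing weights. In the entries of the braidings below the
  factors \<open>c\<close> cancel, so that this order is all that remains of the choice of a standard basis.\<close>

definition position :: "nat \<Rightarrow> (nat \<Rightarrow> 'n) \<Rightarrow> 'n \<Rightarrow> nat" where
  "position r \<iota> = the_inv_into {1..r+1} \<iota>"

text \<open>The coefficient of \<open>v\<^sub>x \<otimes> v\<^sub>y\<close> in the image of \<open>v\<^sub>a \<otimes> v\<^sub>b\<close> under the Hecke type braiding. The pairs that
  receive the correction term are a parameter because \<open>V\<close> and its dual order the indices oppositely.\<close>

definition hecke_entry :: "complex \<Rightarrow> complex \<Rightarrow> ('n \<Rightarrow> 'n \<Rightarrow> bool) \<Rightarrow> 'n \<Rightarrow> 'n \<Rightarrow> 'n \<Rightarrow> 'n \<Rightarrow> complex" where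
  "hecke_entry \<kappa> z inverted x y a b =
     (if a = b then \<kappa> * of_bool (x = a \<and> y = b)
      else \<kappa> / z * of_bool (x = b \<and> y = a)
         + (if inverted a b then (\<kappa> - \<kappa> / z / z) * of_bool (x = a \<and> y = b) else 0))"

text \<open>Likewise for the braiding of \<open>V\<close> with its dual; here \<open>b\<close> and \<open>x\<close> index the dual legs.\<close>

definition mixed_entry :: "complex \<Rightarrow> complex \<Rightarrow> ('n \<Rightarrow> nat) \<Rightarrow> 'n \<Rightarrow> 'n \<Rightarrow> 'n \<Rightarrow> 'n \<Rightarrow> complex" where
  "mixed_entry \<kappa> z \<pi> x y a b =
     (if a = b then of_bool (x = y) * mixed_coeff (inverse (z * z)) (\<pi> a) (\<pi> x) / \<kappa>
      else z / \<kappa> * of_bool (x = b \<and> y = a))"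

lemma tensor_axis: "tensor_vec (axis a 1) (axis b 1) = axis (a, b) 1"
  by (auto simp: tensor_vec_def axis_def vec_eq_iff)

lemma matrix_entry_tensor: "R $ x $ (a, b) = (R *v tensor_vec (axis a 1) (axis b 1)) $ x"
  by (simp add: tensor_axis matrix_vector_axis column_def)

lemma axis_nth_pair: "axis (a, b) (1::complex) $ (x, y) = of_bool (x = a \<and> y = b)"
  by (auto simp: axis_def)

lemma inverse_cancel:
  fixes u v :: complex
  assumes "u \<noteq> 0" "v \<noteq> 0"
  shows "inverse v * (inverse u * (v * u)) = 1" "inverse v * (inverse u * (u * v)) = 1"
    "inverse u * (v * (inverse v * u)) = 1"
    "inverse u * (v * (u * inverse v)) = 1"
  using assms by (simp_all add: field_simps)

context vector_rep begin

abbreviation \<pi> where "\<pi> \<equiv> position r \<iota>"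

lemma \<pi>_\<iota>: "k \<in> {1..r+1} \<Longrightarrow> \<pi> (\<iota> k) = k"
  using iota by (simp add: position_def bij_betw_def the_inv_into_f_f)

lemma \<pi>_in: "\<pi> a \<in> {1..r+1}" and \<iota>_\<pi>: "\<iota> (\<pi> a) = a"
  using iota_surj[of a] \<pi>_\<iota> by metis+

lemma \<pi>_bij: "bij_betw \<pi> UNIV {1..r+1}"
  unfolding position_def by (rule bij_betw_the_inv_into[OF iota])

lemma \<pi>_eq: "\<pi> a = \<pi> a' \<longleftrightarrow> a = a'"
  using \<iota>_\<pi> by metis

lemma axis_b: "axis a 1 = inverse (c (\<pi> a)) *s b (\<pi> a)"
  using axis_eq_b[OF \<pi>_in, of a] by (simp add: \<iota>_\<pi>)

lemma b_\<pi>: "b (\<pi> a) = c (\<pi> a) *s axis a 1"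
  by (simp add: scaled_axis_def \<iota>_\<pi>)

lemma phi_\<pi>: "\<phi> (\<pi> a) = inverse (c (\<pi> a)) *s axis a 1"
  by (simp add: \<phi>_def \<iota>_\<pi>)

lemma braiding_self_entry:
  assumes "is_braiding r q X X R"
  shows "R $ (x, y) $ (a, b') = hecke_entry \<kappa> z (\<lambda>a a'. \<pi> a' < \<pi> a) x y a b'"
  unfolding matrix_entry_tensor
  unfolding axis_b tensor_vec_simps vector_scalar_commute braiding_self[OF assms \<pi>_in \<pi>_in]
  unfolding b_\<pi> tensor_vec_simps tensor_axis hecke_entry_def \<pi>_eq
  using c_nonzero[OF \<pi>_in, of a] c_nonzero[OF \<pi>_in, of b']
  by (auto simp: axis_nth_pair inverse_cancel)

lemma braiding_dual_diag:
  assumes R: "is_braiding r q X (dual_rep X) R"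
  shows "Suc i \<in> {1..r+1} \<Longrightarrow> (R *v tensor_vec (b (Suc i)) (\<phi> (Suc i))) $ (x, y) =
     of_bool (x = y) * mixed_coeff (inverse (z * z)) (Suc i) (\<pi> x) / \<kappa>"
proof (induction i)
  have U: "tensor_vec (\<phi> k) (b k) $ (x, y) = of_bool (x = y) * of_bool (\<pi> x = k)"
    if k: "k \<in> {1..r+1}" for k
    using k c_nonzero[OF k] \<pi>_\<iota>[OF k] \<iota>_\<pi>
    by (auto simp: tensor_vec_def \<phi>_def scaled_axis_def axis_def)
  {
    case 0
    show ?case
      using braiding_dual_first[OF R] U[of 1] \<pi>_in[of x] by (auto simp: mixed_coeff_def divide_inverse)
  next
    case (Suc i)
    then have i: "Suc i \<in> {1..r}" by simp
    show ?case
      unfolding braiding_dual_Suc[OF R i] mixed_coeff_Suc[of _ "Suc i"]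
      using Suc U[of "Suc i"] U[of "Suc (Suc i)"] by (simp add: field_simps)
  }
qed

lemma braiding_dual_entry:
  assumes R: "is_braiding r q X (dual_rep X) R"
  shows "R $ (x, y) $ (a, b') = mixed_entry \<kappa> z \<pi> x y a b'"
proof (cases "a = b'")
  case True
  obtain i where i: "\<pi> a = Suc i" "Suc i \<in> {1..r+1}"
    using \<pi>_in[of a] by (cases "\<pi> a") auto
  have "R $ (x, y) $ (a, a) = (R *v tensor_vec (b (\<pi> a)) (\<phi> (\<pi> a))) $ (x, y)"
    unfolding b_\<pi> phi_\<pi> tensor_vec_simps vector_scalar_commute matrix_entry_tensor
    using c_nonzero[OF \<pi>_in, of a] by simp
  then show ?thesis using braiding_dual_diag[OF R i(2)] True i by (simp add: mixed_entry_def)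
next
  case False
  then have "\<pi> a \<noteq> \<pi> b'" by (simp add: \<pi>_eq)
  have "R $ (x, y) $ (a, b') = (inverse (c (\<pi> a)) * c (\<pi> b')) * (R *v tensor_vec (b (\<pi> a)) (\<phi> (\<pi> b'))) $ (x, y)"
    unfolding b_\<pi> phi_\<pi> tensor_vec_simps vector_scalar_commute matrix_entry_tensor
    using c_nonzero[OF \<pi>_in, of a] c_nonzero[OF \<pi>_in, of b'] by (simp add: inverse_cancel)
  then show ?thesis
    unfolding braiding_dual_off[OF R \<pi>_in \<pi>_in \<open>\<pi> a \<noteq> \<pi> b'\<close>] unfolding b_\<pi> phi_\<pi> tensor_vec_simps tensor_axis
    using False c_nonzero[OF \<pi>_in, of a] c_nonzero[OF \<pi>_in, of b']
    by (simp add: mixed_entry_def axis_nth_pair inverse_cancel)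
qed

lemma braiding_dual_dual_entry:
  assumes "is_braiding r q (dual_rep X) (dual_rep X) R"
  shows "R $ (x, y) $ (a, b') = hecke_entry \<kappa> z (\<lambda>a a'. \<pi> a < \<pi> a') x y a b'"
proof -
  have pos: "position r (\<lambda>k. \<iota> (r + 2 - k)) a = r + 2 - \<pi> a" for a
  proof -
    have "r + 2 - \<pi> a \<in> {1..r+1}" "r + 2 - (r + 2 - \<pi> a) = \<pi> a" using \<pi>_in[of a] by auto
    then show ?thesis using vector_rep.\<pi>_\<iota>[OF dual, of "r + 2 - \<pi> a"] \<iota>_\<pi>[of a] by simp
  qed
  have "(\<lambda>a a'. r + 2 - \<pi> a' < r + 2 - \<pi> a) = (\<lambda>a a'. \<pi> a < \<pi> a')"
  proof (intro ext)
    fix a a'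
    show "(r + 2 - \<pi> a' < r + 2 - \<pi> a) = (\<pi> a < \<pi> a')"
      using \<pi>_in[of a] \<pi>_in[of a'] by auto
  qed
  with vector_rep.braiding_self_entry[OF dual assms] show ?thesis
    unfolding pos vector_rep.\<kappa>_def[OF dual] vector_rep.z_def[OF dual] \<kappa>_def z_def by simp
qed

text \<open>The eigenvalues of the \<open>K\<^sub>i\<close> on a basis vector are known from its position, and they determine the pairing
  of its weight with \<open>2\<rho>\<close>.\<close>

lemma pairing_two_rho:
  assumes w: "\<And>i. i \<in> {1..r} \<Longrightarrow> Kmat X i *v axis a 1 = qpow q (wform r (sroot i) \<mu>) *s axis a 1"
  shows "wform r \<mu> (two_rho r) = real r + 2 - 2 * real (\<pi> a)"
proof -
  have e: "wform r (sroot (\<tau> j)) \<mu> = of_bool (j = \<pi> a) - of_bool (Suc j = \<pi> a)" if j: "j \<in> {1..r}" for j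
  proof -
    have "Kmat X (\<tau> j) *v axis a 1 = qpow q (of_bool (j = \<pi> a) - of_bool (Suc j = \<pi> a)) *s axis a 1"
      unfolding axis_b vector_scalar_commute Kmat_b[OF j \<pi>_in] by (simp add: mult.commute)
    with w[OF tau_in[OF j]] have "(qpow q (wform r (sroot (\<tau> j)) \<mu>) *s axis a 1) $ a =
        (qpow q (of_bool (j = \<pi> a) - of_bool (Suc j = \<pi> a)) *s axis a 1) $ a" by simp
    then have "qpow q (wform r (sroot (\<tau> j)) \<mu>) = qpow q (of_bool (j = \<pi> a) - of_bool (Suc j = \<pi> a))"
      by (simp add: axis_def)
    then show ?thesis by (simp only: qpow_inject q_pos q_less)
  qed
  have bij: "bij_betw \<tau> {1..r} {1..r}"
    unfolding bij_betw_def inj_on_def using tau_inj tau_in tau_surj by (metis image_eqI subset_antisym subsetI image_subsetI)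
  have inv: "real (\<tau> j) * (real r + 1 - real (\<tau> j)) = real j * (real r + 1 - real j)" if "j \<in> {1..r}" for j
    using tau that by (auto simp: of_nat_diff algebra_simps)
  have "wform r \<mu> (two_rho r) = (\<Sum>j=1..r. real (\<tau> j) * (real r + 1 - real (\<tau> j)) * wform r (sroot (\<tau> j)) \<mu>)"
    unfolding wform_two_rho_expand by (rule sum.reindex_bij_betw[OF bij, symmetric])
  also have "\<dots> = (\<Sum>j=1..r. (if j = \<pi> a then real j * (real r + 1 - real j) else 0)
       - (if j = \<pi> a - 1 then real j * (real r + 1 - real j) else 0))"
    using \<pi>_in[of a] by (intro sum.cong) (auto simp: inv e)
  also have "\<dots> = real (\<pi> a) * (real r + 1 - real (\<pi> a)) - real (\<pi> a - 1) * (real r + 1 - real (\<pi> a - 1))"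
  proof -
    have S: "(\<Sum>j=1..r. if j = p then real j * (real r + 1 - real j) else 0) = real p * (real r + 1 - real p)"
      if "p \<le> r + 1" for p
    proof -
      consider "p \<in> {1..r}" | "p = 0" | "p = r + 1" using \<open>p \<le> r + 1\<close> by fastforce
      then show ?thesis by cases auto
    qed
    have "\<pi> a \<le> r + 1" "\<pi> a - 1 \<le> r + 1" using \<pi>_in[of a] by auto
    then show ?thesis by (simp only: sum_subtractf S)
  qed
  also have "\<dots> = real r + 2 - 2 * real (\<pi> a)"
    using \<pi>_in[of a] by (simp add: of_nat_diff algebra_simps)
  finally show ?thesis .
qed

end

section \<open>Recognising the fundamental module\<close>

text \<open>For a singular weight vector \<open>y\<close> the span of these vectors is a submodule.\<close>

inductive_set lowering_orbit :: "nat \<Rightarrow> 'n::finite uq_rep \<Rightarrow> complex^'n \<Rightarrow> (complex^'n) set" for r X y where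
  start: "y \<in> lowering_orbit r X y"
| lower: "x \<in> lowering_orbit r X y \<Longrightarrow> i \<in> {1..r} \<Longrightarrow> Fmat X i *v x \<in> lowering_orbit r X y"

primrec lowering_chain :: "(nat \<Rightarrow> nat) \<Rightarrow> 'n::finite uq_rep \<Rightarrow> complex^'n \<Rightarrow> nat \<Rightarrow> complex^'n" where
  "lowering_chain \<tau> X x 0 = x"
| "lowering_chain \<tau> X x (Suc k) = Fmat X (\<tau> (Suc k)) *v lowering_chain \<tau> X x k"

primrec chain_weight :: "(nat \<Rightarrow> nat) \<Rightarrow> weight \<Rightarrow> nat \<Rightarrow> weight" where
  "chain_weight \<tau> \<mu> 0 = \<mu>"
| "chain_weight \<tau> \<mu> (Suc k) = (\<lambda>i. chain_weight \<tau> \<mu> k i - sroot (\<tau> (Suc k)) i)"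

lemma span_invariant:
  fixes A :: "complex^'n^'n::finite"
  assumes "\<And>g. g \<in> G \<Longrightarrow> A *v g \<in> vec.span G" "x \<in> vec.span G"
  shows "A *v x \<in> vec.span G"
  using assms(2)
proof (induction rule: vec.span_induct_alt)
  case base then show ?case by (simp add: vec.span_zero)
next
  case (step c x y)
  then show ?case using assms(1)
    by (simp add: matrix_vector_right_distrib vector_scalar_commute vec.span_add vec.span_scale)
qed

text \<open>The abstract module of the quantum projective space: simple, of highest weight \<open>\<omega>\<^sub>s\<close> and of dimension
  \<open>r + 1\<close>, with a basis of weight vectors about which nothing else is known.\<close>

locale weighted_simple =
  fixes r :: nat and q :: real and s :: nat and X :: "'n::finite uq_rep" and wts :: "'n \<Rightarrow> weight"
  assumes rank_pos: "1 \<le> r" and q_pos [simp]: "0 < q" and q_less [simp]: "q < 1"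
    and node: "s \<in> {1, r}" and card: "CARD('n) = r + 1"
    and V: "is_V r q (fweight r s) X"
    and weights: "weight_vector r q X (wts a) (axis a 1)"
begin

definition has_weight :: "weight \<Rightarrow> complex^'n \<Rightarrow> bool" where
  "has_weight \<nu> x \<longleftrightarrow> (\<forall>i\<in>{1..r}. Kmat X i *v x = qpow q (wform r (sroot i) \<nu>) *s x)"

text \<open>The quantum integer \<open>[u]\<^sub>q\<close>.\<close>

definition bracket :: "real \<Rightarrow> complex" where
  "bracket u = (qpow q u - qpow q (- u)) / (qpow q 1 - qpow q (-1))"

lemma bracket_simps: "bracket 0 = 0" "bracket 1 = 1" "bracket (-1) = -1"
  using qpow_one_diff[OF q_pos q_less] by (simp_all add: bracket_def divide_simps)

lemma uq: "uq_module r q X" using V by (simp add: is_V_def simple_module_def)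

lemma Kinv_has_weight:
  assumes "has_weight \<nu> x" "i \<in> {1..r}"
  shows "Kinv X i *v x = qpow q (- wform r (sroot i) \<nu>) *s x"
proof -
  have "x = Kinv X i *v (Kmat X i *v x)"
    using uq assms(2) by (simp add: uq_module_def matrix_vector_mul_assoc)
  then have "x = qpow q (wform r (sroot i) \<nu>) *s (Kinv X i *v x)"
    using assms by (simp add: has_weight_def vector_scalar_commute)
  then have "inverse (qpow q (wform r (sroot i) \<nu>)) *s x =
      inverse (qpow q (wform r (sroot i) \<nu>)) *s (qpow q (wform r (sroot i) \<nu>) *s (Kinv X i *v x))" by simp
  then show ?thesis by (simp add: qpow_minus)
qed

lemma Fmat_has_weight:
  assumes "has_weight \<nu> x" "j \<in> {1..r}"
  shows "has_weight (\<lambda>i. \<nu> i - sroot j i) (Fmat X j *v x)"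
  unfolding has_weight_def
proof
  fix i assume i: "i \<in> {1..r}"
  have KK: "Kinv X i *v (Kmat X i *v x) = x"
    using uq i by (simp add: uq_module_def matrix_vector_mul_assoc)
  have "Kmat X i ** Fmat X j ** Kinv X i = mat (qpow q (- wform r (sroot i) (sroot j))) ** Fmat X j"
    using uq i assms(2) by (simp add: uq_module_def)
  then have "(Kmat X i ** Fmat X j ** Kinv X i) *v (Kmat X i *v x) =
     (mat (qpow q (- wform r (sroot i) (sroot j))) ** Fmat X j) *v (Kmat X i *v x)" by simp
  then have "Kmat X i *v (Fmat X j *v x) =
     qpow q (- wform r (sroot i) (sroot j)) *s (Fmat X j *v (Kmat X i *v x))"
    unfolding matrix_vector_mul_assoc[symmetric] mat_scalar_vec KK .
  also have "Kmat X i *v x = qpow q (wform r (sroot i) \<nu>) *s x"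
    using assms(1) i by (simp add: has_weight_def)
  also have "qpow q (- wform r (sroot i) (sroot j)) *s (Fmat X j *v (qpow q (wform r (sroot i) \<nu>) *s x))
     = qpow q (wform r (sroot i) (\<lambda>i. \<nu> i - sroot j i)) *s (Fmat X j *v x)"
    by (simp add: wform_diff_right vector_scalar_commute qpow_add[symmetric])
  finally show "Kmat X i *v (Fmat X j *v x) = qpow q (wform r (sroot i) (\<lambda>i. \<nu> i - sroot j i)) *s (Fmat X j *v x)" .
qed

lemma Emat_Fmat:
  assumes "has_weight \<nu> x" "i \<in> {1..r}" "j \<in> {1..r}"
  shows "Emat X i *v (Fmat X j *v x) = Fmat X j *v (Emat X i *v x) +
     (if i = j then bracket (wform r (sroot i) \<nu>) *s x else 0)"
proof -
  have "Emat X i ** Fmat X j - Fmat X j ** Emat X i =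
      (if i = j then mat (1 / (qpow q 1 - qpow q (-1))) ** (Kmat X i - Kinv X i) else 0)"
    using uq assms by (simp add: uq_module_def)
  then have "(Emat X i ** Fmat X j - Fmat X j ** Emat X i) *v x =
      (if i = j then mat (1 / (qpow q 1 - qpow q (-1))) ** (Kmat X i - Kinv X i) else 0) *v x" by simp
  then have "Emat X i *v (Fmat X j *v x) - Fmat X j *v (Emat X i *v x) =
      (if i = j then (1 / (qpow q 1 - qpow q (-1))) *s (Kmat X i *v x - Kinv X i *v x) else 0)"
    by (simp add: matrix_vector_mult_diff_rdistrib matrix_vector_mul_assoc[symmetric] mat_scalar_vec split: if_splits)
  moreover have "(1 / (qpow q 1 - qpow q (-1))) *s (Kmat X i *v x - Kinv X i *v x) = bracket (wform r (sroot i) \<nu>) *s x"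
    using assms Kinv_has_weight[OF assms(1,2)]
    by (simp add: has_weight_def bracket_def vec_eq_iff diff_divide_distrib algebra_simps)
  ultimately show ?thesis by (simp only: diff_eq_eq add.commute)
qed

text \<open>The \<open>K\<^sub>i\<close> are diagonal in the given basis, so a weight vector can only involve basis vectors on which
  the \<open>K\<^sub>i\<close> have the same eigenvalues.\<close>

lemma weight_of_coordinate:
  assumes "has_weight \<nu> x" "x $ a \<noteq> 0" "i \<in> {1..r}"
  shows "wform r (sroot i) \<nu> = wform r (sroot i) (wts a)"
proof -
  have K: "Kmat X i $ a $ a' = (if a = a' then qpow q (wform r (sroot i) (wts a)) else 0)" for a'
  proof -
    have "Kmat X i *v axis a' 1 = qpow q (wform r (sroot i) (wts a')) *s axis a' 1"
      using weights[of a'] assms(3) by (simp add: weight_vector_def)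
    from arg_cong[OF this[unfolded matrix_vector_axis], of "\<lambda>v. v $ a"] show ?thesis
      by (auto simp: column_def axis_def)
  qed
  have "(Kmat X i *v x) $ a = qpow q (wform r (sroot i) (wts a)) * x $ a"
    by (simp add: matrix_vector_mult_def K if_distrib[of "\<lambda>z. z * _"] cong: if_cong)
  moreover have "(Kmat X i *v x) $ a = qpow q (wform r (sroot i) \<nu>) * x $ a"
    using assms(1,3) by (simp add: has_weight_def)
  ultimately have "qpow q (wform r (sroot i) \<nu>) = qpow q (wform r (sroot i) (wts a))"
    using assms(2) by simp
  then show ?thesis by (simp only: qpow_inject q_pos q_less)
qed

lemma invariant_subspace:
  assumes "vec.subspace W" "\<And>i x. i \<in> {1..r} \<Longrightarrow> x \<in> W \<Longrightarrow> Kmat X i *v x \<in> W \<and> Kinv X i *v x \<in> W \<and>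
        Emat X i *v x \<in> W \<and> Fmat X i *v x \<in> W" "y \<in> W" "y \<noteq> 0"
  shows "W = UNIV"
proof -
  have "W = {0} \<or> W = UNIV"
    using V assms(1,2) unfolding is_V_def simple_module_def by metis
  then show ?thesis using assms(3,4) by blast
qed

text \<open>A nonzero \<open>y\<close> would generate the whole module by simplicity. But the vectors \<open>F\<^bsub>i\<^sub>1\<^esub> \<dots> F\<^bsub>i\<^sub>k\<^esub> y\<close> span the
  submodule generated by \<open>y\<close>, and all their weights have height at most that of \<open>\<mu>\<close>, so this submodule misses
  the highest weight vector.\<close>

lemma singular_vector_zero:
  assumes y: "has_weight \<mu> y" "\<And>i. i \<in> {1..r} \<Longrightarrow> Emat X i *v y = 0"
    and low: "wform r \<mu> (two_rho r) < wform r (fweight r s) (two_rho r)"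
  shows "y = 0"
proof (rule ccontr)
  assume "y \<noteq> 0"
  let ?G = "lowering_orbit r X y"
  have G: "\<exists>\<nu>. has_weight \<nu> x \<and> wform r \<nu> (two_rho r) \<le> wform r \<mu> (two_rho r) \<and>
     (\<forall>i\<in>{1..r}. Emat X i *v x \<in> vec.span ?G)" if "x \<in> ?G" for x
    using that
  proof induction
    case start
    then show ?case using y by (intro exI[of _ \<mu>]) (simp add: vec.span_zero)
  next
    case (lower x j)
    then obtain \<nu> where \<nu>: "has_weight \<nu> x" "wform r \<nu> (two_rho r) \<le> wform r \<mu> (two_rho r)"
      "\<forall>i\<in>{1..r}. Emat X i *v x \<in> vec.span ?G" by blast
    have "Emat X i *v (Fmat X j *v x) \<in> vec.span ?G" if i: "i \<in> {1..r}" for i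
    proof -
      have "Fmat X j *v (Emat X i *v x) \<in> vec.span ?G"
      proof (rule span_invariant)
        show "Emat X i *v x \<in> vec.span ?G" using \<nu>(3) i by blast
        show "Fmat X j *v g \<in> vec.span ?G" if "g \<in> ?G" for g
          by (rule vec.span_base, rule lowering_orbit.lower[OF that lower.hyps(2)])
      qed
      moreover have "(if i = j then bracket (wform r (sroot i) \<nu>) *s x else 0) \<in> vec.span ?G"
        by (simp add: vec.span_zero vec.span_scale vec.span_base lower.hyps)
      ultimately show ?thesis
        unfolding Emat_Fmat[OF \<nu>(1) i lower.hyps(2)] by (rule vec.span_add)
    qed
    moreover have "wform r (\<lambda>i. \<nu> i - sroot j i) (two_rho r) = wform r \<nu> (two_rho r) - 2"
      using wform_sroot_two_rho[OF lower.hyps(2)] wform_diff_right[of r "two_rho r" \<nu> "sroot j"]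
      by (simp only: wform_commute[of r _ "two_rho r"])
    ultimately show ?case
      using Fmat_has_weight[OF \<nu>(1) lower.hyps(2)] \<nu>(2)
      by (intro exI[of _ "\<lambda>i. \<nu> i - sroot j i"] conjI ballI) auto
  qed
  have "vec.span ?G = UNIV"
  proof (rule invariant_subspace)
    show "y \<in> vec.span ?G" by (intro vec.span_base lowering_orbit.start)
    fix i x assume i: "i \<in> {1..r}" and x: "x \<in> vec.span ?G"
    have gK: "Kmat X i *v g \<in> vec.span ?G" "Kinv X i *v g \<in> vec.span ?G" "Emat X i *v g \<in> vec.span ?G"
      if "g \<in> ?G" for g
    proof -
      obtain \<nu> where \<nu>: "has_weight \<nu> g" "Emat X i *v g \<in> vec.span ?G"
        using G[OF \<open>g \<in> ?G\<close>] i by blast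
      show "Kmat X i *v g \<in> vec.span ?G" "Kinv X i *v g \<in> vec.span ?G" "Emat X i *v g \<in> vec.span ?G"
        using \<nu> i Kinv_has_weight[OF \<nu>(1) i] that
        by (simp_all add: has_weight_def vec.span_scale vec.span_base)
    qed
    show "Kmat X i *v x \<in> vec.span ?G \<and> Kinv X i *v x \<in> vec.span ?G \<and>
        Emat X i *v x \<in> vec.span ?G \<and> Fmat X i *v x \<in> vec.span ?G"
    proof (intro conjI)
      show "Kmat X i *v x \<in> vec.span ?G" by (rule span_invariant[OF gK(1) x])
      show "Kinv X i *v x \<in> vec.span ?G" by (rule span_invariant[OF gK(2) x])
      show "Emat X i *v x \<in> vec.span ?G" by (rule span_invariant[OF gK(3) x])
      show "Fmat X i *v x \<in> vec.span ?G"
        by (rule span_invariant[OF _ x], rule vec.span_base, rule lowering_orbit.lower[OF _ i])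
    qed
  qed (use \<open>y \<noteq> 0\<close> in simp_all)
  moreover obtain x where x: "highest_weight_vector r q X (fweight r s) x"
    using V by (auto simp: is_V_def)
  then have hx: "has_weight (fweight r s) x" "x \<noteq> 0"
    by (simp_all add: highest_weight_vector_def weight_vector_def has_weight_def)
  then obtain a where a: "x $ a \<noteq> 0" by (auto simp: vec_eq_iff)
  have "z $ a = 0" if "z \<in> vec.span ?G" for z
    using that
  proof (induction rule: vec.span_induct_alt)
    case (step c g z)
    obtain \<nu> where \<nu>: "has_weight \<nu> g" "wform r \<nu> (two_rho r) \<le> wform r \<mu> (two_rho r)"
      using G[OF step(1)] by blast
    have "g $ a = 0"
    proof (rule ccontr)
      assume "g $ a \<noteq> 0"
      then have "wform r \<nu> (two_rho r) = wform r (fweight r s) (two_rho r)"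
        using weight_of_coordinate[OF \<nu>(1), of a] weight_of_coordinate[OF hx(1) a]
        by (intro wform_two_rho_cong) simp
      then show False using \<nu>(2) low by simp
    qed
    then show ?case using step by simp
  qed simp
  ultimately show False using a by blast
qed

text \<open>Start from the highest weight vector and put \<open>u\<^bsub>k+1\<^esub> = F\<^bsub>\<tau> (k+1)\<^esub> u\<^sub>k\<close>. By induction on \<open>k\<close>, every
  \<open>F\<^bsub>\<tau> j\<^esub> u\<^sub>k\<close> with \<open>j \<noteq> k + 1\<close> is singular of lower height, hence zero, and \<open>E\<^bsub>\<tau> k\<^esub> u\<^sub>k = u\<^bsub>k-1\<^esub>\<close>. So the chain
  spans the module. Its members have pairwise distinct weights, and there are as many of them as basis
  vectors; therefore each is a multiple of exactly one basis vector.\<close>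

lemma vector_rep_exists: "\<exists>\<tau> \<iota> c. vector_rep r q \<tau> \<iota> c X \<and> \<tau> 1 = s"
proof -
  define \<tau> where "\<tau> = (\<lambda>j. if s = 1 then j else r + 1 - j)"
  interpret relabelling r \<tau>
    by standard (use rank_pos in \<open>auto simp: \<tau>_def\<close>)
  have \<tau>1: "\<tau> 1 = s" using node rank_pos by (auto simp: \<tau>_def)
  obtain x where x: "highest_weight_vector r q X (fweight r s) x"
    using V by (auto simp: is_V_def)
  define u where "u = lowering_chain \<tau> X x"
  define \<Lambda> where "\<Lambda> = chain_weight \<tau> (fweight r s)"
  have u0: "u 0 = x" and uS: "u (Suc k) = Fmat X (\<tau> (Suc k)) *v u k" for k by (simp_all add: u_def)
  have pairing: "wform r (sroot (\<tau> j)) (\<Lambda> k) = of_bool (j = Suc k) - of_bool (j = k)"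
    if j: "j \<in> {1..r}" and "k \<le> r" for j k
    using that(2)
  proof (induction k)
    case 0
    then show ?case using fweight_pairing[OF j one_in] j by (simp add: \<Lambda>_def \<tau>1[symmetric])
  next
    case (Suc k)
    then show ?case
      using tau_cartan[OF j, of "Suc k"] by (auto simp: \<Lambda>_def wform_diff_right)
  qed
  have height: "wform r (\<Lambda> k) (two_rho r) = wform r (fweight r s) (two_rho r) - 2 * real k" if "k \<le> r" for k
    using that
  proof (induction k)
    case (Suc k)
    have "wform r (\<Lambda> (Suc k)) (two_rho r) = wform r (\<Lambda> k) (two_rho r) - wform r (sroot (\<tau> (Suc k))) (two_rho r)"
      by (simp only: wform_commute[of r _ "two_rho r"] \<Lambda>_def chain_weight.simps wform_diff_right)
    then show ?case using Suc wform_sroot_two_rho[OF tau_in[of "Suc k"]] by simp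
  qed (simp add: \<Lambda>_def)
  have hw: "has_weight (\<Lambda> k) (u k)" if "k \<le> r" for k
    using that
  proof (induction k)
    case 0
    then show ?case using x by (simp add: \<Lambda>_def u0 highest_weight_vector_def weight_vector_def has_weight_def)
  next
    case (Suc k)
    then show ?case using Fmat_has_weight[of "\<Lambda> k" "u k" "\<tau> (Suc k)"] tau_in[of "Suc k"]
      by (simp add: uS \<Lambda>_def)
  qed
  have EF: "Emat X (\<tau> i) *v (Fmat X (\<tau> j) *v u k) = Fmat X (\<tau> j) *v (Emat X (\<tau> i) *v u k) +
     (if i = j then bracket (of_bool (i = Suc k) - of_bool (i = k)) *s u k else 0)"
    if "i \<in> {1..r}" "j \<in> {1..r}" "k \<le> r" for i j k
    using Emat_Fmat[OF hw[OF that(3)] tau_in[OF that(1)] tau_in[OF that(2)]]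
    unfolding tau_inj[OF that(1,2)] pairing[OF that(1,3)] .
  have singular: "Fmat X (\<tau> j) *v u k = 0"
    if "j \<in> {1..r}" "k \<le> r" "\<And>i. i \<in> {1..r} \<Longrightarrow> Emat X (\<tau> i) *v (Fmat X (\<tau> j) *v u k) = 0" for j k
  proof (rule singular_vector_zero)
    show "has_weight (\<lambda>i. \<Lambda> k i - sroot (\<tau> j) i) (Fmat X (\<tau> j) *v u k)"
      using Fmat_has_weight[OF hw[OF that(2)] tau_in[OF that(1)]] .
    show "Emat X i *v (Fmat X (\<tau> j) *v u k) = 0" if "i \<in> {1..r}" for i
      using tau_surj[OF that] \<open>\<And>i. i \<in> {1..r} \<Longrightarrow> Emat X (\<tau> i) *v (Fmat X (\<tau> j) *v u k) = 0\<close> by metis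
    have "wform r (\<lambda>i. \<Lambda> k i - sroot (\<tau> j) i) (two_rho r) = wform r (\<Lambda> k) (two_rho r) - wform r (sroot (\<tau> j)) (two_rho r)"
      by (simp only: wform_commute[of r _ "two_rho r"] wform_diff_right)
    then show "wform r (\<lambda>i. \<Lambda> k i - sroot (\<tau> j) i) (two_rho r) < wform r (fweight r s) (two_rho r)"
      using height[OF that(2)] wform_sroot_two_rho[OF tau_in[OF that(1)]] by simp
  qed
  have main: "(\<forall>j\<in>{1..r}. Emat X (\<tau> j) *v u k = (if j = k then u (k - 1) else 0)) \<and>
     (\<forall>j\<in>{1..r}. j \<noteq> Suc k \<longrightarrow> Fmat X (\<tau> j) *v u k = 0)" if "k \<le> r" for k
    using that
  proof (induction k rule: less_induct)
    case (less k)
    show ?case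
    proof (cases k)
      case 0
      have E: "Emat X (\<tau> j) *v u 0 = 0" if "j \<in> {1..r}" for j
        using x tau_in[OF that] by (simp add: u0 highest_weight_vector_def)
      moreover have "Fmat X (\<tau> j) *v u 0 = 0" if "j \<in> {1..r}" "j \<noteq> Suc 0" for j
        using that(1) by (rule singular) (use that E in \<open>auto simp: EF bracket_simps\<close>)
      ultimately show ?thesis unfolding 0 by auto
    next
      case (Suc l)
      then have l: "l < k" "l \<le> r" "Suc l \<le> r" using less.prems by auto
      have Fl: "Fmat X (\<tau> j) *v u l = 0" if "j \<in> {1..r}" "j \<noteq> Suc l" for j
        using less.IH[OF l(1,2)] that by blast
      have El: "Emat X (\<tau> j) *v u l = (if j = l then u (l - 1) else 0)" if "j \<in> {1..r}" for j
        using less.IH[OF l(1,2)] that by blast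
      have E: "Emat X (\<tau> j) *v u (Suc l) = (if j = Suc l then u l else 0)" if j: "j \<in> {1..r}" for j
      proof -
        have "Fmat X (\<tau> (Suc l)) *v u (l - 1) = 0" if "j = l"
        proof -
          have "l - 1 < k" "l - 1 \<le> r" "Suc l \<noteq> Suc (l - 1)" using l j that by auto
          then show ?thesis using less.IH[of "l - 1"] l by auto
        qed
        then show ?thesis
          unfolding uS using j l by (auto simp: EF El bracket_simps)
      qed
      moreover have "Fmat X (\<tau> j) *v u (Suc l) = 0" if j: "j \<in> {1..r}" "j \<noteq> Suc (Suc l)" for j
      proof (rule singular[OF j(1) l(3)])
        fix i assume i: "i \<in> {1..r}"
        show "Emat X (\<tau> i) *v (Fmat X (\<tau> j) *v u (Suc l)) = 0"
          unfolding EF[OF i j(1) l(3)] E[OF i]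
          using i j Fl[OF j(1)] uS[of l] by (auto simp: bracket_simps)
      qed
      ultimately show ?thesis unfolding Suc by auto
    qed
  qed
  have E: "Emat X (\<tau> j) *v u k = (if j = k then u (k - 1) else 0)" if "j \<in> {1..r}" "k \<le> r" for j k
    using main[OF that(2)] that(1) by blast
  have F: "Fmat X (\<tau> j) *v u k = (if j = Suc k then u (Suc k) else 0)" if "j \<in> {1..r}" "k \<le> r" for j k
    using main[OF that(2)] that(1) uS[of k] by auto
  have nz: "u k \<noteq> 0" if "k \<le> r" for k
    using that
  proof (induction k)
    case 0
    then show ?case using x by (simp add: u0 highest_weight_vector_def weight_vector_def)
  next
    case (Suc k)
    then show ?case using E[of "Suc k" "Suc k"] by auto
  qed
  have span: "vec.span (u ` {..r}) = UNIV"
  proof (rule invariant_subspace)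
    show "u 0 \<in> vec.span (u ` {..r})" by (intro vec.span_base) simp
    show "u 0 \<noteq> 0" by (rule nz) simp
    fix i z assume "i \<in> {1..r}" and z: "z \<in> vec.span (u ` {..r})"
    then obtain j where j: "i = \<tau> j" "j \<in> {1..r}" by (metis tau_surj)
    have g: "Kmat X i *v g \<in> vec.span (u ` {..r}) \<and> Kinv X i *v g \<in> vec.span (u ` {..r}) \<and>
        Emat X i *v g \<in> vec.span (u ` {..r}) \<and> Fmat X i *v g \<in> vec.span (u ` {..r})" if "g \<in> u ` {..r}" for g
    proof -
      obtain k where k: "g = u k" "k \<le> r" using \<open>g \<in> u ` {..r}\<close> by auto
      have "u k \<in> vec.span (u ` {..r})" if "k \<le> r" for k using that by (intro vec.span_base) simp
      then show ?thesis
        using hw[OF k(2)] Kinv_has_weight[OF hw[OF k(2)] \<open>i \<in> {1..r}\<close>] \<open>i \<in> {1..r}\<close> E[OF j(2) k(2)] F[OF j(2) k(2)] k j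
        by (auto simp: has_weight_def vec.span_scale vec.span_zero)
    qed
    show "Kmat X i *v z \<in> vec.span (u ` {..r}) \<and> Kinv X i *v z \<in> vec.span (u ` {..r}) \<and>
        Emat X i *v z \<in> vec.span (u ` {..r}) \<and> Fmat X i *v z \<in> vec.span (u ` {..r})"
      by (intro conjI span_invariant[OF _ z]) (use g in blast)+
  qed simp
  have "\<exists>k\<le>r. u k $ a \<noteq> 0" for a
  proof (rule ccontr)
    assume c: "\<not> (\<exists>k\<le>r. u k $ a \<noteq> 0)"
    have "z $ a = 0" if "z \<in> vec.span (u ` {..r})" for z
      using that by (induction rule: vec.span_induct_alt) (use c in auto)
    then have "axis a (1::complex) $ a = 0" unfolding span by blast
    then show False by simp
  qed
  then obtain g where g: "\<And>a. g a \<le> r" "\<And>a. u (g a) $ a \<noteq> 0" by metis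
  \<comment> \<open>The weights of the \<open>u\<^sub>k\<close> are distinct: \<open>u\<^sub>k\<close> with \<open>k \<ge> 1\<close> is the only one that pairs to \<open>-1\<close> with \<open>\<alpha>\<^bsub>\<tau> k\<^esub>\<close>.\<close>
  have g_eq: "g a = k" if k: "k \<le> r" "u k $ a \<noteq> 0" for a k
  proof (rule ccontr)
    assume ne: "g a \<noteq> k"
    have eq: "(of_bool (j = Suc k) - of_bool (j = k) :: real) = of_bool (j = Suc (g a)) - of_bool (j = g a)"
      if j: "j \<in> {1..r}" for j
      using weight_of_coordinate[OF hw[OF k(1)] k(2) tau_in[OF j]]
        weight_of_coordinate[OF hw[OF g(1)] g(2) tau_in[OF j]] pairing[OF j k(1)] pairing[OF j g(1)] by simp
    show False
    proof (cases "g a < k")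
      case True
      then show False using eq[of k] k(1) by (simp add: of_bool_def split: if_splits)
    next
      case False
      then have "g a \<in> {1..r}" "k < g a" using ne g(1)[of a] by auto
      then show False using eq[of "g a"] by (simp add: of_bool_def split: if_splits)
    qed
  qed
  have "g ` UNIV = {..r}"
  proof
    show "{..r} \<subseteq> g ` UNIV"
    proof
      fix k assume "k \<in> {..r}"
      then obtain a where "u k $ a \<noteq> 0" using nz[of k] by (auto simp: vec_eq_iff)
      then have "g a = k" using g_eq \<open>k \<in> {..r}\<close> by simp
      then show "k \<in> g ` UNIV" by blast
    qed
  qed (use g in auto)
  moreover have "inj g"
    by (rule eq_card_imp_inj_on) (simp_all add: calculation card)
  ultimately have bij: "bij_betw g UNIV {..r}" by (simp add: bij_betw_def)
  define h where "h = the_inv_into UNIV g"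
  have h: "bij_betw h {..r} UNIV" unfolding h_def by (rule bij_betw_the_inv_into[OF bij])
  have gh: "g (h k) = k" if "k \<le> r" for k
    unfolding h_def using f_the_inv_into_f_bij_betw[OF bij] that by simp
  have hg: "h (g a) = a" for a
    unfolding h_def using bij by (simp add: bij_betw_def the_inv_into_f_f)
  define \<iota> where "\<iota> k = h (k - 1)" for k
  define c where "c k = u (k - 1) $ \<iota> k" for k
  have b: "scaled_axis \<iota> c k = u (k - 1)" if k: "k \<in> {1..r+1}" for k
  proof -
    have k': "k - 1 \<le> r" using k by auto
    have "u (k - 1) $ a = 0" if "a \<noteq> \<iota> k" for a
      using g_eq[OF k', of a] hg[of a] that unfolding \<iota>_def by metis
    then show ?thesis by (auto simp: scaled_axis_def vec_eq_iff axis_def c_def)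
  qed
  have "vector_rep r q \<tau> \<iota> c X"
  proof
    have "bij_betw (\<lambda>k. k - 1) {1..r+1} {..r}"
      by (rule bij_betwI[of _ _ _ Suc]) auto
    from bij_betw_trans[OF this h] show "bij_betw \<iota> {1..r+1} UNIV"
      unfolding \<iota>_def by (simp add: o_def)
    show "c k \<noteq> 0" if "k \<in> {1..r+1}" for k
    proof -
      have "k - 1 \<le> r" using that by auto
      then show ?thesis using g(2)[of "h (k - 1)"] gh[of "k - 1"] by (simp add: c_def \<iota>_def)
    qed
    fix j k assume j: "j \<in> {1..r}" and k: "k \<in> {1..r+1}"
    have k': "k - 1 \<le> r" "(j = Suc (k - 1)) = (j = k)" "(j = k - 1) = (Suc j = k)" using j k by auto
    show "Kmat X (\<tau> j) *v scaled_axis \<iota> c k = qpow q (of_bool (j = k) - of_bool (Suc j = k)) *s scaled_axis \<iota> c k"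
      using hw[OF k'(1)] tau_in[OF j] pairing[OF j k'(1)] unfolding b[OF k] k'(2,3) by (simp add: has_weight_def)
    show "Kinv X (\<tau> j) *v scaled_axis \<iota> c k = qpow q (of_bool (Suc j = k) - of_bool (j = k)) *s scaled_axis \<iota> c k"
      using Kinv_has_weight[OF hw[OF k'(1)] tau_in[OF j]] pairing[OF j k'(1)] unfolding b[OF k] k'(2,3) by simp
    show "Emat X (\<tau> j) *v scaled_axis \<iota> c k = (if k = Suc j then scaled_axis \<iota> c j else 0)"
      using E[OF j k'(1)] b[OF k] b[of j] j k'(3) by auto
    show "Fmat X (\<tau> j) *v scaled_axis \<iota> c k = (if k = j then scaled_axis \<iota> c (Suc j) else 0)"
      using F[OF j k'(1)] b[OF k] b[of "Suc j"] j k'(2) by auto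
  qed simp_all
  with \<tau>1 show ?thesis by blast
qed

end

section \<open>Naturality and Hecke relation in coordinates\<close>

lemma sum_UNIV_pair: "(\<Sum>w\<in>UNIV. f w) = (\<Sum>a\<in>UNIV. \<Sum>a'\<in>UNIV. f (a, a'))"
  for f :: "'a::finite \<times> 'c::finite \<Rightarrow> 'm::comm_monoid_add"
  by (simp add: sum.cartesian_product)

lemma sum_hecke_entry:
  fixes f :: "'n::finite \<Rightarrow> 'n \<Rightarrow> complex"
  shows "(\<Sum>x\<in>UNIV. \<Sum>y\<in>UNIV. f x y * hecke_entry \<kappa> z inverted x y a b) =
    (if a = b then \<kappa> * f a a
     else \<kappa> / z * f b a + (if inverted a b then (\<kappa> - \<kappa> / z / z) * f a b else 0))"
proof -
  have d: "(\<Sum>x\<in>UNIV. \<Sum>y\<in>UNIV. f x y * of_bool (x = c \<and> y = d)) = f c d" for c d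
  proof -
    have "(\<Sum>x\<in>UNIV. \<Sum>y\<in>UNIV. f x y * of_bool (x = c \<and> y = d)) =
       (\<Sum>x\<in>UNIV. if x = c then (\<Sum>y\<in>UNIV. if y = d then f c d else 0) else 0)"
      by (intro sum.cong) (auto simp: if_distrib[of "(*) _"] intro!: sum.cong cong: if_cong)
    then show ?thesis by simp
  qed
  have s: "(\<Sum>x\<in>UNIV. \<Sum>y\<in>UNIV. f x y * (u * of_bool (x = c \<and> y = d))) = u * f c d" for u c d
  proof -
    have "(\<Sum>x\<in>UNIV. \<Sum>y\<in>UNIV. f x y * (u * of_bool (x = c \<and> y = d))) =
       u * (\<Sum>x\<in>UNIV. \<Sum>y\<in>UNIV. f x y * of_bool (x = c \<and> y = d))"
      by (simp only: sum_distrib_left mult.left_commute)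
    then show ?thesis unfolding d .
  qed
  show ?thesis
    unfolding hecke_entry_def
    by (cases "a = b"; cases "inverted a b") (simp_all only: if_True if_False s distrib_left sum.distrib mult_zero_right sum.neutral_const refl if_cancel add_0_right)
qed

text \<open>The Hecke relation \<open>(Q - q\<^sup>w) (Q + q\<^bsup>w-2\<^esup>) = 0\<close>, with \<open>\<kappa> = q\<^sup>w\<close> and \<open>z = q\<close>, solved for the
  square.\<close>

lemma hecke_square:
  fixes Q :: "complex^('n::finite \<times> 'n)^('n \<times> 'n)"
  assumes Q: "\<And>x y a b. Q $ (x, y) $ (a, b) = hecke_entry \<kappa> z inverted x y a b"
    and total: "\<And>a b. a \<noteq> b \<Longrightarrow> inverted a b \<longleftrightarrow> \<not> inverted b a"
    and z: "z \<noteq> 0"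
  shows "Q ** Q = mat (\<kappa> - \<kappa> / z / z) ** Q + mat (\<kappa> * \<kappa> / (z * z))"
proof -
  have m: "(mat u ** A) $ x $ y = u * A $ x $ y" for u :: complex and A :: "complex^'m^'k::finite" and x y
    by (simp add: matrix_matrix_mult_def mat_def if_distrib[of "\<lambda>z. z * _"] cong: if_cong)
  have "(Q ** Q) $ (x, y) $ (a, b) = (mat (\<kappa> - \<kappa> / z / z) ** Q + mat (\<kappa> * \<kappa> / (z * z))) $ (x, y) $ (a, b)"
    for x y a b
  proof -
    have "(Q ** Q) $ (x, y) $ (a, b) = (\<Sum>c\<in>UNIV. \<Sum>d\<in>UNIV. Q $ (x, y) $ (c, d) * hecke_entry \<kappa> z inverted c d a b)"
      by (simp add: matrix_matrix_mult_def sum_UNIV_pair Q)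
    then show ?thesis
      unfolding sum_hecke_entry vector_add_component m using total[of a b] z
      by (auto simp: Q hecke_entry_def mat_def algebra_simps add_divide_distrib diff_divide_distrib)
  qed
  then show ?thesis by (simp add: vec_eq_iff)
qed

text \<open>From here on the quantum group is present only through the entries of the three braidings
  \<open>Q\<close> on \<open>V \<otimes> V\<close>, \<open>R\<close> on \<open>V \<otimes> V\<^sup>*\<close> and \<open>P\<close> on \<open>V\<^sup>* \<otimes> V\<^sup>*\<close>.\<close>

locale projective_braidings =
  fixes r :: nat and \<pi> :: "'n::finite \<Rightarrow> nat" and \<kappa> z :: complex
    and Q R P :: "complex^('n \<times> 'n)^('n \<times> 'n)"
  assumes \<pi>_bij: "bij_betw \<pi> UNIV {1..r+1}"
    and \<kappa>_nonzero [simp]: "\<kappa> \<noteq> 0" and z_nonzero [simp]: "z \<noteq> 0"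
    and Q_entry: "Q $ (x, y) $ (a, b) = hecke_entry \<kappa> z (\<lambda>a a'. \<pi> a' < \<pi> a) x y a b"
    and R_entry: "R $ (x, y) $ (a, b) = mixed_entry \<kappa> z \<pi> x y a b"
    and P_entry: "P $ (x, y) $ (a, b) = hecke_entry \<kappa> z (\<lambda>a a'. \<pi> a < \<pi> a') x y a b"
begin

text \<open>Here \<open>t = q\<^bsup>-2\<^esup>\<close>, the parameter \<open>\<eta> = q\<^sup>w - q\<^bsup>w-2\<^esup>\<close> is the coefficient of \<open>Q\<close> in the Hecke relation, and
  \<open>pivot i = q\<^bsup>(\<lambda>\<^sub>i, 2\<rho>)\<^esup> = q\<^bsup>r - 2 (\<pi> i - 1)\<^esup>\<close> is the weight in \<open>E'\<close>.\<close>

definition t where "t = inverse (z * z)"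
definition \<eta> where "\<eta> = \<kappa> - \<kappa> / z / z"
definition pivot where "pivot a = z ^ r * t ^ (\<pi> a - 1)"

lemma t_nonzero [simp]: "t \<noteq> 0" and pivot_nonzero [simp]: "pivot a \<noteq> 0"
  by (simp_all add: t_def pivot_def)

lemma R_entry_t: "R $ (x, y) $ (a, b) =
    (if a = b then of_bool (x = y) * mixed_coeff t (\<pi> a) (\<pi> x) / \<kappa> else z / \<kappa> * of_bool (x = b \<and> y = a))"
  by (simp only: R_entry mixed_entry_def t_def)

lemma \<eta>_eq: "\<eta> = \<kappa> * (1 - t)"
  by (simp add: \<eta>_def t_def field_simps)

lemma \<pi>_in: "\<pi> a \<in> {1..r+1}" and \<pi>_eq: "\<pi> a = \<pi> a' \<longleftrightarrow> a = a'"
  using \<pi>_bij by (auto simp: bij_betw_def inj_on_def)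

lemma sum_\<pi>: "(\<Sum>a\<in>UNIV. f (\<pi> a)) = (\<Sum>k=1..r+1. f k)"
  by (rule sum.reindex_bij_betw[OF \<pi>_bij])

lemma Q_square: "Q ** Q = mat \<eta> ** Q + mat (\<kappa> * \<kappa> / (z * z))"
  unfolding \<eta>_def by (rule hecke_square[OF Q_entry]) (auto simp: \<pi>_eq[symmetric])

lemma P_square: "P ** P = mat \<eta> ** P + mat (\<kappa> * \<kappa> / (z * z))"
  unfolding \<eta>_def by (rule hecke_square[OF P_entry]) (auto simp: \<pi>_eq[symmetric])

text \<open>The evaluation \<open>E\<close> after the braiding is an invariant functional on \<open>V \<otimes> V\<^sup>*\<close>, hence a multiple of \<open>E'\<close>;
  the multiple \<open>q\<^bsup>-w-m\<^esup>\<close> is the inverse twist on \<open>V\<close>. In coordinates it is a telescoping sum.\<close>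

lemma evaluation_R: "(\<Sum>j\<in>UNIV. R $ (j, j) $ (a, b)) = of_bool (a = b) * pivot a / (\<kappa> * z ^ r)"
proof (cases "a = b")
  case True
  obtain i where i: "\<pi> a = Suc i" "i \<le> r" using \<pi>_in[of a] by (cases "\<pi> a") auto
  have "(\<Sum>k=1..r+1. mixed_coeff t (Suc i) k) = (\<Sum>k=1..Suc i. mixed_coeff t (Suc i) k)"
    by (rule sum.mono_neutral_right) (use i in \<open>auto simp: mixed_coeff_def\<close>)
  then have "(\<Sum>j\<in>UNIV. mixed_coeff t (Suc i) (\<pi> j)) = t ^ i"
    unfolding sum_\<pi> sum_mixed_coeff_right .
  then have "(\<Sum>j\<in>UNIV. mixed_coeff t (Suc i) (\<pi> j) / \<kappa>) = t ^ i / \<kappa>"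
    by (simp add: sum_divide_distrib[symmetric])
  then show ?thesis
    using True i by (simp add: R_entry_t pivot_def)
next
  case False
  then have "R $ (j, j) $ (a, b) = 0" for j by (auto simp: R_entry_t)
  then show ?thesis using False by simp
qed

text \<open>The same for invariant vectors: the braiding sends \<open>C\<close> to \<open>q\<^bsup>-w-m\<^esup> C'\<close>.\<close>

lemma coevaluation_R: "(\<Sum>j\<in>UNIV. R $ (a, b) $ (j, j)) = of_bool (a = b) * inverse (pivot a) / (\<kappa> * z ^ r)"
proof -
  obtain i where i: "\<pi> a = Suc i" "i \<le> r" using \<pi>_in[of a] by (cases "\<pi> a") auto
  have tr: "inverse (z ^ r) * inverse (z ^ r) = t ^ r" by (simp add: t_def power_inverse power_mult_distrib)
  have tt: "inverse (t ^ i) * t ^ r = t ^ (r - i)" using i by (simp add: power_diff divide_inverse mult.commute)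
  have "(\<Sum>j\<in>UNIV. mixed_coeff t (\<pi> j) (\<pi> a)) = t ^ (r + 1 - \<pi> a)"
    unfolding sum_\<pi>[of "\<lambda>k. mixed_coeff t k (\<pi> a)"] using sum_mixed_coeff_left[of "\<pi> a" t "r+1"] \<pi>_in[of a] by simp
  moreover have "inverse (pivot a) / (\<kappa> * z ^ r) = t ^ (r + 1 - \<pi> a) / \<kappa>"
  proof -
    have "inverse (pivot a) / (\<kappa> * z ^ r) = inverse (t ^ i) * (inverse (z ^ r) * inverse (z ^ r)) / \<kappa>"
      using i by (simp add: pivot_def field_simps)
    then show ?thesis unfolding tr tt using i by simp
  qed
  moreover have "(\<Sum>j\<in>UNIV. R $ (a, b) $ (j, j)) = of_bool (a = b) * (\<Sum>j\<in>UNIV. mixed_coeff t (\<pi> j) (\<pi> a)) / \<kappa>"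
    by (simp add: R_entry_t sum_divide_distrib sum_distrib_left)
  ultimately show ?thesis by (simp only: times_divide_eq_right[symmetric])
qed

text \<open>Naturality of the braiding of \<open>V\<close> with \<open>V \<otimes> V\<^sup>*\<close> with respect to the invariant functional \<open>E'\<close>: moving
  the first factor past \<open>V \<otimes> V\<^sup>*\<close> and then contracting is the same as contracting at once.\<close>

lemma pivot_R_Q:
  "(\<Sum>x\<in>UNIV. \<Sum>y\<in>UNIV. (pivot x * R $ (x, m) $ (y, k)) * Q $ (x, y) $ (i, j)) =
     of_bool (j = k) * of_bool (i = m) * pivot j"
proof -
  have pv: "t ^ (\<pi> i - \<pi> j) * pivot j = pivot i" if "\<pi> j < \<pi> i"
  proof -
    have "\<pi> i - 1 = (\<pi> i - \<pi> j) + (\<pi> j - 1)" using that \<pi>_in[of j] by auto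
    then show ?thesis by (simp add: pivot_def power_add)
  qed
  have "inverse z * pivot j * ((t - 1) * t ^ (\<pi> i - \<pi> j - 1)) + (1 - t) * pivot i * z = 0" if "\<pi> j < \<pi> i"
  proof -
    obtain d where d: "\<pi> i - \<pi> j = Suc d" using \<open>\<pi> j < \<pi> i\<close> by (metis Suc_diff_Suc)
    have tz: "t * z = inverse z" by (simp add: t_def)
    have "inverse z * pivot j * ((t - 1) * t ^ (\<pi> i - \<pi> j - 1)) + (1 - t) * pivot i * z
       = (t - 1) * (t ^ d * pivot j) * inverse z + (1 - t) * (t ^ d * pivot j) * (t * z)"
      unfolding pv[OF that, symmetric] d by (simp add: mult_ac)
    then show ?thesis unfolding tz by (simp add: algebra_simps)
  qed
  then have cancel: "pivot j * ((t - 1) * t ^ (\<pi> i - \<pi> j - 1)) / z + (1 - t) * pivot i * z = 0" if "\<pi> j < \<pi> i"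
    using that by (simp add: divide_inverse mult_ac)
  show ?thesis
    unfolding Q_entry sum_hecke_entry \<eta>_def[symmetric]
  proof (cases "i = j")
    case True
    then show "(if i = j then \<kappa> * (pivot i * R $ (i, m) $ (i, k))
     else \<kappa> / z * (pivot j * R $ (j, m) $ (i, k)) +
       (if \<pi> j < \<pi> i then \<eta> * (pivot i * R $ (i, m) $ (j, k)) else 0)) =
     of_bool (j = k) * of_bool (i = m) * pivot j"
      by (auto simp: R_entry_t mixed_coeff_def)
  next
    case ij: False
    then have pij: "\<pi> i \<noteq> \<pi> j" by (simp add: \<pi>_eq)
    show "(if i = j then \<kappa> * (pivot i * R $ (i, m) $ (i, k))
     else \<kappa> / z * (pivot j * R $ (j, m) $ (i, k)) +
       (if \<pi> j < \<pi> i then \<eta> * (pivot i * R $ (i, m) $ (j, k)) else 0)) =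
     of_bool (j = k) * of_bool (i = m) * pivot j"
    proof (cases "k = i")
      case False
      then show ?thesis using ij pij by (auto simp: R_entry_t mixed_coeff_def)
    next
      case True
      show ?thesis
      proof (cases "\<pi> j < \<pi> i")
        case False
        then show ?thesis using True ij pij by (auto simp: R_entry_t mixed_coeff_def)
      next
        case lt: True
        have "\<kappa> / z * (pivot j * (of_bool (j = m) * mixed_coeff t (\<pi> i) (\<pi> j) / \<kappa>)) +
           \<eta> * (pivot i * (z / \<kappa> * of_bool (m = j))) =
           of_bool (m = j) * (pivot j * ((t - 1) * t ^ (\<pi> i - \<pi> j - 1)) / z + (1 - t) * pivot i * z)"
          using lt by (auto simp: mixed_coeff_def \<eta>_eq)
        then show ?thesis
          unfolding cancel[OF lt] using True ij lt
          by (simp add: R_entry_t)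
      qed
    qed
  qed
qed

text \<open>The diagonal part of the inverse of \<open>R\<close>, in the form of a linear combination of columns of \<open>R\<close>: its
  telescoping sums cancel all coefficients but one.\<close>

lemma R_diagonal_inverse:
  "\<kappa> * R $ (j, k) $ (m, m) + \<eta> * (\<Sum>i\<in>UNIV. if \<pi> i < \<pi> m then R $ (j, k) $ (i, i) else 0) =
     of_bool (j = m \<and> k = m)"
proof (cases "j = k")
  case False
  then show ?thesis by (auto simp: R_entry_t intro!: sum.neutral)
next
  case True
  obtain n where n: "\<pi> m = Suc n" "n \<le> r" using \<pi>_in[of m] by (cases "\<pi> m") auto
  have "(\<Sum>i\<in>UNIV. if \<pi> i < \<pi> m then R $ (j, k) $ (i, i) else 0) =
      (\<Sum>i\<in>UNIV. if \<pi> i < Suc n then mixed_coeff t (\<pi> i) (\<pi> j) / \<kappa> else 0)"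
    using True n by (intro sum.cong) (auto simp: R_entry_t)
  also have "\<dots> = (\<Sum>i=1..r+1. if i < Suc n then mixed_coeff t i (\<pi> j) / \<kappa> else 0)"
    by (rule sum_\<pi>[of "\<lambda>i. if i < Suc n then mixed_coeff t i (\<pi> j) / \<kappa> else 0"])
  also have "\<dots> = (\<Sum>i=1..n. mixed_coeff t i (\<pi> j) / \<kappa>)"
    using n by (intro sum.mono_neutral_cong_right) auto
  also have "\<dots> = (if \<pi> j \<le> n then t ^ (n - \<pi> j) else 0) / \<kappa>"
    unfolding sum_divide_distrib[symmetric] using sum_mixed_coeff_left[of "\<pi> j" t n] \<pi>_in[of j] by simp
  finally have s: "(\<Sum>i\<in>UNIV. if \<pi> i < \<pi> m then R $ (j, k) $ (i, i) else 0) =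
      (if \<pi> j \<le> n then t ^ (n - \<pi> j) else 0) / \<kappa>" .
  have \<kappa>: "\<kappa> * (1 - t) * (w / \<kappa>) = (1 - t) * w" for w by simp
  have "\<kappa> * R $ (j, k) $ (m, m) = mixed_coeff t (Suc n) (\<pi> j)"
    using True n by (simp add: R_entry_t)
  moreover have "j = m \<longleftrightarrow> \<pi> j = Suc n" using \<pi>_eq n by metis
  ultimately show ?thesis
    unfolding s \<eta>_eq \<kappa> using True by (auto simp: mixed_coeff_def algebra_simps)
qed

lemma R_off_diagonal_inverse: "l \<noteq> m \<Longrightarrow> \<kappa> / z * R $ (j, k) $ (l, m) = of_bool (j = m \<and> k = l)"
  by (simp add: R_entry_t)

lemma R_right_inverse: "\<exists>R'. R ** R' = mat 1"
proof -
  \<comment> \<open>The columns of the inverse are the combinations found above, on and off the diagonal.\<close>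
  define R' :: "complex^('n \<times> 'n)^('n \<times> 'n)" where
    "R' = (\<chi> u v. case (u, v) of ((a, b), (x, y)) \<Rightarrow>
       if x = y then (if a = b then (if a = x then \<kappa> else if \<pi> a < \<pi> x then \<eta> else 0) else 0)
       else \<kappa> / z * of_bool (a = y \<and> b = x))"
  have "(R ** R') $ (j, k) $ (x, y) = (mat 1 :: complex^('n \<times> 'n)^('n \<times> 'n)) $ (j, k) $ (x, y)" for j k x y
  proof (cases "x = y")
    case True
    have "(R ** R') $ (j, k) $ (x, y) = (\<Sum>a\<in>UNIV. \<Sum>b\<in>UNIV. if b = a then
        R $ (j, k) $ (a, a) * (if a = x then \<kappa> else if \<pi> a < \<pi> x then \<eta> else 0) else 0)"
      unfolding matrix_matrix_mult_def R'_def using True by (auto simp: sum_UNIV_pair if_distrib[of "(*) _"] intro!: sum.cong cong: if_cong)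
    also have "\<dots> = (\<Sum>a\<in>UNIV. (if a = x then \<kappa> * R $ (j, k) $ (x, x) else 0) +
        \<eta> * (if \<pi> a < \<pi> x then R $ (j, k) $ (a, a) else 0))"
      by (auto intro!: sum.cong)
    also have "\<dots> = of_bool (j = x \<and> k = x)"
      by (simp add: sum.distrib sum_distrib_left[symmetric] R_diagonal_inverse)
    finally show ?thesis using True by (auto simp: mat_def)
  next
    case False
    have "R' $ (a, b) $ (x, y) = (if a = y then if b = x then \<kappa> / z else 0 else 0)" for a b
      using False by (simp add: R'_def)
    then have "(R ** R') $ (j, k) $ (x, y) = (\<Sum>a\<in>UNIV. \<Sum>b\<in>UNIV. R $ (j, k) $ (a, b) *
        (if a = y then if b = x then \<kappa> / z else 0 else 0))"
      by (simp add: matrix_matrix_mult_def sum_UNIV_pair)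
    also have "\<dots> = (\<Sum>a\<in>UNIV. if a = y then (\<Sum>b\<in>UNIV. if b = x then \<kappa> / z * R $ (j, k) $ (y, x) else 0) else 0)"
      by (intro sum.cong) (auto simp: if_distrib[of "(*) _"] intro!: sum.cong cong: if_cong)
    also have "\<dots> = of_bool (j = x \<and> k = y)"
      using R_off_diagonal_inverse[of y x j k] False by simp
    finally show ?thesis by (auto simp: mat_def)
  qed
  then have "R ** R' = mat 1" by (simp add: vec_eq_iff)
  then show ?thesis by blast
qed

lemma P_entry_\<eta>: "P $ (x, y) $ (a, b) =
     (if a = b then \<kappa> * of_bool (x = a \<and> y = b)
      else \<kappa> / z * of_bool (x = b \<and> y = a) + (if \<pi> a < \<pi> b then \<eta> * of_bool (x = a \<and> y = b) else 0))"
  by (simp only: P_entry hecke_entry_def \<eta>_def)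

text \<open>Naturality of the braiding of \<open>V \<otimes> V\<^sup>*\<close> with \<open>V\<^sup>*\<close> with respect to \<open>C\<close>: moving \<open>C\<close> past a factor
  \<open>V\<^sup>*\<close> yields \<open>C\<close> on the other side.\<close>

lemma coevaluation_R_P:
  "(\<Sum>i\<in>UNIV. \<Sum>y\<in>UNIV. R $ (j, k) $ (i, y) * P $ (y, l) $ (i, m)) = of_bool (j = m \<and> k = l)"
proof -
  have "(\<Sum>y\<in>UNIV. R $ (j, k) $ (i, y) * P $ (y, l) $ (i, m)) =
     (if i = m then of_bool (l = m) * (\<kappa> * R $ (j, k) $ (m, m)) else 0)
     + (if i = l then of_bool (l \<noteq> m) * (\<kappa> / z * R $ (j, k) $ (l, m)) else 0)
     + of_bool (l = m) * (\<eta> * (if \<pi> i < \<pi> m then R $ (j, k) $ (i, i) else 0))" for i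
  proof -
    have "(\<Sum>y\<in>UNIV. R $ (j, k) $ (i, y) * P $ (y, l) $ (i, m)) =
      (\<Sum>y\<in>UNIV. (if y = m then (if i = m then \<kappa> * of_bool (l = m) else \<kappa> / z * of_bool (l = i)) * R $ (j, k) $ (i, m) else 0)
        + (if y = i then of_bool (l = m) * (\<eta> * (if \<pi> i < \<pi> m then R $ (j, k) $ (i, i) else 0)) else 0))"
      by (intro sum.cong) (auto simp: P_entry_\<eta>)
    then show ?thesis by (auto simp: sum.distrib)
  qed
  then have "(\<Sum>i\<in>UNIV. \<Sum>y\<in>UNIV. R $ (j, k) $ (i, y) * P $ (y, l) $ (i, m)) =
     of_bool (l = m) * (\<kappa> * R $ (j, k) $ (m, m)) + of_bool (l \<noteq> m) * (\<kappa> / z * R $ (j, k) $ (l, m))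
     + of_bool (l = m) * (\<eta> * (\<Sum>i\<in>UNIV. if \<pi> i < \<pi> m then R $ (j, k) $ (i, i) else 0))"
    by (simp add: sum.distrib sum_distrib_left[symmetric])
  then show ?thesis
    using R_diagonal_inverse[of j k m] R_off_diagonal_inverse[of l m j k] by (cases "l = m") auto
qed

end

section \<open>Operators on the legs of a family\<close>

lemma scaleC_zero_left [simp]: "0 *\<^sub>C (x::'m::cvector) = 0"
  using scaleC_add_left[of 0 0 x] by simp

lemma scaleC_minus_right: "u *\<^sub>C (- x) = - (u *\<^sub>C (x::'m::cvector))"
  using scaleC_add_right[of u x "- x"] by (simp add: eq_neg_iff_add_eq_0 add.commute)

lemma scaleC_minus_left: "(- u) *\<^sub>C x = - (u *\<^sub>C (x::'m::cvector))"
  using scaleC_add_left[of u "- u" x] by (simp add: eq_neg_iff_add_eq_0 add.commute)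

lemma scaleC_diff_right: "u *\<^sub>C (x - y) = u *\<^sub>C x - u *\<^sub>C (y::'m::cvector)"
  using scaleC_add_right[of u x "- y"] by (simp add: scaleC_minus_right)

lemma scaleC_diff_left: "(u - v) *\<^sub>C x = u *\<^sub>C x - v *\<^sub>C (x::'m::cvector)"
  using scaleC_add_left[of u "- v" x] by (simp add: scaleC_minus_left)

lemma scaleC_sum_right: "u *\<^sub>C sum f A = (\<Sum>a\<in>A. u *\<^sub>C (f a :: 'm::cvector))"
  by (induction A rule: infinite_finite_induct) (simp_all add: scaleC_add_right)

lemma scaleC_sum_left: "sum f A *\<^sub>C x = (\<Sum>a\<in>A. f a *\<^sub>C (x :: 'm::cvector))"
  by (induction A rule: infinite_finite_induct) (simp_all add: scaleC_add_left)

text \<open>The four-leg operators \<open>at123\<close>, \<open>at234\<close> and their two-leg analogues are all instances of a matrix acting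
  on a family indexed by the chosen legs.\<close>

definition mat_act :: "complex^'v^'u \<Rightarrow> ('v::finite \<Rightarrow> 'm::cvector) \<Rightarrow> 'u \<Rightarrow> 'm" where
  "mat_act A f = (\<lambda>u. \<Sum>v\<in>UNIV. A $ u $ v *\<^sub>C f v)"

lemma mat_act_mult: "mat_act (A ** B) f = mat_act A (mat_act B f)"
proof
  fix u
  have "mat_act (A ** B) f u = (\<Sum>w\<in>UNIV. \<Sum>v\<in>UNIV. A $ u $ v *\<^sub>C B $ v $ w *\<^sub>C f w)"
    by (simp add: mat_act_def matrix_matrix_mult_def scaleC_sum_left scaleC_scaleC)
  also have "\<dots> = (\<Sum>v\<in>UNIV. \<Sum>w\<in>UNIV. A $ u $ v *\<^sub>C B $ v $ w *\<^sub>C f w)"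
    by (rule sum.swap)
  finally show "mat_act (A ** B) f u = mat_act A (mat_act B f) u"
    by (simp add: mat_act_def scaleC_sum_right)
qed

lemma mat_act_add: "mat_act (A + B) f = (\<lambda>u. mat_act A f u + mat_act B f u)"
  by (simp add: mat_act_def scaleC_add_left sum.distrib fun_eq_iff)

lemma mat_act_mat: "mat_act (mat c) f = (\<lambda>u. c *\<^sub>C f u)"
proof
  fix u
  have "mat_act (mat c) f u = (\<Sum>v\<in>UNIV. if u = v then c *\<^sub>C f v else 0)"
    unfolding mat_act_def by (intro sum.cong) (auto simp: mat_def)
  then show "mat_act (mat c) f u = c *\<^sub>C f u" by simp
qed

definition at12 :: "complex^('n \<times> 'n)^('n::finite \<times> 'n) \<Rightarrow> ('n, 'm::cvector) fam4 \<Rightarrow> ('n, 'm) fam4" where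
  "at12 A x = (\<lambda>i j k l. mat_act A (\<lambda>(i, j). x i j k l) (i, j))"
definition at23 :: "complex^('n \<times> 'n)^('n::finite \<times> 'n) \<Rightarrow> ('n, 'm::cvector) fam4 \<Rightarrow> ('n, 'm) fam4" where
  "at23 A x = (\<lambda>i j k l. mat_act A (\<lambda>(j, k). x i j k l) (j, k))"
definition at34 :: "complex^('n \<times> 'n)^('n::finite \<times> 'n) \<Rightarrow> ('n, 'm::cvector) fam4 \<Rightarrow> ('n, 'm) fam4" where
  "at34 A x = (\<lambda>i j k l. mat_act A (\<lambda>(k, l). x i j k l) (k, l))"

lemma at123_eq: "at123 A x = (\<lambda>i j k l. mat_act A (\<lambda>(i, j, k). x i j k l) (i, j, k))"
  by (simp add: at123_def mat_act_def split_def)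

lemma at234_eq: "at234 A x = (\<lambda>i j k l. mat_act A (\<lambda>(j, k, l). x i j k l) (j, k, l))"
  by (simp add: at234_def mat_act_def split_def)

lemma triple_eta: "(\<lambda>(a, b, c). f (a, b, c)) = f" and pair_eta: "(\<lambda>(a, b). g (a, b)) = g"
  by (simp_all add: fun_eq_iff)

lemma at_mult:
  "at123 (A ** B) x = at123 A (at123 B x)" "at234 (A ** B) x = at234 A (at234 B x)"
  "at12 (C ** D) x = at12 C (at12 D x)" "at23 (C ** D) x = at23 C (at23 D x)"
  "at34 (C ** D) x = at34 C (at34 D x)"
  by (simp_all add: at123_eq at234_eq at12_def at23_def at34_def mat_act_mult pair_eta triple_eta)

lemma at_mat:
  "at123 (mat c) x = c *\<^sub>C x" "at234 (mat c) x = c *\<^sub>C x"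
  "at12 (mat c) x = c *\<^sub>C x" "at23 (mat c) x = c *\<^sub>C x" "at34 (mat c) x = c *\<^sub>C x"
  by (simp_all add: at123_eq at234_eq at12_def at23_def at34_def mat_act_mat scaleC_fun_def)

lemma at12_add: "at12 (A + B) x = at12 A x + at12 B x"
  by (simp add: at12_def mat_act_add fun_eq_iff)

lemma at_diff:
  "at123 A (x - y) = at123 A x - at123 A y" "at234 A (x - y) = at234 A x - at234 A y"
  by (simp_all add: at123_eq at234_eq mat_act_def split_def scaleC_diff_right sum_subtractf fun_eq_iff)

lemma at_scaleC:
  "at123 A (u *\<^sub>C x) = u *\<^sub>C at123 A x" "at234 A (u *\<^sub>C x) = u *\<^sub>C at234 A x"
  "at23 B (u *\<^sub>C x) = u *\<^sub>C at23 B x"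
  by (simp_all add: at123_eq at234_eq at23_def mat_act_def split_def scaleC_fun_def scaleC_scaleC
      scaleC_sum_right mult.commute fun_eq_iff)

lemma at123_leg12: "at123 (leg12 A) x = at12 A x"
proof (intro ext)
  fix i j k l
  have "at123 (leg12 A) x i j k l = (\<Sum>a\<in>UNIV. \<Sum>b\<in>UNIV. \<Sum>c\<in>UNIV. if c = k then A $ (i, j) $ (a, b) *\<^sub>C x a b c l else 0)"
    unfolding at123_eq mat_act_def sum_UNIV_pair by (intro sum.cong) (auto simp: leg12_def)
  then show "at123 (leg12 A) x i j k l = at12 A x i j k l"
    by (simp add: at12_def mat_act_def sum_UNIV_pair)
qed

lemma at123_leg23: "at123 (leg23 A) x = at23 A x"
proof (intro ext)
  fix i j k l
  have "at123 (leg23 A) x i j k l = (\<Sum>a\<in>UNIV. if a = i then (\<Sum>b\<in>UNIV. \<Sum>c\<in>UNIV. A $ (j, k) $ (b, c) *\<^sub>C x a b c l) else 0)"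
    unfolding at123_eq mat_act_def sum_UNIV_pair by (intro sum.cong) (auto simp: leg23_def)
  then show "at123 (leg23 A) x i j k l = at23 A x i j k l"
    by (simp add: at23_def mat_act_def sum_UNIV_pair)
qed

lemma at234_leg12: "at234 (leg12 A) x = at23 A x"
proof (intro ext)
  fix i j k l
  have "at234 (leg12 A) x i j k l = (\<Sum>a\<in>UNIV. \<Sum>b\<in>UNIV. \<Sum>c\<in>UNIV. if c = l then A $ (j, k) $ (a, b) *\<^sub>C x i a b c else 0)"
    unfolding at234_eq mat_act_def sum_UNIV_pair by (intro sum.cong) (auto simp: leg12_def)
  then show "at234 (leg12 A) x i j k l = at23 A x i j k l"
    by (simp add: at23_def mat_act_def sum_UNIV_pair)
qed

lemma at234_leg23: "at234 (leg23 A) x = at34 A x"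
proof (intro ext)
  fix i j k l
  have "at234 (leg23 A) x i j k l = (\<Sum>a\<in>UNIV. if a = j then (\<Sum>b\<in>UNIV. \<Sum>c\<in>UNIV. A $ (k, l) $ (b, c) *\<^sub>C x i a b c) else 0)"
    unfolding at234_eq mat_act_def sum_UNIV_pair by (intro sum.cong) (auto simp: leg23_def)
  then show "at234 (leg23 A) x i j k l = at34 A x i j k l"
    by (simp add: at34_def mat_act_def sum_UNIV_pair)
qed

lemma at12_at34_commute: "at12 A (at34 B x) = at34 B (at12 A x)"
proof (intro ext)
  fix i j k l
  have "at12 A (at34 B x) i j k l = (\<Sum>u\<in>UNIV. \<Sum>v\<in>UNIV. A $ (i, j) $ u *\<^sub>C B $ (k, l) $ v *\<^sub>C x (fst u) (snd u) (fst v) (snd v))"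
    by (simp add: at12_def at34_def mat_act_def split_def scaleC_sum_right)
  also have "\<dots> = (\<Sum>v\<in>UNIV. \<Sum>u\<in>UNIV. B $ (k, l) $ v *\<^sub>C A $ (i, j) $ u *\<^sub>C x (fst u) (snd u) (fst v) (snd v))"
    by (subst sum.swap) (simp add: scaleC_scaleC mult.commute)
  also have "\<dots> = at34 B (at12 A x) i j k l"
    by (simp add: at12_def at34_def mat_act_def split_def scaleC_sum_right)
  finally show "at12 A (at34 B x) i j k l = at34 B (at12 A x) i j k l" .
qed

lemma sum_of_bool_last:
  fixes u v :: "'a::finite \<Rightarrow> complex"
  shows "(\<Sum>x\<in>UNIV. u x * of_bool (a = x) * (v x * of_bool (x = b))) = u a * v a * of_bool (a = b)"
proof -
  have "(\<Sum>x\<in>UNIV. u x * of_bool (a = x) * (v x * of_bool (x = b))) = (\<Sum>x\<in>UNIV. if x = a then u a * v a * of_bool (a = b) else 0)"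
    by (intro sum.cong) auto
  then show ?thesis by simp
qed

lemma sum_of_bool_first:
  fixes u v :: "'a::finite \<Rightarrow> 'a \<Rightarrow> 'a \<Rightarrow> complex"
  shows "(\<Sum>x\<in>UNIV. \<Sum>y\<in>UNIV. \<Sum>w\<in>UNIV. of_bool (a = x) * u x y w * (of_bool (x = b) * v x y w)) =
     of_bool (a = b) * (\<Sum>y\<in>UNIV. \<Sum>w\<in>UNIV. u a y w * v a y w)"
proof -
  have "(\<Sum>x\<in>UNIV. \<Sum>y\<in>UNIV. \<Sum>w\<in>UNIV. of_bool (a = x) * u x y w * (of_bool (x = b) * v x y w)) =
     (\<Sum>x\<in>UNIV. if x = a then of_bool (a = b) * (\<Sum>y\<in>UNIV. \<Sum>w\<in>UNIV. u a y w * v a y w) else 0)"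
    by (intro sum.cong) auto
  then show ?thesis by simp
qed

lemma leg12_mult: "leg12 A ** leg12 B = leg12 (A ** B)"
proof -
  have "(leg12 A ** leg12 B) $ (i, j, k) $ (a, b, c) = leg12 (A ** B) $ (i, j, k) $ (a, b, c)" for i j k a b c
    by (simp only: matrix_matrix_mult_def vec_lambda_beta sum_UNIV_pair leg12_def prod.case sum_of_bool_last
        sum_distrib_right)
  then show ?thesis by (simp add: vec_eq_iff)
qed

lemma leg23_mult: "leg23 A ** leg23 B = leg23 (A ** B)"
proof -
  have "(leg23 A ** leg23 B) $ (i, j, k) $ (a, b, c) = leg23 (A ** B) $ (i, j, k) $ (a, b, c)" for i j k a b c
    by (simp only: matrix_matrix_mult_def vec_lambda_beta sum_UNIV_pair leg23_def prod.case sum_of_bool_first)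
  then show ?thesis by (simp add: vec_eq_iff)
qed

lemmas leg_mult = leg12_mult leg23_mult

lemma leg_one: "leg12 (mat 1) = mat 1" "leg23 (mat 1) = mat 1"
  by (auto simp: vec_eq_iff leg12_def leg23_def mat_def)

lemma invertible_leg: "invertible A \<Longrightarrow> invertible (leg12 A)" "invertible A \<Longrightarrow> invertible (leg23 A)"
  unfolding invertible_def by (metis leg_mult leg_one)+

lemma inverse_cancel_matrix:
  assumes "invertible (A :: complex^'n::finite^'n)"
  shows "A ** matrix_inv A = mat 1" "matrix_inv A ** A = mat 1"
  using assms unfolding invertible_def matrix_inv_def by (metis (mono_tags, lifting) someI_ex)+

lemma invertible_matrix_inv: "invertible A \<Longrightarrow> invertible (matrix_inv A)" for A :: "complex^'n::finite^'n"
  using inverse_cancel_matrix[of A] unfolding invertible_def by blast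

section \<open>Contractions, insertions and braidings\<close>

text \<open>Contractions and insertions with arbitrary weights; \<open>E'\<close> and \<open>C'\<close> correspond to the pivotal weights and
  their inverses.\<close>

definition contract12 :: "('n::finite \<Rightarrow> complex) \<Rightarrow> ('n, 'm::cvector) fam4 \<Rightarrow> ('n, 'm) fam2" where
  "contract12 \<theta> x = (\<lambda>k l. \<Sum>i\<in>UNIV. \<theta> i *\<^sub>C x i i k l)"
definition contract23 :: "('n::finite \<Rightarrow> complex) \<Rightarrow> ('n, 'm::cvector) fam4 \<Rightarrow> ('n, 'm) fam2" where
  "contract23 \<theta> x = (\<lambda>i l. \<Sum>j\<in>UNIV. \<theta> j *\<^sub>C x i j j l)"
definition insert23 :: "('n \<Rightarrow> complex) \<Rightarrow> ('n, 'm::cvector) fam2 \<Rightarrow> ('n, 'm) fam4" where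
  "insert23 \<theta> x = (\<lambda>i j k l. if j = k then \<theta> j *\<^sub>C x i l else 0)"

lemma E23_diff: "E23 (x - y) = E23 x - E23 y"
  and E23_scaleC: "E23 (u *\<^sub>C x) = u *\<^sub>C E23 x"
  by (simp_all add: E23_def sum.distrib sum_subtractf scaleC_sum_right scaleC_fun_def fun_eq_iff)

lemma E'12_add: "E'12 D (x + y) = E'12 D x + E'12 D y" and E'12_diff: "E'12 D (x - y) = E'12 D x - E'12 D y"
  and E'12_scaleC: "E'12 D (u *\<^sub>C x) = u *\<^sub>C E'12 D x"
  by (simp_all add: E'12_def sum.distrib sum_subtractf scaleC_sum_right scaleC_fun_def scaleC_add_right
      scaleC_diff_right scaleC_scaleC mult.commute)

lemma contract23_add: "contract23 \<theta> (x + y) = contract23 \<theta> x + contract23 \<theta> y"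
  and contract23_scaleC: "contract23 \<theta> (u *\<^sub>C x) = u *\<^sub>C contract23 \<theta> x"
  by (simp_all add: contract23_def sum.distrib scaleC_add_right scaleC_sum_right scaleC_fun_def scaleC_scaleC mult.commute fun_eq_iff)

context projective_braidings begin

text \<open>The inverse twist \<open>q\<^bsup>-w-m\<^esup>\<close>.\<close>

definition \<epsilon> where "\<epsilon> = inverse (\<kappa> * z ^ r)"

lemma \<epsilon>_nonzero [simp]: "\<epsilon> \<noteq> 0" by (simp add: \<epsilon>_def)

lemma hecke_inverse:
  fixes A :: "complex^('n \<times> 'n)^('n \<times> 'n)"
  assumes "A ** A = mat \<eta> ** A + mat (\<kappa> * \<kappa> / (z * z))" 
  shows "invertible A" "A = mat (\<kappa> * \<kappa> / (z * z)) ** matrix_inv A + mat \<eta>"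
proof -
  define u where "u = \<kappa> * \<kappa> / (z * z)"
  have u: "u \<noteq> 0" by (simp add: u_def)
  have comm: "mat v ** B = B ** mat v" for v and B :: "complex^('n \<times> 'n)^('n \<times> 'n)"
    by (simp add: vec_eq_iff matrix_matrix_mult_def mat_def if_distrib[of "\<lambda>x. x * _"] if_distrib[of "(*) _"] mult.commute cong: if_cong)
  have mm: "mat v ** mat w = (mat (v * w) :: complex^('n \<times> 'n)^('n \<times> 'n))" for v w
    by (simp add: vec_eq_iff matrix_matrix_mult_def mat_def if_distrib[of "\<lambda>x. x * _"] if_distrib[of "(*) _"] cong: if_cong)
  \<comment> \<open>The relation \<open>A (A - \<eta>) = u\<close> with \<open>u \<noteq> 0\<close> exhibits the inverse of \<open>A\<close>.\<close>
  have 1: "A ** (A - mat \<eta>) = mat u"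
  proof -
    have "A ** (A - mat \<eta>) = A ** A - A ** mat \<eta>"
      by (simp add: vec_eq_iff matrix_matrix_mult_def right_diff_distrib sum_subtractf)
    then show ?thesis using assms by (simp add: comm[of \<eta> A] u_def)
  qed
  have "A ** (mat (inverse u) ** (A - mat \<eta>)) = mat (inverse u) ** (A ** (A - mat \<eta>))"
    by (simp only: matrix_mul_assoc comm[of _ A])
  also have "\<dots> = mat 1" unfolding 1 mm using u by simp
  finally have r: "A ** (mat (inverse u) ** (A - mat \<eta>)) = mat 1" .
  then show inv: "invertible A"
    using matrix_left_right_inverse unfolding invertible_def by blast
  have "matrix_inv A = matrix_inv A ** (A ** (mat (inverse u) ** (A - mat \<eta>)))" unfolding r by simp
  also have "\<dots> = mat (inverse u) ** (A - mat \<eta>)"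
    unfolding matrix_mul_assoc inverse_cancel_matrix(2)[OF inv] by simp
  finally have "mat u ** matrix_inv A = mat (u * inverse u) ** (A - mat \<eta>)"
    by (simp add: matrix_mul_assoc mm)
  then show "A = mat (\<kappa> * \<kappa> / (z * z)) ** matrix_inv A + mat \<eta>"
    using u by (simp add: u_def[symmetric])
qed

lemmas Q_invertible = hecke_inverse(1)[OF Q_square]
lemmas P_invertible = hecke_inverse(1)[OF P_square]
lemmas Q_hecke = hecke_inverse(2)[OF Q_square]

lemma R_invertible: "invertible R"
  using R_right_inverse matrix_left_right_inverse unfolding invertible_def by blast

lemma at23_R_inv: "at23 R (at23 (matrix_inv R) x) = x" "at23 (matrix_inv R) (at23 R x) = x"
  and at12_Q_inv: "at12 Q (at12 (matrix_inv Q) x) = x" "at12 (matrix_inv Q) (at12 Q x) = x"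
  and at34_P_inv: "at34 P (at34 (matrix_inv P) x) = x" "at34 (matrix_inv P) (at34 P x) = x"
  by (simp_all add: at_mult[symmetric] inverse_cancel_matrix R_invertible Q_invertible P_invertible
      at_mat scaleC_fun_def scaleC_one)

lemma E23_R: "E23 (at23 R x) = \<epsilon> *\<^sub>C contract23 pivot x"
proof (intro ext)
  fix i l
  have "E23 (at23 R x) i l = (\<Sum>a\<in>UNIV. \<Sum>b\<in>UNIV. (\<Sum>j\<in>UNIV. R $ (j, j) $ (a, b)) *\<^sub>C x i a b l)"
  proof -
    have "E23 (at23 R x) i l = (\<Sum>j\<in>UNIV. \<Sum>w\<in>UNIV. R $ (j, j) $ w *\<^sub>C x i (fst w) (snd w) l)"
      by (simp add: E23_def at23_def mat_act_def split_def)
    also have "\<dots> = (\<Sum>w\<in>UNIV. \<Sum>j\<in>UNIV. R $ (j, j) $ w *\<^sub>C x i (fst w) (snd w) l)"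
      by (rule sum.swap)
    finally show ?thesis by (simp add: sum_UNIV_pair scaleC_sum_left)
  qed
  also have "\<dots> = (\<Sum>a\<in>UNIV. \<Sum>b\<in>UNIV. if b = a then (\<epsilon> * pivot a) *\<^sub>C x i a a l else 0)"
    unfolding evaluation_R by (intro sum.cong) (auto simp: \<epsilon>_def divide_inverse mult.commute)
  finally show "E23 (at23 R x) i l = (\<epsilon> *\<^sub>C contract23 pivot x) i l"
    by (simp add: contract23_def scaleC_fun_def scaleC_sum_right scaleC_scaleC)
qed

lemma R_insert23: "at23 R (insert23 (\<lambda>_. 1) x) = \<epsilon> *\<^sub>C insert23 (\<lambda>a. inverse (pivot a)) x"
proof (intro ext)
  fix i j k l
  have "at23 R (insert23 (\<lambda>_. 1) x) i j k l = (\<Sum>a\<in>UNIV. \<Sum>b\<in>UNIV. if b = a then R $ (j, k) $ (a, a) *\<^sub>C x i l else 0)"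
    unfolding at23_def mat_act_def insert23_def sum_UNIV_pair by (intro sum.cong) (auto simp: scaleC_one)
  also have "\<dots> = (\<Sum>a\<in>UNIV. R $ (j, k) $ (a, a)) *\<^sub>C x i l"
    by (simp add: scaleC_sum_left)
  finally show "at23 R (insert23 (\<lambda>_. 1) x) i j k l = (\<epsilon> *\<^sub>C insert23 (\<lambda>a. inverse (pivot a)) x) i j k l"
    unfolding coevaluation_R
    by (simp add: insert23_def scaleC_fun_def scaleC_scaleC \<epsilon>_def divide_inverse mult.commute)
qed

lemma R_P_insert23: "at23 R (at34 P (insert23 (\<lambda>_. 1) x)) = C3 x"
proof (intro ext)
  fix i j k l
  have P: "at34 P (insert23 (\<lambda>_. 1) x) i a y l = (\<Sum>m\<in>UNIV. P $ (y, l) $ (a, m) *\<^sub>C x i m)" for a y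
  proof -
    have "at34 P (insert23 (\<lambda>_. 1) x) i a y l = (\<Sum>b\<in>UNIV. if b = a then (\<Sum>m\<in>UNIV. P $ (y, l) $ (a, m) *\<^sub>C x i m) else 0)"
      unfolding at34_def mat_act_def insert23_def sum_UNIV_pair by (intro sum.cong) (auto simp: scaleC_one)
    then show ?thesis by simp
  qed
  have "at23 R (at34 P (insert23 (\<lambda>_. 1) x)) i j k l =
     (\<Sum>w\<in>UNIV. \<Sum>m\<in>UNIV. (R $ (j, k) $ w * P $ (snd w, l) $ (fst w, m)) *\<^sub>C x i m)"
    unfolding at23_def mat_act_def P[abs_def] split_def by (simp add: P scaleC_sum_right scaleC_scaleC)
  also have "\<dots> = (\<Sum>m\<in>UNIV. \<Sum>w\<in>UNIV. (R $ (j, k) $ w * P $ (snd w, l) $ (fst w, m)) *\<^sub>C x i m)"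
    by (rule sum.swap)
  also have "\<dots> = (\<Sum>m\<in>UNIV. of_bool (j = m \<and> k = l) *\<^sub>C x i m)"
    unfolding coevaluation_R_P[symmetric] by (simp add: sum_UNIV_pair scaleC_sum_left)
  also have "\<dots> = (\<Sum>m\<in>UNIV. if m = j then of_bool (k = l) *\<^sub>C x i j else 0)"
    by (intro sum.cong) auto
  finally show "at23 R (at34 P (insert23 (\<lambda>_. 1) x)) i j k l = C3 x i j k l"
    by (simp add: C3_def scaleC_one)
qed

lemma contract12_R_Q: "contract12 pivot (at23 R (at12 Q x)) = contract23 pivot x"
proof (intro ext)
  fix m l
  have "contract12 pivot (at23 R (at12 Q x)) m l =
     (\<Sum>a\<in>UNIV. \<Sum>w\<in>UNIV. \<Sum>u\<in>UNIV. (pivot a * R $ (a, m) $ w * Q $ (a, fst w) $ u) *\<^sub>C x (fst u) (snd u) (snd w) l)"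
    by (simp add: contract12_def at23_def at12_def mat_act_def split_def scaleC_sum_right scaleC_scaleC mult.assoc)
  also have "\<dots> = (\<Sum>a\<in>UNIV. \<Sum>u\<in>UNIV. \<Sum>w\<in>UNIV. (pivot a * R $ (a, m) $ w * Q $ (a, fst w) $ u) *\<^sub>C x (fst u) (snd u) (snd w) l)"
    by (rule sum.cong[OF refl], rule sum.swap)
  also have "\<dots> = (\<Sum>u\<in>UNIV. \<Sum>a\<in>UNIV. \<Sum>w\<in>UNIV. (pivot a * R $ (a, m) $ w * Q $ (a, fst w) $ u) *\<^sub>C x (fst u) (snd u) (snd w) l)"
    by (rule sum.swap)
  also have "\<dots> = (\<Sum>u\<in>UNIV. \<Sum>k\<in>UNIV. (\<Sum>a\<in>UNIV. \<Sum>y\<in>UNIV. (pivot a * R $ (a, m) $ (y, k)) * Q $ (a, y) $ u) *\<^sub>C x (fst u) (snd u) k l)"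
  proof (rule sum.cong[OF refl])
    fix u
    have "(\<Sum>a\<in>UNIV. \<Sum>w\<in>UNIV. (pivot a * R $ (a, m) $ w * Q $ (a, fst w) $ u) *\<^sub>C x (fst u) (snd u) (snd w) l) =
      (\<Sum>a\<in>UNIV. \<Sum>y\<in>UNIV. \<Sum>k\<in>UNIV. (pivot a * R $ (a, m) $ (y, k) * Q $ (a, y) $ u) *\<^sub>C x (fst u) (snd u) k l)"
      by (simp add: sum_UNIV_pair)
    also have "\<dots> = (\<Sum>a\<in>UNIV. \<Sum>k\<in>UNIV. \<Sum>y\<in>UNIV. (pivot a * R $ (a, m) $ (y, k) * Q $ (a, y) $ u) *\<^sub>C x (fst u) (snd u) k l)"
      by (rule sum.cong[OF refl], rule sum.swap)
    also have "\<dots> = (\<Sum>k\<in>UNIV. \<Sum>a\<in>UNIV. \<Sum>y\<in>UNIV. (pivot a * R $ (a, m) $ (y, k) * Q $ (a, y) $ u) *\<^sub>C x (fst u) (snd u) k l)"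
      by (rule sum.swap)
    finally show "(\<Sum>a\<in>UNIV. \<Sum>w\<in>UNIV. (pivot a * R $ (a, m) $ w * Q $ (a, fst w) $ u) *\<^sub>C x (fst u) (snd u) (snd w) l) =
      (\<Sum>k\<in>UNIV. (\<Sum>a\<in>UNIV. \<Sum>y\<in>UNIV. (pivot a * R $ (a, m) $ (y, k)) * Q $ (a, y) $ u) *\<^sub>C x (fst u) (snd u) k l)"
      by (simp add: scaleC_sum_left)
  qed
  also have "\<dots> = (\<Sum>i\<in>UNIV. \<Sum>j\<in>UNIV. \<Sum>k\<in>UNIV. (of_bool (j = k) * of_bool (i = m) * pivot j) *\<^sub>C x i j k l)"
    by (simp add: sum_UNIV_pair pivot_R_Q)
  also have "\<dots> = (\<Sum>i\<in>UNIV. \<Sum>j\<in>UNIV. \<Sum>k\<in>UNIV. if k = j then (of_bool (i = m) * pivot j) *\<^sub>C x i j j l else 0)"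
    by (intro sum.cong) auto
  also have "\<dots> = (\<Sum>i\<in>UNIV. if i = m then (\<Sum>j\<in>UNIV. pivot j *\<^sub>C x m j j l) else 0)"
    by (intro sum.cong) auto
  finally show "contract12 pivot (at23 R (at12 Q x)) m l = contract23 pivot x m l"
    by (simp add: contract23_def)
qed

end

locale projective_data = projective_braidings "rk D" \<pi> \<kappa> z "R_V_V D" "R_V_Vd D" "R_Vd_Vd D"
  for D :: "'n::finite qps" and \<pi> \<kappa> z +
  assumes z_eq: "qp D 1 = z" and \<kappa>_eq: "qp D (const_w D) = \<kappa>" and q_pos: "0 < qpar D"
    and a_eq: "const_a D = 2" and m_eq: "const_m D = real (rk D)"
    and pivot_eq: "qp D (wform (rk D) (wts D i) (two_rho (rk D))) = pivot i"
begin

lemma qp_powers: "qp D (real k) = z ^ k"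
  using qpow_of_nat[OF q_pos, of k] by (simp only: z_eq)

lemma C'2_eq: "C'2 D x = insert23 (\<lambda>a. inverse (pivot a)) x"
  using q_pos by (simp add: C'2_def insert23_def qpow_minus pivot_eq fun_eq_iff)

lemma S_act: "at123 (S_op D) x = at23 (R_V_Vd D) (at12 (R_V_V D) (at23 (matrix_inv (R_V_Vd D)) x))"
  by (simp add: S_op_def at_mult at123_leg12 at123_leg23)

lemma St_act: "at234 (St_op D) x = at23 (R_V_Vd D) (at34 (matrix_inv (R_Vd_Vd D)) (at23 (matrix_inv (R_V_Vd D)) x))"
  by (simp add: St_op_def at_mult at234_leg12 at234_leg23)

lemma S_invertible: "invertible (S_op D)" and St_invertible: "invertible (St_op D)"
  unfolding S_op_def St_op_def
  by (intro invertible_mult invertible_leg invertible_matrix_inv R_invertible Q_invertible P_invertible)+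

lemma S_inv: "at123 (matrix_inv (S_op D)) (at123 (S_op D) x) = x"
  and St_inv: "at234 (matrix_inv (St_op D)) (at234 (St_op D) x) = x"
  by (simp_all add: at_mult[symmetric] inverse_cancel_matrix S_invertible St_invertible at_mat scaleC_fun_def scaleC_one)

text \<open>Both operators are conjugates by \<open>R\<close> on the legs 2 and 3, of \<open>Q\<close> on the legs 1 and 2 and of \<open>P\<^sup>-\<^sup>1\<close> on the
  legs 3 and 4, and these act on disjoint legs.\<close>

lemma S_St_commute: "at123 (S_op D) (at234 (St_op D) x) = at234 (St_op D) (at123 (S_op D) x)"
  by (simp add: S_act St_act at23_R_inv at12_at34_commute)

text \<open>This exchanges the two insertions that occur in the inverse metric: the last two factors of \<open>S\<^sup>~\<close> carry
  \<open>C\<close> from the right of a dual leg to its left, and the first factor turns \<open>C\<close> into a multiple of \<open>C'\<close>.\<close>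

lemma St_C3: "at234 (St_op D) (C3 x) = \<epsilon> *\<^sub>C C'2 D x"
proof -
  have "at234 (St_op D) (C3 x) = at23 (R_V_Vd D) (insert23 (\<lambda>_. 1) x)"
    unfolding R_P_insert23[symmetric] St_act by (simp add: at23_R_inv at34_P_inv)
  then show ?thesis by (simp add: R_insert23 C'2_eq)
qed

lemma St_inv_C'2: "at234 (matrix_inv (St_op D)) (C'2 D x) = inverse \<epsilon> *\<^sub>C C3 x"
proof -
  have "C'2 D x = inverse \<epsilon> *\<^sub>C at234 (St_op D) (C3 x)"
    by (simp add: St_C3 scaleC_fun_def scaleC_scaleC scaleC_one)
  then show ?thesis by (simp add: at_scaleC St_inv)
qed

text \<open>The outermost factor \<open>R\<close> of \<open>S\<close> turns \<open>E\<close> into a multiple of \<open>E'\<close>. Naturality evaluates \<open>E'\<close> after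
  \<open>Q\<^sup>-\<^sup>1\<close>, not after \<open>Q\<close>; the Hecke relation converts one into the other and is responsible for the second
  summand.\<close>

lemma E23_S: "E23 (at123 (S_op D) x) = (\<epsilon> * \<kappa> * \<kappa> / (z * z)) *\<^sub>C contract12 pivot x + \<eta> *\<^sub>C E23 x"
proof -
  define y where "y = at23 (matrix_inv (R_V_Vd D)) x"
  have x: "x = at23 (R_V_Vd D) y" by (simp add: y_def at23_R_inv)
  have Q: "at12 (R_V_V D) y = (\<kappa> * \<kappa> / (z * z)) *\<^sub>C at12 (matrix_inv (R_V_V D)) y + \<eta> *\<^sub>C y"
    by (subst Q_hecke) (simp add: at12_add at_mult at_mat)
  have "contract23 pivot (at12 (matrix_inv (R_V_V D)) y) = contract12 pivot x"
    unfolding contract12_R_Q[symmetric] at12_Q_inv x ..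
  moreover have "\<epsilon> *\<^sub>C contract23 pivot y = E23 x" unfolding x E23_R ..
  moreover have "E23 (at123 (S_op D) x) = \<epsilon> *\<^sub>C contract23 pivot (at12 (R_V_V D) y)"
    by (simp add: S_act y_def E23_R)
  ultimately show ?thesis
    unfolding Q contract23_add contract23_scaleC
  proof -
    assume eqs: "contract23 pivot (at12 (matrix_inv (R_V_V D)) y) = contract12 pivot x"
      "\<epsilon> *\<^sub>C contract23 pivot y = E23 x"
      "E23 (at123 (S_op D) x) = \<epsilon> *\<^sub>C ((\<kappa> * \<kappa> / (z * z)) *\<^sub>C contract23 pivot (at12 (matrix_inv (R_V_V D)) y)
        + \<eta> *\<^sub>C contract23 pivot y)"
    have "E23 (at123 (S_op D) x) = (\<epsilon> * (\<kappa> * \<kappa> / (z * z))) *\<^sub>C contract12 pivot x + \<eta> *\<^sub>C \<epsilon> *\<^sub>C contract23 pivot y"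
      unfolding eqs(3) eqs(1) scaleC_add_right scaleC_scaleC by (simp only: mult.commute)
    then show ?thesis unfolding eqs(2) by (simp add: mult.assoc)
  qed
qed

end

section \<open>Relations of the algebra\<close>

definition complex_linear :: "('m::cvector \<Rightarrow> 'l::cvector) \<Rightarrow> bool" where
  "complex_linear h \<longleftrightarrow> (\<forall>x y. h (x + y) = h x + h y) \<and> (\<forall>c x. h (c *\<^sub>C x) = c *\<^sub>C h x)"

lemma complex_linear_sum:
  assumes "complex_linear h"
  shows "h (sum f A) = (\<Sum>a\<in>A. h (f a))"
proof -
  have "h 0 = 0" using assms scaleC_zero_left[of "0"] unfolding complex_linear_def by (metis scaleC_zero_left)
  then show ?thesis
    using assms by (induction A rule: infinite_finite_induct) (simp_all add: complex_linear_def)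
qed

lemma complex_linear_diff: "complex_linear h \<Longrightarrow> h (x - y) = h x - h y"
  unfolding complex_linear_def by (metis add_diff_cancel_right' diff_add_cancel)

lemma complex_linear_scaleC: "complex_linear h \<Longrightarrow> h (c *\<^sub>C x) = c *\<^sub>C h x"
  and complex_linear_add: "complex_linear h \<Longrightarrow> h (x + y) = h x + h y"
  by (simp_all add: complex_linear_def)

lemma complex_linear_at:
  assumes "complex_linear h"
  shows "h (at123 A x i j k l) = at123 A (\<lambda>i j k l. h (x i j k l)) i j k l"
    and "h (at234 A x i j k l) = at234 A (\<lambda>i j k l. h (x i j k l)) i j k l"
  by (simp_all add: at123_eq at234_eq mat_act_def split_def complex_linear_sum[OF assms]
      complex_linear_scaleC[OF assms])

lemma complex_linear_E'12_E23:
  "complex_linear h \<Longrightarrow> h (E'12 D (E23 x)) = E'12 D (E23 (\<lambda>i j k l. h (x i j k l)))"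
  by (simp add: E'12_def E23_def complex_linear_sum complex_linear_scaleC)

lemma lin_ext_superset:
  "finite A \<Longrightarrow> Poly_Mapping.keys f \<subseteq> A \<Longrightarrow> lin_ext \<phi> f = (\<Sum>k\<in>A. Poly_Mapping.lookup f k *\<^sub>C \<phi> k)"
  unfolding lin_ext_def by (rule sum.mono_neutral_left) (auto simp: in_keys_iff)

lemma complex_linear_lin_ext: "complex_linear (lin_ext \<phi>)"
  unfolding complex_linear_def
proof (intro conjI allI)
  fix f g :: "'a \<Rightarrow>\<^sub>0 complex"
  let ?A = "Poly_Mapping.keys f \<union> Poly_Mapping.keys g \<union> Poly_Mapping.keys (f + g)"
  show "lin_ext \<phi> (f + g) = lin_ext \<phi> f + lin_ext \<phi> g"
    unfolding lin_ext_superset[of ?A f, OF _ order_trans[OF Un_upper1 Un_upper1], simplified]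
      lin_ext_superset[of ?A g, OF _ order_trans[OF Un_upper2 Un_upper1], simplified]
      lin_ext_superset[of ?A "f + g", OF _ Un_upper2, simplified]
    by (simp add: lookup_add scaleC_add_left sum.distrib)
next
  fix c and f :: "'a \<Rightarrow>\<^sub>0 complex"
  let ?A = "Poly_Mapping.keys f \<union> Poly_Mapping.keys (c *\<^sub>C f)"
  show "lin_ext \<phi> (c *\<^sub>C f) = c *\<^sub>C lin_ext \<phi> f"
    unfolding lin_ext_superset[of ?A f, OF _ Un_upper1, simplified]
      lin_ext_superset[of ?A "c *\<^sub>C f", OF _ Un_upper2, simplified]
    by (simp add: lookup_scaleC scaleC_sum_right scaleC_scaleC scaleC_complex_def)
qed

lemma lin_ext_single: "lin_ext \<phi> (Poly_Mapping.single k c) = c *\<^sub>C \<phi> k"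
  by (cases "c = 0") (simp_all add: lin_ext_def)

text \<open>The defining relations hold in the presented algebra, since a relation lies in the ideal it generates.\<close>

lemma presented_algebra_relation:
  fixes g :: "'x \<Rightarrow> 'b::calgebra_1"
  assumes "presented_algebra g R" "f \<in> R"
  shows "lin_ext (\<lambda>w. prod_list (map g (letters w))) f = 0"
proof -
  have "\<exists>x f' y. f = x * f' * y \<and> f' \<in> R"
    using assms(2) by (intro exI[of _ 1] exI[of _ f]) simp
  then have "f \<in> ideal_of R"
    unfolding ideal_of_def by (intro add_span.base) blast
  then show ?thesis using assms(1) by (simp add: presented_algebra_def Let_def)
qed

lemma entries_mem: "x i j k l \<in> entries x"
  by (auto simp: entries_def)

context
  fixes D :: "'n::finite qps" and p :: "'n \<Rightarrow> 'n \<Rightarrow> 'b::calgebra_1"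
  assumes alg: "is_qps_algebra D p"
begin

abbreviation (input) "evaluate \<equiv> lin_ext (\<lambda>w. prod_list (map (\<lambda>(i, j). p i j) (letters w)))"

lemma evaluate_gen: "evaluate (free_gen (i, j)) = p i j"
  by (simp add: free_gen_def lin_ext_single scaleC_one)

lemma evaluate_one: "evaluate 1 = 1"
  unfolding one_poly_mapping.abs_eq[symmetric]
  by (simp flip: single_one add: lin_ext_single scaleC_one zero_word_def)

lemma evaluate_gen_gen: "evaluate (free_gen (i, j) * free_gen (k, l)) = p i j * p k l"
  by (simp add: free_gen_def mult_single lin_ext_single scaleC_one plus_word_def)

lemma evaluate_zero: "f \<in> B_relations D (\<lambda>i j. free_gen (i, j)) \<Longrightarrow> evaluate f = 0"
  using presented_algebra_relation[OF alg[unfolded is_qps_algebra_def]] .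

lemma algebra_S: "at123 (S_op D) (fprod (*) p p) = qp D (const_w D) *\<^sub>C fprod (*) p p"
proof (intro ext)
  fix i j k l
  let ?P = "\<lambda>i j. free_gen (i, j) :: ('n \<times> 'n) word \<Rightarrow>\<^sub>0 complex"
  have "evaluate ((at123 (S_op D) (fprod (*) ?P ?P) - qp D (const_w D) *\<^sub>C fprod (*) ?P ?P) i j k l) = 0"
    by (rule evaluate_zero, unfold B_relations_def, rule UnI1, rule UnI1, rule entries_mem)
  then show "at123 (S_op D) (fprod (*) p p) i j k l = (qp D (const_w D) *\<^sub>C fprod (*) p p) i j k l"
    by (simp add: complex_linear_diff[OF complex_linear_lin_ext] complex_linear_at[OF complex_linear_lin_ext]
        complex_linear_scaleC[OF complex_linear_lin_ext] scaleC_fun_def fprod_def evaluate_gen_gen)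
qed

lemma algebra_St: "at234 (St_op D) (fprod (*) p p) = qp D (- const_w D) *\<^sub>C fprod (*) p p"
proof (intro ext)
  fix i j k l
  let ?P = "\<lambda>i j. free_gen (i, j) :: ('n \<times> 'n) word \<Rightarrow>\<^sub>0 complex"
  have "evaluate ((at234 (St_op D) (fprod (*) ?P ?P) - qp D (- const_w D) *\<^sub>C fprod (*) ?P ?P) i j k l) = 0"
    by (rule evaluate_zero, unfold B_relations_def, rule UnI1, rule UnI2, rule entries_mem)
  then show "at234 (St_op D) (fprod (*) p p) i j k l = (qp D (- const_w D) *\<^sub>C fprod (*) p p) i j k l"
    by (simp add: complex_linear_diff[OF complex_linear_lin_ext] complex_linear_at[OF complex_linear_lin_ext]
        complex_linear_scaleC[OF complex_linear_lin_ext] scaleC_fun_def fprod_def evaluate_gen_gen)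
qed

lemma algebra_E': "E'12 D p = qp D (const_m D) *\<^sub>C 1"
proof -
  let ?P = "\<lambda>i j. free_gen (i, j) :: ('n \<times> 'n) word \<Rightarrow>\<^sub>0 complex"
  have "evaluate (E'12 D ?P - qp D (const_m D) *\<^sub>C 1) = 0"
    by (rule evaluate_zero) (auto simp: B_relations_def)
  then show ?thesis
    by (simp add: complex_linear_diff[OF complex_linear_lin_ext] complex_linear_scaleC[OF complex_linear_lin_ext]
        complex_linear_sum[OF complex_linear_lin_ext] E'12_def evaluate_gen evaluate_one)
qed

end

section \<open>Traces and the projection property\<close>

context projective_data begin

lemma geometric: "(1 - u) * (\<Sum>a\<in>UNIV. u ^ (\<pi> a - 1)) = 1 - u ^ Suc (rk D)" for u :: complex
proof -
  have "(\<Sum>a\<in>UNIV. u ^ (\<pi> a - 1)) = (\<Sum>k=1..rk D + 1. u ^ (k - 1))"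
    by (rule sum_\<pi>)
  also have "\<dots> = (\<Sum>k<Suc (rk D). u ^ k)"
    by (rule sum.reindex_bij_witness[of _ Suc "\<lambda>k. k - 1"]) auto
  finally show ?thesis by (simp only: one_diff_power_eq)
qed

text \<open>The value of the inverse metric on \<open>g\<^bsub>-+\<^esub>\<close> is \<open>q\<^sup>m [r + 1]\<^sub>q - 1\<close>. Its product with \<open>1 - q\<^sup>2\<close> telescopes,
  and this product is what the braiding involves.\<close>

lemma metric_trace_mp: "(1 - z * z) * (z ^ rk D * (\<Sum>a\<in>UNIV. inverse (pivot a)) - 1) = z * z * (1 - z ^ rk D * z ^ rk D)"
proof -
  have "z ^ rk D * inverse (pivot a) = (z * z) ^ (\<pi> a - 1)" for a
    by (simp add: pivot_def t_def power_inverse power_mult_distrib field_simps)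
  then have "z ^ rk D * (\<Sum>a\<in>UNIV. inverse (pivot a)) = (\<Sum>a\<in>UNIV. (z * z) ^ (\<pi> a - 1))"
    by (simp only: sum_distrib_left)
  then have "(1 - z * z) * (z ^ rk D * (\<Sum>a\<in>UNIV. inverse (pivot a)) - 1) = 1 - (z * z) ^ Suc (rk D) - (1 - z * z)"
    by (simp only: right_diff_distrib geometric mult_1_right)
  then show ?thesis by (simp add: power_mult_distrib algebra_simps)
qed

text \<open>The corresponding computation for \<open>g\<^bsub>+-\<^esub>\<close>, whose value is \<open>q\<^bsup>-m\<^esup> [r + 1]\<^sub>q - 1\<close>.\<close>

lemma metric_trace_pm: "(1 - t) * (inverse (z ^ rk D) * (\<Sum>a\<in>UNIV. pivot a) - 1) = t * (1 - t ^ rk D)"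
proof -
  have "inverse (z ^ rk D) * pivot a = t ^ (\<pi> a - 1)" for a
    by (simp add: pivot_def)
  then have "inverse (z ^ rk D) * (\<Sum>a\<in>UNIV. pivot a) = (\<Sum>a\<in>UNIV. t ^ (\<pi> a - 1))"
    by (simp only: sum_distrib_left)
  then have "(1 - t) * (inverse (z ^ rk D) * (\<Sum>a\<in>UNIV. pivot a) - 1) = 1 - t ^ Suc (rk D) - (1 - t)"
    by (simp only: right_diff_distrib geometric mult_1_right)
  then show ?thesis by (simp add: algebra_simps)
qed

context
  fixes p :: "'n \<Rightarrow> 'n \<Rightarrow> 'b::calgebra_1"
  assumes alg: "is_qps_algebra D p"
begin

abbreviation (input) "pp \<equiv> fprod (*) p p"

lemma S_pp: "at123 (S_op D) pp = \<kappa> *\<^sub>C pp"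
  using algebra_S[OF alg] by (simp add: \<kappa>_eq)

lemma St_pp: "at234 (St_op D) pp = inverse \<kappa> *\<^sub>C pp"
  using algebra_St[OF alg] q_pos by (simp add: qpow_minus \<kappa>_eq)

lemma E'_p: "E'12 D p = z ^ rk D *\<^sub>C 1"
  using algebra_E'[OF alg] by (simp add: m_eq qp_powers)

lemma S_inv_pp: "at123 (matrix_inv (S_op D)) pp = inverse \<kappa> *\<^sub>C pp"
proof -
  have "pp = inverse \<kappa> *\<^sub>C at123 (S_op D) pp" by (simp add: S_pp scaleC_scaleC scaleC_one)
  then have "at123 (matrix_inv (S_op D)) pp = at123 (matrix_inv (S_op D)) (inverse \<kappa> *\<^sub>C at123 (S_op D) pp)" by simp
  then show ?thesis by (simp only: at_scaleC S_inv)
qed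

lemma St_inv_pp: "at234 (matrix_inv (St_op D)) pp = \<kappa> *\<^sub>C pp"
proof -
  have "pp = \<kappa> *\<^sub>C at234 (St_op D) pp" by (simp add: St_pp scaleC_scaleC scaleC_one)
  then have "at234 (matrix_inv (St_op D)) pp = at234 (matrix_inv (St_op D)) (\<kappa> *\<^sub>C at234 (St_op D) pp)" by simp
  then show ?thesis by (simp only: at_scaleC St_inv)
qed

text \<open>The matrix of generators is a projection. Contracting the relation \<open>S pp = q\<^sup>w pp\<close> gives
  \<open>q\<^bsup>w-2\<^esup> p + (q\<^sup>w - q\<^bsup>w-2\<^esup>) E pp = q\<^sup>w E pp\<close>, and \<open>q\<^bsup>w-2\<^esup>\<close> can be cancelled.\<close>

lemma E23_pp: "E23 pp = p"
proof -
  \<comment> \<open>Contracting the first two legs of \<open>pp\<close> gives \<open>(E' p) p\<close>, and \<open>E' p = q\<^sup>m\<close>.\<close>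
  have c: "contract12 pivot pp = z ^ rk D *\<^sub>C p"
  proof (intro ext)
    fix k l
    have "contract12 pivot pp k l = E'12 D p * p k l"
      by (simp add: contract12_def E'12_def fprod_def pivot_eq sum_distrib_right mult_scaleC_left)
    then show "contract12 pivot pp k l = (z ^ rk D *\<^sub>C p) k l"
      by (simp add: E'_p mult_scaleC_left scaleC_fun_def)
  qed
  have "\<kappa> *\<^sub>C E23 pp = (\<epsilon> * \<kappa> * \<kappa> / (z * z)) *\<^sub>C z ^ rk D *\<^sub>C p + \<eta> *\<^sub>C E23 pp"
    using E23_S[of pp] by (simp add: S_pp E23_scaleC c)
  then have "(\<kappa> - \<eta>) *\<^sub>C E23 pp = (\<epsilon> * \<kappa> * \<kappa> / (z * z) * z ^ rk D) *\<^sub>C p"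
    by (simp only: scaleC_diff_left scaleC_scaleC diff_eq_eq)
  moreover have "\<kappa> - \<eta> = \<kappa> / (z * z)" "\<epsilon> * \<kappa> * \<kappa> / (z * z) * z ^ rk D = \<kappa> / (z * z)"
    by (simp_all add: \<eta>_def \<epsilon>_def field_simps)
  ultimately have "(\<kappa> / (z * z)) *\<^sub>C E23 pp = (\<kappa> / (z * z)) *\<^sub>C p" by (simp only:)
  then have "((z * z / \<kappa>) * (\<kappa> / (z * z))) *\<^sub>C E23 pp = ((z * z / \<kappa>) * (\<kappa> / (z * z))) *\<^sub>C p"
    by (simp only: scaleC_scaleC[symmetric])
  then show ?thesis by (simp add: scaleC_one)
qed

lemma E23_C'2: "E23 (C'2 D p) = (\<Sum>a\<in>UNIV. inverse (pivot a)) *\<^sub>C p"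
  by (simp add: C'2_eq E23_def insert23_def scaleC_fun_def scaleC_sum_left)

lemma E'_E23_S_C3:
  "E'12 D (E23 (at123 (S_op D) (C3 p))) =
     (\<epsilon> * \<kappa> * \<kappa> / (z * z) * (\<Sum>a\<in>UNIV. pivot a) * z ^ rk D + \<eta> * z ^ rk D) *\<^sub>C 1"
proof -
  have "E23 (C3 p) = p" by (simp add: E23_def C3_def fun_eq_iff eq_commute[of _ "_ :: 'n"])
  moreover have "E'12 D (contract12 pivot (C3 p)) = ((\<Sum>a\<in>UNIV. pivot a) * z ^ rk D) *\<^sub>C 1"
  proof -
    have "contract12 pivot (C3 p) = (\<lambda>k l. if k = l then E'12 D p else 0)"
      by (auto simp: contract12_def C3_def E'12_def pivot_eq fun_eq_iff)
    then have "E'12 D (contract12 pivot (C3 p)) = (\<Sum>a\<in>UNIV. pivot a *\<^sub>C E'12 D p)"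
      by (simp add: E'12_def[of D "\<lambda>k l. if k = l then _ else _"] pivot_eq)
    then show ?thesis by (simp add: E'_p scaleC_sum_left[symmetric] scaleC_scaleC sum_distrib_right)
  qed
  ultimately show ?thesis
    by (simp add: E23_S E'12_add E'12_scaleC E'_p scaleC_scaleC scaleC_add_left mult.assoc)
qed

end

end

section \<open>The inverse metric and the generalized braiding\<close>

context projective_data begin

lemma qp_constants:
  "qp D (const_a D) = z * z" "qp D (- const_a D) = t"
  "qp D (const_m D) = z ^ rk D" "qp D (- const_m D) = inverse (z ^ rk D)"
  "qp D (- const_w D - const_m D) = \<epsilon>"
  "qp D (2 * const_a D - 2 * const_w D) = (z * z) * (z * z) / (\<kappa> * \<kappa>)"
  "qp D (2 * const_w D - 2 * const_a D) = \<kappa> * \<kappa> * (t * t)"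
  "qp D (2 * const_m D) = z ^ rk D * z ^ rk D" "qp D (- (2 * const_m D)) = inverse (z ^ rk D * z ^ rk D)"
proof -
  have a: "qp D (const_a D) = z * z"
    unfolding a_eq using qpow_add[OF q_pos, of 1 1] by (simp add: z_eq)
  have m: "qp D (const_m D) = z ^ rk D" unfolding m_eq by (rule qp_powers)
  note add = qpow_add[OF q_pos] and minus = qpow_minus[OF q_pos]
  have d: "qp D (x - y) = qp D x * inverse (qp D y)" for x y
    using add[of x "- y"] minus[of y] by simp
  have dbl: "qp D (2 * x) = qp D x * qp D x" for x using add[of x x] by simp
  show "qp D (const_a D) = z * z" "qp D (- const_a D) = t"
    "qp D (const_m D) = z ^ rk D" "qp D (- const_m D) = inverse (z ^ rk D)"
    by (simp_all only: a m minus t_def)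
  show "qp D (- const_w D - const_m D) = \<epsilon>"
    "qp D (2 * const_a D - 2 * const_w D) = (z * z) * (z * z) / (\<kappa> * \<kappa>)"
    "qp D (2 * const_w D - 2 * const_a D) = \<kappa> * \<kappa> * (t * t)"
    "qp D (2 * const_m D) = z ^ rk D * z ^ rk D" "qp D (- (2 * const_m D)) = inverse (z ^ rk D * z ^ rk D)"
    unfolding minus[of "2 * const_m D"] d dbl minus a m \<kappa>_eq \<epsilon>_def t_def
    by (simp_all add: divide_inverse)
qed

text \<open>On each side only two kinds of terms occur: one insertion of \<open>C\<close> or \<open>C'\<close>, and \<open>pp\<close>. The insertions match
  because \<open>S\<^sup>~\<close> exchanges \<open>C\<close> and \<open>C'\<close>. The coefficient of \<open>pp\<close> gets contributions from the eigenvalues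
  of \<open>S\<close> and \<open>S\<^sup>~\<close> on \<open>pp\<close> and from the summand \<open>p g p\<close> of the braiding, on which the metric is
  a scalar multiple of \<open>pp\<close>.\<close>

lemma metric_intertwines_braiding:
  fixes p :: "'n \<Rightarrow> 'n \<Rightarrow> 'b::calgebra_1" and lt :: "'b \<Rightarrow> 't::cvector \<Rightarrow> 't"
  assumes alg: "is_qps_algebra D p"
    and bim: "cbimodule lt rt"
    and metric: "is_inverse_metric D p lt rt tens dp dbp met"
    and braiding: "is_generalized_braiding D p lt rt tens dp dbp \<sigma>"
  shows "met (\<sigma> (tens (dp i j) (dbp k l))) = (z * z * (z ^ rk D * z ^ rk D)) *\<^sub>C met (tens (dp i j) (dbp k l))"
    and "met (\<sigma> (tens (dbp i j) (dp k l))) = (t * inverse (z ^ rk D * z ^ rk D)) *\<^sub>C met (tens (dbp i j) (dp k l))"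
proof -
  let ?pp = "fprod (*) p p" and ?pair = "\<lambda>x y. met (tens x y)" and ?Z = "z ^ rk D"
  have met: "met (x + y) = met x + met y" "met (lt b x) = b * met x" "met (rt x b) = met x * b" for x y b
    using metric by (simp_all add: is_inverse_metric_def bimodule_map_def Let_def)
  have lin: "complex_linear met"
    unfolding complex_linear_def
  proof (intro conjI allI)
    fix c x
    have "met (c *\<^sub>C x) = met (lt (c *\<^sub>C 1) x)" using bim by (simp add: cbimodule.lact_scaleC_one)
    then show "met (c *\<^sub>C x) = c *\<^sub>C met x" by (simp add: met mult_scaleC_left)
  qed (rule met)
  have pm: "fprod ?pair dp dbp = (z * z * \<epsilon>) *\<^sub>C at123 (S_op D) (C3 p) - (z * z * inverse ?Z) *\<^sub>C ?pp"
    and mp: "fprod ?pair dbp dp = C'2 D p - inverse ?Z *\<^sub>C ?pp"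
    using metric by (simp_all only: is_inverse_metric_def Let_def qp_constants)
  have br_pm: "fprod (\<lambda>x y. \<sigma> (tens x y)) dp dbp =
      ((z * z) * (z * z) / (\<kappa> * \<kappa>)) *\<^sub>C at123 (S_op D) (at234 (matrix_inv (St_op D)) (fprod tens dbp dp)) +
      ((1 - z * z) * (z * z) * inverse ?Z) *\<^sub>C fprod (\<lambda>b c. lt b (rt (g_mp D tens dp dbp) c)) p p"
    and br_mp: "fprod (\<lambda>x y. \<sigma> (tens x y)) dbp dp =
      (\<kappa> * \<kappa> * (t * t)) *\<^sub>C at123 (matrix_inv (S_op D)) (at234 (St_op D) (fprod tens dp dbp)) +
      ((1 - t) * inverse ?Z) *\<^sub>C fprod (\<lambda>b c. lt b (rt (g_pm D tens dp dbp) c)) p p"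
    using braiding by (simp_all only: is_generalized_braiding_def Let_def qp_constants)
  define \<gamma> where "\<gamma> = ?Z * (\<Sum>a\<in>UNIV. inverse (pivot a)) - 1"
  define \<gamma>' where "\<gamma>' = inverse ?Z * (\<Sum>a\<in>UNIV. pivot a) - 1"
  have g_mp: "met (g_mp D tens dp dbp) = \<gamma> *\<^sub>C 1"
  proof -
    have "met (g_mp D tens dp dbp) = E'12 D (E23 (fprod ?pair dbp dp))"
      by (simp add: g_mp_def complex_linear_E'12_E23[OF lin] fprod_def)
    also have "\<dots> = \<gamma> *\<^sub>C 1"
      unfolding mp E23_diff E23_scaleC E23_pp[OF alg] E23_C'2[OF alg] E'12_diff E'12_scaleC E'_p[OF alg]
        scaleC_scaleC scaleC_diff_left[symmetric] by (simp add: \<gamma>_def right_diff_distrib mult.commute)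
    finally show ?thesis .
  qed
  have g_pm: "met (g_pm D tens dp dbp) = \<gamma>' *\<^sub>C 1"
  proof -
    have "met (g_pm D tens dp dbp) = E'12 D (E23 (fprod ?pair dp dbp))"
      by (simp add: g_pm_def complex_linear_E'12_E23[OF lin] fprod_def)
    also have "\<dots> = (z * z * \<epsilon> * (\<epsilon> * \<kappa> * \<kappa> / (z * z) * (\<Sum>a\<in>UNIV. pivot a) * ?Z + \<eta> * ?Z) - z * z * inverse ?Z * ?Z) *\<^sub>C 1"
      unfolding pm E23_diff E23_scaleC E23_pp[OF alg] E'12_diff E'12_scaleC E'_p[OF alg] E'_E23_S_C3[OF alg]
        scaleC_scaleC scaleC_diff_left[symmetric] ..
    also have "z * z * \<epsilon> * (\<epsilon> * \<kappa> * \<kappa> / (z * z) * (\<Sum>a\<in>UNIV. pivot a) * ?Z + \<eta> * ?Z) - z * z * inverse ?Z * ?Z = \<gamma>'"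
      by (simp add: \<gamma>'_def \<epsilon>_def \<eta>_def field_simps)
    finally show ?thesis .
  qed
  have sandwich: "(\<lambda>i j k l. met (fprod (\<lambda>b c. lt b (rt g c)) p p i j k l)) = u *\<^sub>C ?pp"
    if "met g = u *\<^sub>C 1" for g u
    using that by (simp add: fprod_def met scaleC_fun_def mult_scaleC_left mult_scaleC_right)
  have "(\<lambda>i j k l. met (fprod (\<lambda>x y. \<sigma> (tens x y)) dp dbp i j k l)) =
      ((z * z) * (z * z) / (\<kappa> * \<kappa>)) *\<^sub>C at123 (S_op D) (at234 (matrix_inv (St_op D)) (fprod ?pair dbp dp)) +
      ((1 - z * z) * (z * z) * inverse ?Z) *\<^sub>C \<gamma> *\<^sub>C ?pp"
    unfolding br_pm sandwich[OF g_mp, symmetric]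
    by (simp add: fun_eq_iff scaleC_fun_def complex_linear_add[OF lin] complex_linear_scaleC[OF lin] complex_linear_at[OF lin] fprod_def)
  also have "\<dots> = ((z * z) * (z * z) / (\<kappa> * \<kappa>) * inverse \<epsilon>) *\<^sub>C at123 (S_op D) (C3 p)
      - ((z * z) * (z * z) / (\<kappa> * \<kappa>) * inverse ?Z * \<kappa> * \<kappa> - (1 - z * z) * (z * z) * inverse ?Z * \<gamma>) *\<^sub>C ?pp"
    unfolding mp at_diff at_scaleC St_inv_C'2 St_inv_pp[OF alg] S_pp[OF alg] scaleC_scaleC scaleC_diff_right scaleC_diff_left
    by (simp add: mult_ac)
  also have "(z * z) * (z * z) / (\<kappa> * \<kappa>) * inverse \<epsilon> = z * z * (?Z * ?Z) * (z * z * \<epsilon>)"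
    by (simp add: \<epsilon>_def field_simps)
  also have "(z * z) * (z * z) / (\<kappa> * \<kappa>) * inverse ?Z * \<kappa> * \<kappa> - (1 - z * z) * (z * z) * inverse ?Z * \<gamma>
      = z * z * (?Z * ?Z) * (z * z * inverse ?Z)"
  proof -
    have "(1 - z * z) * (z * z) * inverse ?Z * \<gamma> = (z * z) * inverse ?Z * ((1 - z * z) * \<gamma>)" by (simp add: mult_ac)
    also have "(1 - z * z) * \<gamma> = z * z * (1 - ?Z * ?Z)" unfolding \<gamma>_def by (rule metric_trace_mp)
    finally show ?thesis by (simp add: field_simps)
  qed
  finally have "(\<lambda>i j k l. met (fprod (\<lambda>x y. \<sigma> (tens x y)) dp dbp i j k l)) = (z * z * (?Z * ?Z)) *\<^sub>C fprod ?pair dp dbp"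
    unfolding pm scaleC_diff_right scaleC_scaleC .
  then show "met (\<sigma> (tens (dp i j) (dbp k l))) = (z * z * (?Z * ?Z)) *\<^sub>C met (tens (dp i j) (dbp k l))"
    by (simp add: fun_eq_iff fprod_def scaleC_fun_def)
  have "(\<lambda>i j k l. met (fprod (\<lambda>x y. \<sigma> (tens x y)) dbp dp i j k l)) =
      (\<kappa> * \<kappa> * (t * t)) *\<^sub>C at123 (matrix_inv (S_op D)) (at234 (St_op D) (fprod ?pair dp dbp)) +
      ((1 - t) * inverse ?Z) *\<^sub>C \<gamma>' *\<^sub>C ?pp"
    unfolding br_mp sandwich[OF g_pm, symmetric]
    by (simp add: fun_eq_iff scaleC_fun_def complex_linear_add[OF lin] complex_linear_scaleC[OF lin] complex_linear_at[OF lin] fprod_def)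
  also have "\<dots> = (\<kappa> * \<kappa> * (t * t) * (z * z * \<epsilon>) * \<epsilon>) *\<^sub>C C'2 D p
      - (\<kappa> * \<kappa> * (t * t) * (z * z * inverse ?Z) * inverse \<kappa> * inverse \<kappa> - (1 - t) * inverse ?Z * \<gamma>') *\<^sub>C ?pp"
    unfolding pm at_diff at_scaleC S_St_commute[symmetric] St_C3 St_pp[OF alg] S_inv S_inv_pp[OF alg]
      scaleC_scaleC scaleC_diff_right scaleC_diff_left
    by (simp add: mult_ac)
  also have "\<kappa> * \<kappa> * (t * t) * (z * z * \<epsilon>) * \<epsilon> = t * inverse (?Z * ?Z)"
    by (simp add: \<epsilon>_def t_def field_simps)
  also have "\<kappa> * \<kappa> * (t * t) * (z * z * inverse ?Z) * inverse \<kappa> * inverse \<kappa> - (1 - t) * inverse ?Z * \<gamma>'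
      = t * inverse (?Z * ?Z) * inverse ?Z"
  proof -
    have "(1 - t) * inverse ?Z * \<gamma>' = inverse ?Z * ((1 - t) * \<gamma>')" by (simp add: mult_ac)
    also have "(1 - t) * \<gamma>' = t * (1 - t ^ rk D)" unfolding \<gamma>'_def by (rule metric_trace_pm)
    also have "t ^ rk D = inverse (?Z * ?Z)" by (simp add: t_def power_inverse power_mult_distrib)
    finally have 1: "(1 - t) * inverse ?Z * \<gamma>' = inverse ?Z * (t * (1 - inverse (?Z * ?Z)))" .
    have 2: "\<kappa> * \<kappa> * (t * t) * (z * z * inverse ?Z) * inverse \<kappa> * inverse \<kappa> = t * inverse ?Z"
      by (simp add: t_def field_simps)
    show ?thesis unfolding 1 2 by (simp add: algebra_simps)
  qed
  finally have "(\<lambda>i j k l. met (fprod (\<lambda>x y. \<sigma> (tens x y)) dbp dp i j k l)) = (t * inverse (?Z * ?Z)) *\<^sub>C fprod ?pair dbp dp"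
    unfolding mp scaleC_diff_right scaleC_scaleC .
  then show "met (\<sigma> (tens (dbp i j) (dp k l))) = (t * inverse (?Z * ?Z)) *\<^sub>C met (tens (dbp i j) (dp k l))"
    by (simp add: fun_eq_iff fprod_def scaleC_fun_def)
qed

end

text \<open>The standard forms of \<open>V\<close> and of its dual supply the entries of all three braidings, and the positions
  of the basis vectors supply the pivotal weights.\<close>

lemma qps_projective_data:
  assumes D: "qps_data D"
  shows "\<exists>\<pi> \<kappa> z. projective_data D \<pi> \<kappa> z"
proof -
  let ?r = "rk D" and ?q = "qpar D" and ?s = "node D"
  have q: "0 < ?q" "?q < 1" using D by (auto simp: qps_data_def)
  have s: "?s \<in> {1..?r}" using D by (auto simp: qps_data_def)
  interpret weighted_simple ?r ?q ?s "Vrep D" "wts D"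
    by standard (use D in \<open>auto simp: qps_data_def\<close>)
  obtain \<tau> \<iota> c where rep: "vector_rep ?r ?q \<tau> \<iota> c (Vrep D)" "\<tau> 1 = ?s"
    using vector_rep_exists by blast
  interpret V: vector_rep ?r ?q \<tau> \<iota> c "Vrep D" by (rule rep)
  interpret B: projective_braidings ?r V.\<pi> V.\<kappa> V.z "R_V_V D" "R_V_Vd D" "R_Vd_Vd D"
    by standard (use D V.\<pi>_bij in \<open>auto simp: qps_data_def V.braiding_self_entry V.braiding_dual_entry V.braiding_dual_dual_entry\<close>)
  have pow: "qpow ?q (real k) = V.z ^ k" for k
    unfolding V.z_def by (rule qpow_of_nat[OF q(1)])
  have "projective_data D V.\<pi> V.\<kappa> V.z"
  proof
    show "qp D 1 = V.z" by (simp add: V.z_def)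
    show "qp D (const_w D) = V.\<kappa>"
      using V.wform_ends(1) rep(2) by (simp add: const_w_def V.\<kappa>_def)
    show "0 < ?q" by (fact q)
    show "const_a D = 2" using wform_sroot_sroot[OF s, of ?s] by (simp add: const_a_def)
    show "const_m D = real ?r"
    proof -
      have "const_m D = (\<Sum>i=1..?r. if i = ?s then real ?s * (real ?r + 1 - real ?s) else 0)"
        unfolding const_m_def wform_two_rho_expand
        by (intro sum.cong) (auto simp: wform_sroot_fweight[OF _ s])
      then have "const_m D = real ?s * (real ?r + 1 - real ?s)" using s by simp
      then show ?thesis using D by (auto simp: qps_data_def)
    qed
    fix i
    have "wform ?r (wts D i) (two_rho ?r) = real ?r + 2 - 2 * real (V.\<pi> i)"
      using weights[of i] by (intro V.pairing_two_rho) (simp add: weight_vector_def)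
    also have "\<dots> = real ?r + - (real (2 * (V.\<pi> i - 1)))"
      using V.\<pi>_in[of i] by (simp add: of_nat_diff)
    finally have w: "wform ?r (wts D i) (two_rho ?r) = real ?r + - (real (2 * (V.\<pi> i - 1)))" .
    show "qp D (wform ?r (wts D i) (two_rho ?r)) = B.pivot i"
      unfolding w qpow_add[OF q(1)] qpow_minus[OF q(1)] pow B.pivot_def B.t_def
      by (simp only: power_mult power2_eq_square power_inverse)
  qed
  then show ?thesis by blast
qed

theorem proposition4p7:
  fixes D :: "'n::finite qps"
    and p :: "'n \<Rightarrow> 'n \<Rightarrow> 'b::calgebra_1"
    and lact :: "'b \<Rightarrow> 'o::cvector \<Rightarrow> 'o" and ract :: "'o \<Rightarrow> 'b \<Rightarrow> 'o"
    and dp dbp :: "'n \<Rightarrow> 'n \<Rightarrow> 'o"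
    and lt :: "'b \<Rightarrow> 't::cvector \<Rightarrow> 't" and rt :: "'t \<Rightarrow> 'b \<Rightarrow> 't"
    and tens :: "'o \<Rightarrow> 'o \<Rightarrow> 't"
    and met :: "'t \<Rightarrow> 'b" and \<sigma> :: "'t \<Rightarrow> 't"
  assumes "qps_data D"
    and "is_qps_algebra D p"
    and "is_hk_calculus D p lact ract dp dbp"
    and "is_tensor_square lact ract lt rt tens"
    and "is_inverse_metric D p lt rt tens dp dbp met"
    and "is_generalized_braiding D p lt rt tens dp dbp \<sigma>"
  shows "(\<forall>i j k l. (met \<circ> \<sigma>) (tens (dp i j) (dbp k l)) =
            (qpow (qpar D) (wform (rk D) (sroot (node D)) (sroot (node D))) *
             qpow (qpar D) (2 * wform (rk D) (fweight (rk D) (node D)) (two_rho (rk D))))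
            *\<^sub>C met (tens (dp i j) (dbp k l))) \<and>
         (\<forall>i j k l. (met \<circ> \<sigma>) (tens (dbp i j) (dp k l)) =
            (qpow (qpar D) (- wform (rk D) (sroot (node D)) (sroot (node D))) *
             qpow (qpar D) (- (2 * wform (rk D) (fweight (rk D) (node D)) (two_rho (rk D)))))
            *\<^sub>C met (tens (dbp i j) (dp k l)))"
proof -
  obtain \<pi> \<kappa> z where "projective_data D \<pi> \<kappa> z"
    using qps_projective_data[OF assms(1)] by blast
  then interpret projective_data D \<pi> \<kappa> z .
  have "cbimodule lt rt" using assms(4) by (simp add: is_tensor_square_def)
  note main = metric_intertwines_braiding[OF assms(2) this assms(5,6)]
  show ?thesis
    unfolding comp_def main const_a_def[symmetric] const_m_def[symmetric] qp_constants by simp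
qed

end
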